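(* Consider the Cauchy problem $$u_{tt}-\Delta u+b(t)u_t-g(t)\Delta u_t=0,\quad (t,x)\in[0,\infty)\times\mathbb{R}^n,\qquad u(0,x)=u_0(x),\quad u_t(0,x)=u_1(x),\quad x\in\mathbb{R}^n.$$ Assume that the strictly positive coefficient $b$ satisfies: (B1) $b\in\mathcal C^2([0,\infty))$; (B2) $b'(t)$ does not change its sign and $t\,b(t)\to\infty$ as $t\to\infty$; (B3) $\dfrac{|b^{(k)}(t)|}{b(t)}\lesssim\dfrac1{(1+t)^k}$ for $k=1,2$; (EF) $|b'(t)|\le a\,b^2(t)$ with a constant $a<1$; and that the coefficient $g$ satisfies for all $t\in[0,\infty)$: (E1) $g(t)>0$ and $g'(t)<0$; (E2) $g\in L^1([0,\infty))$; (E3) $b(t)g(t)\le\frac12$; (E4) $\dfrac{b'(t)}{b(t)}\le-\dfrac{g'(t)}{g(t)}$; (E5) $\dfrac{(g')^2}{g}\in L^1([0,\infty))$; and moreover $-g'(t)\le 2-\varepsilon_0$ for all $t\ge0$ with some $\varepsilon_0>0$. Then there is a (sufficiently large) $t_0$ such that for all $t\ge t_0$ Sobolev solutions satisfy $$\||D|^{|\beta|}u(t,\cdot)\|_{L^2}\lesssim\Big(1+\int_{t_0}^t\frac{d\tau}{b(\tau)}\Big)^{-\frac{|\beta|}2}\|u_0\|_{H^{|\beta|}}+\Big(1+\int_{t_0}^t\frac{d\tau}{b(\tau)}\Big)^{-\frac{|\beta|-1}2}\|u_1\|_{H^{|\beta|-1}}\quad\text{for }|\beta|\ge1,$$ $$\||D|^{|\beta|}u_t(t,\cdot)\|_{L^2}\lesssim\Big(1+\int_{t_0}^t\frac{d\tau}{b(\tau)}\Big)^{-\frac{|\beta|+1}2}\|u_0\|_{H^{|\beta|+1}}+\Big(1+\int_{t_0}^t\frac{d\tau}{b(\tau)}\Big)^{-\frac{|\beta|}2}\|u_1\|_{H^{|\beta|}}\quad\text{for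 }|\beta|\ge0.$$
   Context: $f\lesssim h$ means $f\le Ch$ with a constant $C>0$ independent of $t$ and of the data. $|D|^a$ is the Fourier multiplier with symbol $|\xi|^a$; $H^a=H^a(\mathbb{R}^n)$ is the Bessel potential (inhomogeneous Sobolev) space based on $L^2$. $|\beta|$ denotes the order of differentiation (a number). Each estimate is understood for data for which its right-hand side is finite. Sobolev solutions are understood via the partial Fourier transform in $x$: $\hat u(t,\xi)$ solves $\hat u_{tt}+|\xi|^2\hat u+(b(t)+g(t)|\xi|^2)\hat u_t=0$, $\hat u(0,\xi)=\hat u_0(\xi)$, $\hat u_t(0,\xi)=\hat u_1(\xi)$. The coefficients are as regular as needed for the stated derivatives to exist. *)

theory Defs
  imports "HOL-Analysis.Analysis"
begin

definition L2 :: "('a::euclidean_space \<Rightarrow> complex) set" where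
  "L2 = {f \<in> borel_measurable lborel. integrable lborel (\<lambda>x. (cmod (f x))\<^sup>2)}"

definition L2_norm :: "('a::euclidean_space \<Rightarrow> complex) \<Rightarrow> real" where
  "L2_norm f = sqrt (LINT x|lborel. (cmod (f x))\<^sup>2)"

text \<open>The nonnegative integral makes convergence in mean square meaningful without assuming
  beforehand that the differences are square integrable.\<close>

definition L2_tendsto :: "(nat \<Rightarrow> 'a::euclidean_space \<Rightarrow> complex) \<Rightarrow> ('a \<Rightarrow> complex) \<Rightarrow> bool" where
  "L2_tendsto \<phi> f \<longleftrightarrow>
     ((\<lambda>k. \<integral>\<^sup>+ x. ennreal ((cmod (\<phi> k x - f x))\<^sup>2) \<partial>lborel) \<longlonglongrightarrow> 0)"

definition fourier :: "('a::euclidean_space \<Rightarrow> complex) \<Rightarrow> 'a \<Rightarrow> complex" where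
  "fourier f \<xi> = (LINT x|lborel. cis (- (x \<bullet> \<xi>)) * f x)"

text \<open>The Fourier--Plancherel transform, given as a relation: the integral transform above is
  defined pointwise only for integrable functions, and its graph on the integrable functions in
  \<open>L2\<close> is closed with respect to convergence in mean square. The image \<open>F\<close> is determined up to
  a null set. The normalization of \<open>fourier\<close> does not affect the Fourier multipliers below.\<close>

definition fourier_L2 :: "('a::euclidean_space \<Rightarrow> complex) \<Rightarrow> ('a \<Rightarrow> complex) \<Rightarrow> bool" where
  "fourier_L2 f F \<longleftrightarrow> f \<in> L2 \<and> F \<in> L2 \<and>
     (\<exists>\<phi>. (\<forall>k. \<phi> k \<in> L2 \<and> integrable lborel (\<phi> k)) \<and>
          L2_tendsto \<phi> f \<and> L2_tendsto (\<lambda>k. fourier (\<phi> k)) F)"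

definition is_multiplier_image ::
    "('a::euclidean_space \<Rightarrow> real) \<Rightarrow> ('a \<Rightarrow> complex) \<Rightarrow> ('a \<Rightarrow> complex) \<Rightarrow> bool" where
  "is_multiplier_image m f w \<longleftrightarrow>
     (\<exists>F. fourier_L2 f F \<and> fourier_L2 w (\<lambda>\<xi>. complex_of_real (m \<xi>) * F \<xi>))"

definition multiplier_domain :: "('a::euclidean_space \<Rightarrow> real) \<Rightarrow> ('a \<Rightarrow> complex) set" where
  "multiplier_domain m = {f. \<exists>w. is_multiplier_image m f w}"

text \<open>For \<open>f\<close> in the domain this picks one of the (almost everywhere equal) functions \<open>m(D) f\<close>.\<close>

definition multiplier :: "('a::euclidean_space \<Rightarrow> real) \<Rightarrow> ('a \<Rightarrow> complex) \<Rightarrow> 'a \<Rightarrow> complex" where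
  "multiplier m f = (SOME w. is_multiplier_image m f w)"

text \<open>The symbol of \<open>|D|\<^sup>a\<close>. Since \<open>0 powr 0 = 0\<close>, for \<open>a = 0\<close> it differs from the constant
  \<open>1\<close> at the origin, which is a null set.\<close>

definition abs_symbol :: "real \<Rightarrow> 'a::euclidean_space \<Rightarrow> real" where
  "abs_symbol a \<xi> = norm \<xi> powr a"

definition bessel_symbol :: "real \<Rightarrow> 'a::euclidean_space \<Rightarrow> real" where
  "bessel_symbol a \<xi> = (1 + (norm \<xi>)\<^sup>2) powr (a / 2)"

text \<open>The Bessel potential space \<open>H\<^sup>a\<close> as a subspace of \<open>L2\<close>; this is the usual space for
  orders \<open>a \<ge> 0\<close>, the only ones used.\<close>

definition sobolev_H :: "real \<Rightarrow> ('a::euclidean_space \<Rightarrow> complex) set" where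
  "sobolev_H a = multiplier_domain (bessel_symbol a)"

definition sobolev_norm :: "real \<Rightarrow> ('a::euclidean_space \<Rightarrow> complex) \<Rightarrow> real" where
  "sobolev_norm a f = L2_norm (multiplier (bessel_symbol a) f)"

text \<open>\<open>u\<close> is a Sobolev solution with data \<open>u\<^sub>0\<close>, \<open>u\<^sub>1\<close> and \<open>v\<close> is its time derivative \<open>u\<^sub>t\<close>.
  Both the equation and the time derivative are understood through the partial Fourier transform
  in \<open>x\<close>: \<open>U\<close>, \<open>V\<close>, \<open>W\<close> are representatives of the transforms of \<open>u\<close>, \<open>u\<^sub>t\<close>, \<open>u\<^sub>t\<^sub>t\<close>.\<close>

definition sobolev_solution ::
    "(real \<Rightarrow> real) \<Rightarrow> (real \<Rightarrow> real) \<Rightarrow> ('a::euclidean_space \<Rightarrow> complex) \<Rightarrow> ('a \<Rightarrow> complex) \<Rightarrow>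
     (real \<Rightarrow> 'a \<Rightarrow> complex) \<Rightarrow> (real \<Rightarrow> 'a \<Rightarrow> complex) \<Rightarrow> bool" where
  "sobolev_solution b g u\<^sub>0 u\<^sub>1 u v \<longleftrightarrow>
     (\<exists>U V W.
        (\<forall>t\<ge>0. fourier_L2 (u t) (U t) \<and> fourier_L2 (v t) (V t)) \<and>
        fourier_L2 u\<^sub>0 (U 0) \<and> fourier_L2 u\<^sub>1 (V 0) \<and>
        (AE \<xi> in lborel. \<forall>t\<ge>0.
           ((\<lambda>s. U s \<xi>) has_vector_derivative V t \<xi>) (at t within {0..}) \<and>
           ((\<lambda>s. V s \<xi>) has_vector_derivative W t \<xi>) (at t within {0..}) \<and>
           W t \<xi> + complex_of_real ((norm \<xi>)\<^sup>2) * U t \<xi>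
             + complex_of_real (b t + g t * (norm \<xi>)\<^sup>2) * V t \<xi> = 0))"

end

theory Submission
  imports Defs "HOL-Probability.Characteristic_Functions"
begin

text \<open>
  The Plancherel transform turns the equation into one oscillator per frequency \<open>r = |\<xi>|\<close>,
  \<open>y'' + h y' + r\<^sup>2 y = 0\<close> with damping \<open>h = b + g r\<^sup>2\<close>, so everything follows from a bound
  for a single oscillator that is uniform in \<open>r\<close>. The bound comes from one Lyapunov functional,
  with no division of the phase space into zones.

  Write \<open>z = y'\<close> and \<open>E = z\<^sup>2 + r\<^sup>2 y\<^sup>2\<close>. The damping acts only on \<open>z\<close>; adding \<open>\<alpha> y z\<close> to \<open>E/2\<close>
  lets it act on \<open>y\<close> as well. The natural decay rate of the oscillator is \<open>h\<close> when \<open>h \<le> r\<close>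
  (oscillation) and \<open>r\<^sup>2/h\<close> when \<open>h \<ge> r\<close> (overdamping), and \<open>\<alpha> = r\<^sup>2 h / (8 (r\<^sup>2 + h\<^sup>2))\<close> is a smooth
  substitute for the minimum of the two. The functional \<open>F = E/2 + \<alpha> y z\<close> is equivalent to \<open>E\<close>, and
  \<open>F' \<le> (k/16 - \<alpha>/2) F\<close> with \<open>k = (g')\<^sup>2/g\<close> (\<open>lyapunov_deriv\<close>): of the two parts of \<open>h' = b' + g' r\<^sup>2\<close>,
  the first is absorbed since \<open>|b'| \<le> b\<^sup>2\<close>, and the second costs only the integrable rate \<open>k\<close>.

  Let \<open>\<Lambda>(t) = 1 + \<integral>\<^sub>0\<^sup>t d\<tau>/b(\<tau>)\<close>, \<open>\<rho> = r\<^sup>2/(1 + r\<^sup>2)\<close> and \<open>x = \<rho> \<Lambda>\<close>. For large times \<open>g \<le> b\<close>, because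
  \<open>t g(t) \<le> \<integral>g\<close> while \<open>t b(t)\<close> tends to infinity; then \<open>\<alpha>\<close> is at least a multiple of
  \<open>min b (\<rho>/b)\<close>. Also \<open>b\<^sup>2 \<Lambda>\<close> tends to infinity, because \<open>b\<close> changes by at most a constant factor
  over \<open>[t/2, t]\<close>. Hence the logarithmic derivative \<open>N x'/(1 + x)\<close> of the weight \<open>(1 + x)\<^sup>N\<close> is
  dominated by \<open>\<alpha>/2\<close> up to the derivative of a bounded function, for every \<open>N\<close>, and
  \<open>(1 + \<rho> \<Lambda>(t))\<^sup>N E(t) \<le> C E(0)\<close> for all frequencies at once (\<open>weighted_energy_bound\<close>). For
  \<open>N = s\<close> this gives
  \<open>r^(s-1) sqrt E(t) \<le> C (\<Lambda>^(-s/2) (1 + r\<^sup>2)^(s/2) |y(0)| + \<Lambda>^(-(s-1)/2) (1 + r\<^sup>2)^((s-1)/2) |z(0)|)\<close>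
  (\<open>frequency_estimate\<close>), which contains both estimates of the theorem, the second one with \<open>s + 1\<close>
  in place of \<open>s\<close>. The thresholds after which the weight argument works depend on \<open>N\<close>, but before
  them \<open>\<Lambda>\<close> is bounded and the energy does not increase, so \<open>t\<^sub>0 = 0\<close> is admissible.

  To return to functions of \<open>x\<close> one needs that the Plancherel transform, defined as a closed relation,
  is single valued, a multiple of an isometry, and onto; the last property provides the function
  whose transform is \<open>|\<xi>|\<^sup>s U(t,\<xi>)\<close>. All three rest on one fact: convolution with a shrinking Gaussian
  converges to the identity in mean square (\<open>heat_conv_tendsto\<close>). It yields Plancherel's identity by
  inserting a Gaussian into \<open>\<integral> |fourier f|\<^sup>2\<close>, and an inverse on functions both integrable and square integrable
  (\<open>fourier_L2_inversion\<close>); completeness extends the inverse to all square integrable functions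
  (\<open>fourier_L2_surj\<close>).
\<close>

section \<open>Dissipation of a single damped oscillator\<close>

lemma quadratic_form_bound:
  fixes c p q y z :: real
  assumes "c\<^sup>2 \<le> 4 * p * q" "p \<ge> 0" "q \<ge> 0"
  shows "c * y * z \<le> p * y\<^sup>2 + q * z\<^sup>2"
proof -
  have "(c * y * z)\<^sup>2 \<le> (4 * p * q) * (y * z)\<^sup>2"
    using mult_right_mono[OF assms(1), of "(y * z)\<^sup>2"] by (simp add: power_mult_distrib mult_ac)
  also have "\<dots> \<le> (p * y\<^sup>2 + q * z\<^sup>2)\<^sup>2"
    using zero_le_power2[of "p * y\<^sup>2 - q * z\<^sup>2"] by (simp add: power2_eq_square algebra_simps)
  finally show ?thesis
    using assms(2,3) by (simp add: abs_le_square_iff[symmetric])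
qed

text \<open>The left side is the time derivative of \<open>(z\<^sup>2 + r\<^sup>2 y\<^sup>2)/2 + \<alpha> y z\<close> along the oscillator. The mixed term
  consists of three parts, each split by a weighted arithmetic--geometric mean inequality: \<open>\<alpha> h\<close> is
  controlled because \<open>\<alpha> h\<^sup>2 \<le> r\<^sup>2 h/8\<close>; the contribution of \<open>b'\<close> to \<open>\<alpha>'\<close> because \<open>|b'| \<le> b\<^sup>2 \<le> h\<^sup>2\<close>; and the
  contribution of \<open>g' r\<^sup>2\<close> is compared with the part \<open>g r\<^sup>2\<close> of the damping, which leaves \<open>(g')\<^sup>2/g\<close>.
  The factor \<open>8\<close> in \<open>\<alpha>\<close> makes the three losses in \<open>z\<^sup>2\<close>, together with \<open>\<alpha> z\<^sup>2\<close>, smaller than \<open>h z\<^sup>2\<close>.\<close>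

lemma lyapunov_dissipation:
  fixes r b g b' g' y z :: real
  assumes r: "r > 0" and b: "b > 0" and g: "g > 0" and b': "\<bar>b'\<bar> \<le> b\<^sup>2"
    and h: "h = b + g * r\<^sup>2"
    and \<alpha>: "\<alpha> = r\<^sup>2 * h / (8 * (r\<^sup>2 + h\<^sup>2))"
    and \<alpha>': "\<alpha>' = r\<^sup>2 * (r\<^sup>2 - h\<^sup>2) * (b' + g' * r\<^sup>2) / (8 * (r\<^sup>2 + h\<^sup>2)\<^sup>2)"
  shows "- (h - \<alpha>) * z\<^sup>2 - \<alpha> * (r\<^sup>2 * y\<^sup>2) + (\<alpha>' - \<alpha> * h) * y * z
    \<le> - (\<alpha> / 2) * (z\<^sup>2 + r\<^sup>2 * y\<^sup>2) + (g'\<^sup>2 / g) / 64 * (r\<^sup>2 * y\<^sup>2)"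
proof -
  define D where "D = r\<^sup>2 + h\<^sup>2"
  have hb: "b \<le> h" and h0: "h > 0" using b g r by (auto simp: h add_pos_nonneg)
  have D: "D > 0" "r\<^sup>2 \<le> D" "h\<^sup>2 \<le> D" "D \<noteq> 0" using r by (auto simp: D_def add_pos_nonneg intro!: less_imp_neq[symmetric])
  have \<alpha>D: "\<alpha> = r\<^sup>2 * h / (8 * D)" by (simp add: \<alpha> D_def)
  have \<alpha>0: "\<alpha> \<ge> 0" using h0 D by (simp add: \<alpha>D)
  have \<alpha>h: "\<alpha> \<le> h / 8" using D h0 by (simp add: \<alpha>D field_simps)
  \<comment> \<open>Both factors of \<open>s * q\<close> in \<open>\<alpha>'\<close> are bounded by \<open>1\<close>; \<open>\<beta>\<close> and \<open>\<gamma>\<close> are the contributions of \<open>b'\<close> and \<open>g'\<close>.\<close>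
  define q where "q = (r\<^sup>2 - h\<^sup>2) / D"
  have q: "\<bar>q\<bar> \<le> 1" using D by (simp add: q_def D_def abs_le_iff)
  define s where "s = r\<^sup>2 / D"
  have s: "0 \<le> s" "s \<le> 1" using D by (auto simp: s_def)
  define \<beta> where "\<beta> = s * q * b' / 8"
  define \<gamma> where "\<gamma> = s * q * g' * r\<^sup>2 / 8"
  have split: "\<alpha>' = \<beta> + \<gamma>"
    by (simp add: \<alpha>' \<beta>_def \<gamma>_def s_def q_def D_def[symmetric] power2_eq_square[of D] add_divide_distrib distrib_left)
  have sq: "\<bar>s * q\<bar> \<le> 1" using s q by (simp add: abs_mult mult_le_one)
  have 1: "- (\<alpha> * h) * y * z \<le> (\<alpha> * r\<^sup>2 / 4) * y\<^sup>2 + (h / 8) * z\<^sup>2"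
  proof (rule quadratic_form_bound)
    have "\<alpha> * h\<^sup>2 \<le> r\<^sup>2 * h / 8"
      using D h0 r by (simp add: \<alpha>D field_simps)
    from mult_left_mono[OF this \<alpha>0] show "(- (\<alpha> * h))\<^sup>2 \<le> 4 * (\<alpha> * r\<^sup>2 / 4) * (h / 8)"
      by (simp add: power2_eq_square mult_ac)
  qed (use \<alpha>0 h0 in auto)
  have 2: "\<beta> * y * z \<le> (\<alpha> * r\<^sup>2 / 4) * y\<^sup>2 + (h / 8) * z\<^sup>2"
  proof (rule quadratic_form_bound)
    have "\<bar>\<beta>\<bar> \<le> s * h\<^sup>2 / 8"
    proof -
      have "\<bar>q\<bar> * \<bar>b'\<bar> \<le> 1 * h\<^sup>2"
        using q b' hb b by (intro mult_mono order_trans[OF b'] power_mono) auto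
      from mult_left_mono[OF this s(1)] show ?thesis using s by (simp add: \<beta>_def abs_mult mult_ac)
    qed
    then have "\<beta>\<^sup>2 \<le> (s * h\<^sup>2 / 8)\<^sup>2" by (simp add: abs_le_square_iff[symmetric] s)
    also have "\<dots> = h\<^sup>2 / D * (4 * (\<alpha> * r\<^sup>2 / 4) * (h / 8))"
      using D by (simp add: s_def \<alpha>D power2_eq_square mult_ac)
    also have "\<dots> \<le> 1 * (4 * (\<alpha> * r\<^sup>2 / 4) * (h / 8))"
      using D \<alpha>0 h0 by (intro mult_right_mono) auto
    finally show "\<beta>\<^sup>2 \<le> 4 * (\<alpha> * r\<^sup>2 / 4) * (h / 8)" by simp
  qed (use \<alpha>0 h0 in auto)
  have 3: "\<gamma> * y * z \<le> ((g'\<^sup>2 / g) / 64 * r\<^sup>2) * y\<^sup>2 + (g * r\<^sup>2 / 4) * z\<^sup>2"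
  proof (rule quadratic_form_bound)
    have "\<gamma>\<^sup>2 = (s * q)\<^sup>2 * (g' * r\<^sup>2 / 8)\<^sup>2" by (simp add: \<gamma>_def power_mult_distrib power_divide)
    also have "\<dots> \<le> 1 * (g' * r\<^sup>2 / 8)\<^sup>2"
      using sq by (intro mult_right_mono) (auto simp: abs_square_le_1)
    also have "\<dots> = 4 * ((g'\<^sup>2 / g) / 64 * r\<^sup>2) * (g * r\<^sup>2 / 4)"
      using g by (simp add: power2_eq_square)
    finally show "\<gamma>\<^sup>2 \<le> 4 * ((g'\<^sup>2 / g) / 64 * r\<^sup>2) * (g * r\<^sup>2 / 4)" .
  qed (use g in auto)
  have 4: "g * r\<^sup>2 / 4 * z\<^sup>2 \<le> h / 4 * z\<^sup>2"
    using b by (intro mult_right_mono) (auto simp: h)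
  have 5: "\<alpha> * z\<^sup>2 \<le> h / 8 * z\<^sup>2" using \<alpha>h by (intro mult_right_mono) auto
  have 6: "0 \<le> h * z\<^sup>2" using h0 by auto
  have 7: "(\<alpha>' - \<alpha> * h) * y * z = \<beta> * y * z + \<gamma> * y * z + (- (\<alpha> * h) * y * z)"
    by (simp add: split algebra_simps)
  have 8: "- (h - \<alpha>) * z\<^sup>2 = \<alpha> * z\<^sup>2 - h * z\<^sup>2"
    "- (\<alpha> / 2) * (z\<^sup>2 + r\<^sup>2 * y\<^sup>2) = - (\<alpha> * z\<^sup>2) / 2 - (\<alpha> * r\<^sup>2 * y\<^sup>2) / 2" by (auto simp: field_simps)
  show ?thesis unfolding 7 8 using 1 2 3 4 5 6 by (simp add: mult.assoc)
qed


text \<open>For \<open>h \<le> r\<close> the rate is at least \<open>h/16\<close>, and for \<open>h \<ge> r\<close> at least \<open>r\<^sup>2/(16 h)\<close>. Since \<open>g \<le> b\<close>, the damping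
  lies between \<open>b\<close> and \<open>b (1 + r\<^sup>2)\<close>, which makes the lower bound uniform over low and high frequencies.\<close>

lemma lyapunov_rate_lower_bound:
  fixes r b g :: real
  assumes r: "r > 0" and b: "b > 0" and g: "g > 0" "g \<le> b"
    and h: "h = b + g * r\<^sup>2"
  shows "min b (r\<^sup>2 / (1 + r\<^sup>2) / b) / 16 \<le> r\<^sup>2 * h / (8 * (r\<^sup>2 + h\<^sup>2))"
proof -
  have hb: "b \<le> h" "h > 0" using b g r by (auto simp: h add_pos_nonneg)
  have r2: "r\<^sup>2 > 0" using r by simp
  show ?thesis
  proof (cases "h \<le> r")
    case True
    then have "h\<^sup>2 \<le> r\<^sup>2" using hb by (intro power_mono) auto
    then have "h / 16 \<le> r\<^sup>2 * h / (8 * (r\<^sup>2 + h\<^sup>2))"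
      using hb r2 by (simp add: field_simps add_pos_pos)
    moreover have "min b (r\<^sup>2 / (1 + r\<^sup>2) / b) / 16 \<le> h / 16"
      by (intro divide_right_mono order_trans[OF min.cobounded1 hb(1)]) simp
    ultimately show ?thesis by (rule order_trans[rotated])
  next
    case False
    then have le: "r\<^sup>2 \<le> h\<^sup>2" using r by (intro power_mono) auto
    have "g * r\<^sup>2 \<le> b * r\<^sup>2" using g by (intro mult_right_mono) auto
    then have "h \<le> b * (1 + r\<^sup>2)" by (simp add: h algebra_simps)
    then have "r\<^sup>2 / (b * (1 + r\<^sup>2)) \<le> r\<^sup>2 / h"
      using hb b r2 by (intro divide_left_mono) (auto simp: add_pos_pos)
    moreover have "r\<^sup>2 / h / 16 \<le> r\<^sup>2 * h / (8 * (r\<^sup>2 + h\<^sup>2))"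
    proof -
      have "r\<^sup>2 / h / 16 = r\<^sup>2 * h / (16 * h\<^sup>2)" using hb by (simp add: power2_eq_square)
      also have "\<dots> \<le> r\<^sup>2 * h / (8 * (r\<^sup>2 + h\<^sup>2))"
        using hb r2 le by (intro divide_left_mono) (auto simp: add_pos_pos)
      finally show ?thesis .
    qed
    moreover have "min b (r\<^sup>2 / (1 + r\<^sup>2) / b) / 16 \<le> r\<^sup>2 / (b * (1 + r\<^sup>2)) / 16"
    proof (rule divide_right_mono)
      have "r\<^sup>2 / (1 + r\<^sup>2) / b = r\<^sup>2 / (b * (1 + r\<^sup>2))" by (simp add: mult.commute)
      then show "min b (r\<^sup>2 / (1 + r\<^sup>2) / b) \<le> r\<^sup>2 / (b * (1 + r\<^sup>2))" by (metis min.cobounded2)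
    qed simp
    ultimately show ?thesis
      by (meson divide_right_mono order_trans zero_le_numeral)
  qed
qed

text \<open>With \<open>x' = \<rho>/b\<close>, the left side is the derivative of \<open>N ln (1 + x) + 8 N\<^sup>2/(1 + x)\<close>. The bounded second term
  is there for the case that \<open>\<rho>/b\<close> is the minimum: \<open>N x'/(1 + x)\<close> is small compared with \<open>\<rho>/b\<close> only once
  \<open>x\<close> is large, and \<open>u - 8 u\<^sup>2 \<le> 1/32\<close> for \<open>u = N/(1 + x)\<close> removes this restriction. When \<open>b\<close> is the
  minimum, \<open>N x'/(1 + x) \<le> N/(b L)\<close> suffices.\<close>

lemma weight_rate_bound:
  fixes b L \<rho> N :: real
  assumes b: "b > 0" and L: "L > 0" and \<rho>: "\<rho> \<ge> 0" and N: "N \<ge> 0" "32 * N \<le> b\<^sup>2 * L"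
  defines "x \<equiv> \<rho> * L"
  shows "\<rho> / b * (N / (1 + x) - 8 * N\<^sup>2 / (1 + x)\<^sup>2) \<le> min b (\<rho> / b) / 32"
proof -
  have x: "x \<ge> 0" using L \<rho> by (simp add: x_def)
  have "\<rho> / b * (N / (1 + x) - 8 * N\<^sup>2 / (1 + x)\<^sup>2) \<le> \<rho> / b * (1 / 32)"
  proof (rule mult_left_mono)
    define u where "u = N / (1 + x)"
    have "0 \<le> 8 * (u - 1 / 16)\<^sup>2" by simp
    then have "u - 8 * u\<^sup>2 \<le> 1 / 32" by (simp add: power2_eq_square algebra_simps)
    then show "N / (1 + x) - 8 * N\<^sup>2 / (1 + x)\<^sup>2 \<le> 1 / 32"
      by (simp add: u_def power_divide)
  qed (use \<rho> b in auto)
  moreover have "\<rho> / b * (N / (1 + x) - 8 * N\<^sup>2 / (1 + x)\<^sup>2) \<le> b / 32"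
  proof -
    have "\<rho> / b * (N / (1 + x) - 8 * N\<^sup>2 / (1 + x)\<^sup>2) \<le> \<rho> / b * (N / (1 + x))"
      using \<rho> b by (intro mult_left_mono) auto
    also have "\<dots> = (\<rho> * N) / (b * (1 + x))" by simp
    also have "\<dots> \<le> b / 32"
    proof -
      have "\<rho> * (32 * N) \<le> \<rho> * (b\<^sup>2 * L)" using N(2) \<rho> by (rule mult_left_mono)
      also have "\<dots> = b * b * x" by (simp add: x_def power2_eq_square mult_ac)
      also have "\<dots> \<le> b * (b * (1 + x))" using b by (simp add: algebra_simps)
      finally show ?thesis using b x by (simp add: divide_le_eq mult_ac)
    qed
    finally show ?thesis .
  qed
  ultimately show ?thesis unfolding min_def by (simp only: split: if_split) simp
qed

text \<open>Stated with the gauge integral, for which every derivative is integrable: the coefficient \<open>g'\<close>, and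
  with it the derivative of the Lyapunov functional, need not be continuous.\<close>

lemma increment_le_integral:
  fixes f f' k :: "real \<Rightarrow> real"
  assumes "a \<le> c" and f: "\<And>x. x \<in> {a..c} \<Longrightarrow> (f has_real_derivative f' x) (at x within {a..c})"
    and k: "k integrable_on {a..c}" "\<And>x. x \<in> {a..c} \<Longrightarrow> f' x \<le> k x"
  shows "f c - f a \<le> integral {a..c} k"
proof (rule has_integral_le)
  show "(f' has_integral f c - f a) {a..c}"
    using assms(1) f by (intro fundamental_theorem_of_calculus)
      (auto simp: has_real_derivative_iff_has_vector_derivative[symmetric])
  show "(k has_integral integral {a..c} k) {a..c}" using k(1) by (rule integrable_integral)
qed (use k(2) in auto)

text \<open>Amounts to \<open>r\<^sup>2 l \<le> (1 + r\<^sup>2 l/(1 + r\<^sup>2)) (1 + r\<^sup>2)\<close>; it trades the frequency weight gained by the energy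
  estimate for decay in \<open>l\<close> and Bessel weights of the data.\<close>

lemma frequency_weight:
  assumes r: "r > 0" and l: "l > 0" and a: "a \<ge> (0::real)"
  shows "r powr a \<le> (1 + r\<^sup>2 / (1 + r\<^sup>2) * l) powr (a / 2) * (l powr (- a / 2) * (1 + r\<^sup>2) powr (a / 2))"
proof -
  define \<rho> where "\<rho> = r\<^sup>2 / (1 + r\<^sup>2)"
  have \<rho>: "\<rho> \<ge> 0" "r\<^sup>2 = \<rho> * (1 + r\<^sup>2)" by (auto simp: \<rho>_def add_pos_nonneg less_imp_neq[symmetric])
  have "r powr a * l powr (a / 2) = (r\<^sup>2 * l) powr (a / 2)"
    using r l by (simp add: powr_mult powr_powr flip: powr_numeral)
  also have "\<dots> \<le> ((1 + \<rho> * l) * (1 + r\<^sup>2)) powr (a / 2)"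
  proof (rule powr_mono2)
    have "r\<^sup>2 * l = (\<rho> * l) * (1 + r\<^sup>2)" by (subst \<rho>(2)) simp
    also have "\<dots> \<le> (1 + \<rho> * l) * (1 + r\<^sup>2)" by (intro mult_right_mono) auto
    finally show "r\<^sup>2 * l \<le> (1 + \<rho> * l) * (1 + r\<^sup>2)" .
  qed (use a l in auto)
  also have "\<dots> = (1 + \<rho> * l) powr (a / 2) * (1 + r\<^sup>2) powr (a / 2)"
    using \<rho>(1) l by (simp add: powr_mult)
  finally have "r powr a * l powr (a / 2) * l powr (- a / 2)
      \<le> (1 + \<rho> * l) powr (a / 2) * (1 + r\<^sup>2) powr (a / 2) * l powr (- a / 2)"
    by (intro mult_right_mono) auto
  moreover have "l powr (a / 2) * l powr (- a / 2) = 1" using l by (simp flip: powr_add)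
  ultimately show ?thesis by (simp add: \<rho>_def mult_ac)
qed

section \<open>Decay of Fourier modes under effective damping\<close>

locale effective_damping =
  fixes b b' g g' :: "real \<Rightarrow> real"
  assumes b_pos: "\<And>t. t \<ge> 0 \<Longrightarrow> b t > 0"
    and b_deriv: "\<And>t. t \<ge> 0 \<Longrightarrow> (b has_real_derivative b' t) (at t within {0..})"
    and b'_le: "\<And>t. t \<ge> 0 \<Longrightarrow> \<bar>b' t\<bar> \<le> (b t)\<^sup>2"
    and b_slow: "\<exists>C>0. \<forall>t\<ge>0. \<bar>b' t\<bar> / b t \<le> C * (1 / (1 + t))"
    and b_effective: "filterlim (\<lambda>t. t * b t) at_top at_top"
    and g_pos: "\<And>t. t \<ge> 0 \<Longrightarrow> g t > 0"
    and g_deriv: "\<And>t. t \<ge> 0 \<Longrightarrow> (g has_real_derivative g' t) (at t within {0..})"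
    and g'_neg: "\<And>t. t \<ge> 0 \<Longrightarrow> g' t < 0"
    and g_int: "g absolutely_integrable_on {0..}"
    and g'_int: "(\<lambda>t. (g' t)\<^sup>2 / g t) absolutely_integrable_on {0..}"
begin

text \<open>The time scale of the heat equation \<open>b(t) u\<^sub>t = \<Delta>u\<close> that governs the low frequencies, shifted by \<open>1\<close> so that
  negative powers stay bounded.\<close>

definition parabolic_time :: "real \<Rightarrow> real" where
  "parabolic_time t = 1 + integral {0..t} (\<lambda>\<tau>. 1 / b \<tau>)"

lemma b_continuous: "continuous_on {0..} b"
  by (rule DERIV_continuous_on[where D=b']) (use b_deriv in auto)

lemma inverse_b_continuous: "continuous_on {0..t} (\<lambda>\<tau>. 1 / b \<tau>)"
  using b_pos by (intro continuous_intros continuous_on_subset[OF b_continuous]) force+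

lemma parabolic_time_deriv: "t \<in> {0..T} \<Longrightarrow> (parabolic_time has_real_derivative 1 / b t) (at t within {0..T})"
  using DERIV_add[OF DERIV_const integral_has_real_derivative[OF inverse_b_continuous]]
  by (simp add: parabolic_time_def[abs_def])

lemma parabolic_time_mono: "0 \<le> s \<Longrightarrow> s \<le> t \<Longrightarrow> parabolic_time s \<le> parabolic_time t"
  unfolding parabolic_time_def using b_pos
  by (intro add_left_mono integral_subset_le integrable_continuous_real inverse_b_continuous)
    (auto intro: less_imp_le)

lemma parabolic_time_ge_1: "0 \<le> t \<Longrightarrow> 1 \<le> parabolic_time t"
  using parabolic_time_mono[of 0 t] by (simp add: parabolic_time_def)

text \<open>Since \<open>g\<close> decreases, \<open>t g(t)\<close> is bounded by the integral of \<open>g\<close>, whereas \<open>t b(t)\<close> tends to infinity.\<close>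

lemma g_eventually_le_b: "\<exists>T\<ge>0. \<forall>t\<ge>T. g t \<le> b t"
proof -
  have g_on: "g integrable_on {0..}" using g_int by (rule set_lebesgue_integral_eq_integral(1))
  define I where "I = integral {0..} g"
  have tg: "t * g t \<le> I" if "t \<ge> 0" for t
  proof -
    have anti: "g t \<le> g s" if "s \<in> {0..t}" for s
    proof -
      have "g t - g s \<le> integral {s..t} (\<lambda>_. 0)"
      proof (rule increment_le_integral)
        show "(g has_real_derivative g' x) (at x within {s..t})" if "x \<in> {s..t}" for x
          by (rule DERIV_subset[OF g_deriv]) (use that \<open>s \<in> _\<close> in auto)
        show "g' x \<le> 0" if "x \<in> {s..t}" for x
          using g'_neg[of x] that \<open>s \<in> _\<close> by simp
      qed (use that in auto)
      then show ?thesis by simp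
    qed
    have "t * g t = integral {0..t} (\<lambda>_. g t)" using that by simp
    also have "\<dots> \<le> integral {0..t} g"
      by (rule integral_le) (auto intro: integrable_on_subinterval[OF g_on] anti)
    also have "\<dots> \<le> I"
      unfolding I_def
      by (rule integral_subset_le) (auto intro: integrable_on_subinterval[OF g_on] g_on less_imp_le g_pos)
    finally show ?thesis .
  qed
  from b_effective obtain T where T: "\<And>t. t \<ge> T \<Longrightarrow> I \<le> t * b t"
    unfolding filterlim_at_top eventually_at_top_linorder by blast
  have "g t \<le> b t" if "t \<ge> max T 1" for t
  proof -
    have "t * g t \<le> t * b t" using tg[of t] T[of t] that by linarith
    then show ?thesis using that by simp
  qed
  then show ?thesis by (intro exI[of _ "max T 1"]) auto
qed

text \<open>The bound on \<open>|b'|/b\<close> keeps \<open>b\<close> within a factor \<open>e\<^sup>C\<close> of \<open>b(t)\<close> on \<open>[t/2, t]\<close>, so the integral of \<open>1/b\<close> over this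
  interval is at least a multiple of \<open>t/b(t)\<close>, and \<open>b\<^sup>2\<close> times it at least a multiple of \<open>t b(t)\<close>. This
  expresses that oscillating modes are damped faster than any power of the parabolic time.\<close>

lemma b_squared_parabolic_time_at_top: "\<exists>T\<ge>0. \<forall>t\<ge>T. M \<le> (b t)\<^sup>2 * parabolic_time t"
proof -
  obtain C where C: "C > 0" "\<And>t. t \<ge> 0 \<Longrightarrow> \<bar>b' t\<bar> / b t \<le> C * (1 / (1 + t))"
    using b_slow by blast
  have ratio: "b s \<le> exp C * b t" if s: "s \<in> {t/2..t}" "t > 0" for s t
  proof -
    have nn: "s \<ge> 0" using s by auto
    have "(- ln (b t)) - (- ln (b s)) \<le> integral {s..t} (\<lambda>_. C * (2 / t))"
    proof (rule increment_le_integral)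
      fix x assume x: "x \<in> {s..t}"
      show "((\<lambda>x. - ln (b x)) has_real_derivative - (b' x / b x)) (at x within {s..t})"
        using x nn b_pos[of x] by (auto intro!: derivative_eq_intros DERIV_subset[OF b_deriv])
      have "- (b' x / b x) \<le> \<bar>b' x\<bar> / b x"
        using b_pos[of x] x nn by (simp add: field_simps abs_if)
      also have "\<dots> \<le> C * (1 / (1 + x))" using C(2)[of x] x nn by auto
      also have "\<dots> \<le> C * (2 / t)"
      proof -
        have "1 / (1 + x) \<le> 1 / (t / 2)" using x s by (intro divide_left_mono) auto
        then show ?thesis using C(1) by (intro mult_left_mono) auto
      qed
      finally show "- (b' x / b x) \<le> C * (2 / t)" .
    qed (use s in auto)
    also have "\<dots> = (t - s) * (C * (2 / t))" using s by simp
    also have "\<dots> \<le> (t / 2) * (C * (2 / t))" using s C(1) by (intro mult_right_mono) auto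
    also have "\<dots> = C" using s by simp
    finally have "ln (b s) \<le> C + ln (b t)" by simp
    also have "\<dots> = ln (exp C * b t)" using b_pos[of t] s by (simp add: ln_mult)
    finally show ?thesis using b_pos[of t] b_pos[of s] s nn by (simp add: ln_le_cancel_iff)
  qed
  from b_effective obtain T where T: "\<And>t. t \<ge> T \<Longrightarrow> 2 * exp C * M \<le> t * b t"
    unfolding filterlim_at_top eventually_at_top_linorder by blast
  have "M \<le> (b t)\<^sup>2 * parabolic_time t" if t: "t \<ge> max T 1" for t
  proof -
    have bt: "b t > 0" using b_pos t by auto
    have "t / 2 * (1 / (exp C * b t)) = integral {t/2..t} (\<lambda>_. 1 / (exp C * b t))"
      using t by simp
    also have "\<dots> \<le> integral {t/2..t} (\<lambda>s. 1 / b s)"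
    proof (rule integral_le)
      show "(\<lambda>s. 1 / b s) integrable_on {t/2..t}"
        using t by (intro integrable_on_subinterval[OF integrable_continuous_real[OF inverse_b_continuous[of t]]]) auto
      fix s assume s: "s \<in> {t/2..t}"
      then show "1 / (exp C * b t) \<le> 1 / b s"
        using ratio[OF s] t b_pos[of s] bt by (intro divide_left_mono) auto
    qed auto
    also have "\<dots> \<le> integral {0..t} (\<lambda>s. 1 / b s)"
      using t b_pos by (intro integral_subset_le integrable_on_subinterval[OF integrable_continuous_real[OF inverse_b_continuous[of t]]])
        (auto intro: less_imp_le)
    also have "\<dots> \<le> parabolic_time t" by (simp add: parabolic_time_def)
    finally have "(b t)\<^sup>2 * (t / 2 * (1 / (exp C * b t))) \<le> (b t)\<^sup>2 * parabolic_time t"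
      by (intro mult_left_mono) auto
    also have "(b t)\<^sup>2 * (t / 2 * (1 / (exp C * b t))) = t * b t / (2 * exp C)"
      using bt by (simp add: power2_eq_square)
    finally have "t * b t / (2 * exp C) \<le> (b t)\<^sup>2 * parabolic_time t" .
    moreover have "M \<le> t * b t / (2 * exp C)" using T[of t] t by (simp add: field_simps)
    ultimately show ?thesis by linarith
  qed
  then show ?thesis by (intro exI[of _ "max T 1"]) auto
qed

definition error_rate :: "real \<Rightarrow> real" where
  "error_rate t = (g' t)\<^sup>2 / g t"

definition total_damping :: "real \<Rightarrow> real \<Rightarrow> real" where
  "total_damping r t = b t + g t * r\<^sup>2"

definition fourier_mode :: "real \<Rightarrow> (real \<Rightarrow> real) \<Rightarrow> (real \<Rightarrow> real) \<Rightarrow> bool" where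
  "fourier_mode r y z \<longleftrightarrow> r > 0 \<and>
     (\<forall>t\<ge>0. (y has_real_derivative z t) (at t within {0..}) \<and>
            (z has_real_derivative - (r\<^sup>2 * y t) - total_damping r t * z t) (at t within {0..}))"

definition energy :: "real \<Rightarrow> (real \<Rightarrow> real) \<Rightarrow> (real \<Rightarrow> real) \<Rightarrow> real \<Rightarrow> real" where
  "energy r y z t = (z t)\<^sup>2 + r\<^sup>2 * (y t)\<^sup>2"

text \<open>A smooth substitute for one eighth of \<open>min (total_damping r t) (r\<^sup>2 / total_damping r t)\<close>, the decay rate
  of the oscillator with frozen coefficients.\<close>

definition coupling :: "real \<Rightarrow> real \<Rightarrow> real" where
  "coupling r t = r\<^sup>2 * total_damping r t / (8 * (r\<^sup>2 + (total_damping r t)\<^sup>2))"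

definition lyapunov :: "real \<Rightarrow> (real \<Rightarrow> real) \<Rightarrow> (real \<Rightarrow> real) \<Rightarrow> real \<Rightarrow> real" where
  "lyapunov r y z t = energy r y z t / 2 + coupling r t * y t * z t"

lemma energy_nonneg: "energy r y z t \<ge> 0"
  by (simp add: energy_def)

lemma total_damping_pos: "t \<ge> 0 \<Longrightarrow> total_damping r t > 0"
  using b_pos[of t] g_pos[of t] by (simp add: total_damping_def add_pos_nonneg)

lemma energy_decreasing:
  assumes "fourier_mode r y z" "0 \<le> s" "s \<le> t"
  shows "energy r y z t \<le> energy r y z s"
proof -
  have "energy r y z t - energy r y z s \<le> integral {s..t} (\<lambda>_. 0)"
  proof (rule increment_le_integral)
    fix x assume x: "x \<in> {s..t}"
    then have d: "(y has_real_derivative z x) (at x within {s..t})"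
      "(z has_real_derivative - (r\<^sup>2 * y x) - total_damping r x * z x) (at x within {s..t})"
      using assms by (auto simp: fourier_mode_def intro!: DERIV_subset[where s="{0..}" and t="{s..t}"])
    show "(energy r y z has_real_derivative - 2 * total_damping r x * (z x)\<^sup>2) (at x within {s..t})"
      unfolding energy_def[abs_def]
      by (rule derivative_eq_intros d refl)+ (simp add: power2_eq_square algebra_simps)
    show "- 2 * total_damping r x * (z x)\<^sup>2 \<le> 0" using total_damping_pos[of x r] x assms by simp
  qed (use assms in auto)
  then show ?thesis by simp
qed

lemma coupling_nonneg: "t \<ge> 0 \<Longrightarrow> coupling r t \<ge> 0"
  using total_damping_pos[of t r] by (simp add: coupling_def)

text \<open>The coupling is at most \<open>r/2\<close>, so the mixed term is at most a quarter of the energy.\<close>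

lemma lyapunov_equivalent_energy:
  assumes r: "r > 0" and t: "t \<ge> 0"
  shows "energy r y z t \<le> 4 * lyapunov r y z t" "lyapunov r y z t \<le> energy r y z t"
proof -
  have "coupling r t \<le> r / 2"
  proof -
    have "r * total_damping r t \<le> r\<^sup>2 + (total_damping r t)\<^sup>2"
    proof -
      have "0 \<le> r * total_damping r t" using total_damping_pos[OF t, of r] r by simp
      then show ?thesis using sum_squares_bound[of r "total_damping r t"] by (simp add: mult.assoc)
    qed
    from mult_left_mono[OF this, of r] have "r\<^sup>2 * total_damping r t \<le> r * (r\<^sup>2 + (total_damping r t)\<^sup>2)"
      using r by (simp add: power2_eq_square mult.assoc)
    moreover have "0 \<le> r * (r\<^sup>2 + (total_damping r t)\<^sup>2)" using r by simp
    ultimately have "r\<^sup>2 * total_damping r t \<le> r / 2 * (8 * (r\<^sup>2 + (total_damping r t)\<^sup>2))" by linarith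
    moreover have "0 < 8 * (r\<^sup>2 + (total_damping r t)\<^sup>2)" using r by (simp add: add_pos_nonneg)
    ultimately show ?thesis unfolding coupling_def by (simp only: pos_divide_le_eq)
  qed
  then have "(coupling r t)\<^sup>2 \<le> (r / 2)\<^sup>2" using coupling_nonneg[OF t] by (intro power_mono) auto
  then have c: "(coupling r t)\<^sup>2 \<le> 4 * (r\<^sup>2 / 4) * (1 / 4)" "(- coupling r t)\<^sup>2 \<le> 4 * (r\<^sup>2 / 4) * (1 / 4)"
    by (auto simp: power_divide)
  have "coupling r t * y t * z t \<le> energy r y z t / 4" "- (coupling r t) * y t * z t \<le> energy r y z t / 4"
    using quadratic_form_bound[OF c(1), of "y t" "z t"] quadratic_form_bound[OF c(2), of "y t" "z t"]
    by (auto simp: energy_def)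
  then show "energy r y z t \<le> 4 * lyapunov r y z t" "lyapunov r y z t \<le> energy r y z t"
    using energy_nonneg[of r y z t] by (auto simp: lyapunov_def)
qed

lemma coupling_deriv:
  assumes r: "r > 0" and t: "t \<ge> 0"
  shows "(coupling r has_real_derivative
    r\<^sup>2 * (r\<^sup>2 - (total_damping r t)\<^sup>2) * (b' t + g' t * r\<^sup>2) / (8 * (r\<^sup>2 + (total_damping r t)\<^sup>2)\<^sup>2)) (at t within {0..})"
proof -
  define h' D where "h' = b' t + g' t * r\<^sup>2" and "D = r\<^sup>2 + (total_damping r t)\<^sup>2"
  have hd: "(total_damping r has_real_derivative h') (at t within {0..})"
    unfolding total_damping_def[abs_def] h'_def by (rule derivative_eq_intros b_deriv[OF t] g_deriv[OF t] refl)+ simp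
  have D: "D > 0" using r by (simp add: D_def add_pos_nonneg)
  have num: "r\<^sup>2 * h' * (8 * D) - r\<^sup>2 * total_damping r t * (8 * (2 * total_damping r t * h')) = 8 * (r\<^sup>2 * (r\<^sup>2 - (total_damping r t)\<^sup>2) * h')"
    by (simp add: D_def power2_eq_square algebra_simps)
  have "(coupling r has_real_derivative (r\<^sup>2 * h' * (8 * D) - r\<^sup>2 * total_damping r t * (8 * (2 * total_damping r t * h'))) / (8 * D * (8 * D)))
      (at t within {0..})"
    unfolding coupling_def[abs_def] D_def
    by (rule DERIV_divide) (use D in \<open>auto intro!: derivative_eq_intros hd simp: D_def\<close>)
  also have "(r\<^sup>2 * h' * (8 * D) - r\<^sup>2 * total_damping r t * (8 * (2 * total_damping r t * h'))) / (8 * D * (8 * D))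
      = r\<^sup>2 * (r\<^sup>2 - (total_damping r t)\<^sup>2) * h' / (8 * D\<^sup>2)"
    unfolding num using D by (simp add: power2_eq_square)
  finally show ?thesis by (simp only: h'_def D_def)
qed

lemma lyapunov_deriv:
  assumes m: "fourier_mode r y z"
  obtains D where
    "\<And>t. t \<ge> 0 \<Longrightarrow> (lyapunov r y z has_real_derivative D t) (at t within {0..})"
    "\<And>t. t \<ge> 0 \<Longrightarrow> D t \<le> (error_rate t / 16 - coupling r t / 2) * lyapunov r y z t"
proof -
  have r: "r > 0" using m by (simp add: fourier_mode_def)
  define \<alpha>' where "\<alpha>' t = r\<^sup>2 * (r\<^sup>2 - (total_damping r t)\<^sup>2) * (b' t + g' t * r\<^sup>2) / (8 * (r\<^sup>2 + (total_damping r t)\<^sup>2)\<^sup>2)" for t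
  define D where "D t = - (total_damping r t - coupling r t) * (z t)\<^sup>2 - coupling r t * (r\<^sup>2 * (y t)\<^sup>2)
    + (\<alpha>' t - coupling r t * total_damping r t) * y t * z t" for t
  show thesis
  proof
    fix t :: real assume t: "t \<ge> 0"
    have d: "(y has_real_derivative z t) (at t within {0..})"
      "(z has_real_derivative - (r\<^sup>2 * y t) - total_damping r t * z t) (at t within {0..})"
      using m t by (auto simp: fourier_mode_def)
    have a: "(coupling r has_real_derivative \<alpha>' t) (at t within {0..})"
      unfolding \<alpha>'_def by (rule coupling_deriv[OF r t])
    show "(lyapunov r y z has_real_derivative D t) (at t within {0..})"
      unfolding lyapunov_def[abs_def] energy_def
      by (auto intro!: derivative_eq_intros d a simp: D_def power2_eq_square field_simps)
    have "D t \<le> - (coupling r t / 2) * energy r y z t + error_rate t / 64 * (r\<^sup>2 * (y t)\<^sup>2)"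
      unfolding D_def energy_def error_rate_def
      by (rule lyapunov_dissipation[OF r b_pos[OF t] g_pos[OF t] b'_le[OF t] total_damping_def coupling_def \<alpha>'_def])
    also have "\<dots> \<le> - (coupling r t / 2) * lyapunov r y z t + error_rate t / 64 * (4 * lyapunov r y z t)"
    proof (rule add_mono)
      show "- (coupling r t / 2) * energy r y z t \<le> - (coupling r t / 2) * lyapunov r y z t"
        using coupling_nonneg[OF t] lyapunov_equivalent_energy(2)[OF r t]
        by (intro mult_left_mono_neg) auto
      have "r\<^sup>2 * (y t)\<^sup>2 \<le> energy r y z t" by (simp add: energy_def)
      also have "\<dots> \<le> 4 * lyapunov r y z t" by (rule lyapunov_equivalent_energy(1)[OF r t])
      finally show "error_rate t / 64 * (r\<^sup>2 * (y t)\<^sup>2) \<le> error_rate t / 64 * (4 * lyapunov r y z t)"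
        using g_pos[OF t] by (intro mult_left_mono) (auto simp: error_rate_def)
    qed
    also have "\<dots> = (error_rate t / 16 - coupling r t / 2) * lyapunov r y z t" by (simp add: algebra_simps)
    finally show "D t \<le> (error_rate t / 16 - coupling r t / 2) * lyapunov r y z t" .
  qed
qed

lemma error_rate_nonneg: "t \<ge> 0 \<Longrightarrow> error_rate t \<ge> 0"
  using g_pos[of t] by (simp add: error_rate_def)

lemma error_rate_integrable: "error_rate integrable_on {0..}"
  unfolding error_rate_def[abs_def] using g'_int by (rule set_lebesgue_integral_eq_integral(1))

text \<open>The logarithm of weight times Lyapunov functional, corrected by the bounded term \<open>8 N\<^sup>2/(1 + x)\<close>, grows
  at most at rate \<open>error_rate/16\<close>: the growth of the weight is compensated by half of the coupling.
  Taking logarithms is legitimate because a mode whose energy is nonzero at time \<open>t\<close> had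
  nonzero energy at all earlier times.\<close>

lemma weighted_energy_late:
  assumes m: "fourier_mode r y z" and N: "N \<ge> 0" and T: "0 \<le> T" "T \<le> t"
    and gb: "\<And>\<tau>. \<tau> \<ge> T \<Longrightarrow> g \<tau> \<le> b \<tau>" and NL: "\<And>\<tau>. \<tau> \<ge> T \<Longrightarrow> 32 * N \<le> (b \<tau>)\<^sup>2 * parabolic_time \<tau>"
  defines "\<rho> \<equiv> r\<^sup>2 / (1 + r\<^sup>2)"
  shows "(1 + \<rho> * parabolic_time t) powr N * energy r y z t
    \<le> 4 * exp (8 * N\<^sup>2 + integral {0..} error_rate / 16) * ((1 + \<rho> * parabolic_time T) powr N * energy r y z T)"
proof (cases "energy r y z t = 0")
  case True
  then show ?thesis by (simp add: energy_nonneg)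
next
  case False
  have r: "r > 0" using m by (simp add: fourier_mode_def)
  have \<rho>: "\<rho> \<ge> 0" by (simp add: \<rho>_def)
  have F_pos: "lyapunov r y z \<tau> > 0" if "\<tau> \<in> {T..t}" for \<tau>
  proof -
    have "0 < energy r y z t" using False energy_nonneg[of r y z t] by linarith
    also have "\<dots> \<le> energy r y z \<tau>" using that T by (intro energy_decreasing[OF m]) auto
    also have "\<dots> \<le> 4 * lyapunov r y z \<tau>" using that T by (intro lyapunov_equivalent_energy r) auto
    finally show ?thesis by simp
  qed
  define x where "x \<tau> = \<rho> * parabolic_time \<tau>" for \<tau>
  have x_nonneg: "x \<tau> \<ge> 0" if "\<tau> \<ge> 0" for \<tau>
    using parabolic_time_ge_1[OF that] \<rho> by (simp add: x_def)
  define \<Phi> where "\<Phi> \<tau> = N * ln (1 + x \<tau>) + 8 * N\<^sup>2 / (1 + x \<tau>) + ln (lyapunov r y z \<tau>)" for \<tau>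
  obtain D where D: "\<And>\<tau>. \<tau> \<ge> 0 \<Longrightarrow> (lyapunov r y z has_real_derivative D \<tau>) (at \<tau> within {0..})"
    "\<And>\<tau>. \<tau> \<ge> 0 \<Longrightarrow> D \<tau> \<le> (error_rate \<tau> / 16 - coupling r \<tau> / 2) * lyapunov r y z \<tau>"
    using lyapunov_deriv[OF m] by blast
  have "\<Phi> t - \<Phi> T \<le> integral {T..t} (\<lambda>\<tau>. error_rate \<tau> / 16)"
  proof (rule increment_le_integral)
    show "(\<lambda>\<tau>. error_rate \<tau> / 16) integrable_on {T..t}"
      using T by (intro integrable_on_divide integrable_on_subinterval[OF error_rate_integrable]) auto
    fix \<tau> assume \<tau>: "\<tau> \<in> {T..t}"
    then have \<tau>0: "\<tau> \<ge> 0" using T by auto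
    note pos = F_pos[OF \<tau>] x_nonneg[OF \<tau>0]
    have sub: "{T..t} \<subseteq> {0..t}" "{T..t} \<subseteq> {0..}" using T by auto
    have dx: "(x has_real_derivative \<rho> / b \<tau>) (at \<tau> within {T..t})"
      unfolding x_def[abs_def]
      using DERIV_cmult[OF DERIV_subset[OF parabolic_time_deriv sub(1)], of \<tau> \<rho>] \<tau> T by simp
    have dF: "(lyapunov r y z has_real_derivative D \<tau>) (at \<tau> within {T..t})"
      by (rule DERIV_subset[OF D(1)[OF \<tau>0] sub(2)])
    show "(\<Phi> has_real_derivative \<rho> / b \<tau> * (N / (1 + x \<tau>) - 8 * N\<^sup>2 / (1 + x \<tau>)\<^sup>2) + D \<tau> / lyapunov r y z \<tau>)
        (at \<tau> within {T..t})"
    proof -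
      define c where "c = \<rho> / b \<tau>"
      note dx = dx[folded c_def]
      have 1: "((\<lambda>\<tau>. N * ln (1 + x \<tau>)) has_real_derivative c * (N / (1 + x \<tau>))) (at \<tau> within {T..t})"
        using pos by (auto intro!: derivative_eq_intros dx)
      have 2: "((\<lambda>\<tau>. 8 * N\<^sup>2 / (1 + x \<tau>)) has_real_derivative - (c * (8 * N\<^sup>2 / (1 + x \<tau>)\<^sup>2)))
          (at \<tau> within {T..t})"
        using pos by (auto intro!: derivative_eq_intros dx simp: power2_eq_square)
      have 3: "((\<lambda>\<tau>. ln (lyapunov r y z \<tau>)) has_real_derivative D \<tau> / lyapunov r y z \<tau>)
          (at \<tau> within {T..t})"
        using pos by (auto intro!: derivative_eq_intros dF)
      show ?thesis
        using DERIV_add[OF DERIV_add[OF 1 2] 3]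
        unfolding \<Phi>_def[abs_def] c_def[symmetric] right_diff_distrib by simp
    qed
    have "\<rho> / b \<tau> * (N / (1 + x \<tau>) - 8 * N\<^sup>2 / (1 + x \<tau>)\<^sup>2) \<le> min (b \<tau>) (\<rho> / b \<tau>) / 16 / 2"
      unfolding x_def using weight_rate_bound[OF b_pos[OF \<tau>0] _ \<rho> N NL[of \<tau>]] parabolic_time_ge_1[OF \<tau>0] \<tau> by simp
    also have "\<dots> \<le> coupling r \<tau> / 2"
      unfolding \<rho>_def coupling_def using \<tau>
      by (intro divide_right_mono lyapunov_rate_lower_bound[OF r b_pos[OF \<tau>0] g_pos[OF \<tau>0] gb total_damping_def]) auto
    finally have 1: "\<rho> / b \<tau> * (N / (1 + x \<tau>) - 8 * N\<^sup>2 / (1 + x \<tau>)\<^sup>2) \<le> coupling r \<tau> / 2" .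
    have "D \<tau> / lyapunov r y z \<tau> \<le> error_rate \<tau> / 16 - coupling r \<tau> / 2"
      using D(2)[OF \<tau>0] pos by (simp add: pos_divide_le_eq)
    with 1 show "\<rho> / b \<tau> * (N / (1 + x \<tau>) - 8 * N\<^sup>2 / (1 + x \<tau>)\<^sup>2) + D \<tau> / lyapunov r y z \<tau> \<le> error_rate \<tau> / 16"
      by linarith
  qed (use T in auto)
  also have "\<dots> \<le> integral {0..} error_rate / 16"
  proof -
    have "integral {T..t} error_rate \<le> integral {0..} error_rate"
      using T error_rate_nonneg by (intro integral_subset_le integrable_on_subinterval[OF error_rate_integrable] error_rate_integrable) auto
    then show ?thesis by simp
  qed
  finally have \<Phi>_le: "\<Phi> t \<le> \<Phi> T + integral {0..} error_rate / 16" by simp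
  have pos: "1 + x t > 0" "1 + x T > 0" "lyapunov r y z t > 0" "lyapunov r y z T > 0"
    using x_nonneg[of t] x_nonneg[of T] F_pos T by auto
  have "N * ln (1 + x t) + ln (lyapunov r y z t) \<le> \<Phi> t"
    using pos by (simp add: \<Phi>_def)
  also note \<Phi>_le
  also have "\<Phi> T + integral {0..} error_rate / 16
      \<le> N * ln (1 + x T) + ln (lyapunov r y z T) + (8 * N\<^sup>2 + integral {0..} error_rate / 16)"
  proof -
    have "8 * N\<^sup>2 / (1 + x T) \<le> 8 * N\<^sup>2 / 1" using x_nonneg[OF T(1)] by (intro divide_left_mono) auto
    then show ?thesis by (simp add: \<Phi>_def)
  qed
  finally have "exp (N * ln (1 + x t) + ln (lyapunov r y z t))
      \<le> exp (N * ln (1 + x T) + ln (lyapunov r y z T) + (8 * N\<^sup>2 + integral {0..} error_rate / 16))" by simp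
  then have *: "(1 + x t) powr N * lyapunov r y z t
      \<le> (1 + x T) powr N * lyapunov r y z T * exp (8 * N\<^sup>2 + integral {0..} error_rate / 16)"
    using pos by (simp add: exp_add powr_def)
  have "(1 + x t) powr N * energy r y z t \<le> (1 + x t) powr N * (4 * lyapunov r y z t)"
    using T by (intro mult_left_mono lyapunov_equivalent_energy r) auto
  also have "\<dots> \<le> 4 * ((1 + x T) powr N * lyapunov r y z T * exp (8 * N\<^sup>2 + integral {0..} error_rate / 16))"
    using * by simp
  also have "\<dots> \<le> 4 * ((1 + x T) powr N * energy r y z T * exp (8 * N\<^sup>2 + integral {0..} error_rate / 16))"
    using T by (intro mult_left_mono mult_right_mono lyapunov_equivalent_energy r) auto
  finally show ?thesis by (simp add: x_def mult_ac)
qed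

text \<open>Up to the time \<open>T\<close> from which \<open>weighted_energy_late\<close> applies, the weight is bounded by \<open>(1 + parabolic_time T)\<^sup>N\<close>
  uniformly in \<open>r\<close>, and the energy does not increase.\<close>

lemma weighted_energy_bound:
  assumes N: "N \<ge> 0"
  shows "\<exists>C>0. \<forall>r y z t. fourier_mode r y z \<longrightarrow> t \<ge> 0 \<longrightarrow>
    (1 + r\<^sup>2 / (1 + r\<^sup>2) * parabolic_time t) powr N * energy r y z t \<le> C * energy r y z 0"
proof -
  obtain T1 where T1: "T1 \<ge> 0" "\<And>t. t \<ge> T1 \<Longrightarrow> g t \<le> b t" using g_eventually_le_b by blast
  obtain T2 where T2: "T2 \<ge> 0" "\<And>t. t \<ge> T2 \<Longrightarrow> 32 * N \<le> (b t)\<^sup>2 * parabolic_time t"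
    using b_squared_parabolic_time_at_top by blast
  define T where "T = max T1 T2"
  have T: "T \<ge> 0" using T1 by (simp add: T_def)
  define K where "K = 4 * exp (8 * N\<^sup>2 + integral {0..} error_rate / 16)"
  define W where "W = (1 + parabolic_time T) powr N"
  have K: "K \<ge> 1"
  proof -
    have "0 \<le> integral {0..} error_rate" by (intro integral_nonneg error_rate_integrable) (auto intro: error_rate_nonneg)
    then have "1 \<le> exp (8 * N\<^sup>2 + integral {0..} error_rate / 16)" by simp
    then show ?thesis unfolding K_def by linarith
  qed
  have W: "W > 0" using parabolic_time_ge_1[OF T] by (simp add: W_def)
  have "(1 + r\<^sup>2 / (1 + r\<^sup>2) * parabolic_time t) powr N * energy r y z t \<le> K * W * energy r y z 0"
    if m: "fourier_mode r y z" and t: "t \<ge> 0" for r y z t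
  proof -
    define \<rho> where "\<rho> = r\<^sup>2 / (1 + r\<^sup>2)"
    have \<rho>: "0 \<le> \<rho>" "\<rho> \<le> 1" by (auto simp: \<rho>_def divide_le_eq add_pos_nonneg)
    have early: "(1 + \<rho> * parabolic_time s) powr N * energy r y z s \<le> W * energy r y z 0" if s: "0 \<le> s" "s \<le> T" for s
    proof -
      have "\<rho> * parabolic_time s \<le> 1 * parabolic_time T" using \<rho> parabolic_time_mono[OF s] parabolic_time_ge_1[OF s(1)] by (intro mult_mono) auto
      then have "(1 + \<rho> * parabolic_time s) powr N \<le> W"
        unfolding W_def using \<rho> parabolic_time_ge_1[OF s(1)] N by (intro powr_mono2) auto
      then show ?thesis
        using energy_decreasing[OF m _ s(1)] energy_nonneg W by (intro mult_mono) auto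
    qed
    show ?thesis
    proof (cases "t \<le> T")
      case True
      then have "(1 + \<rho> * parabolic_time t) powr N * energy r y z t \<le> 1 * (W * energy r y z 0)" using early t by simp
      also have "\<dots> \<le> K * (W * energy r y z 0)"
        using K W energy_nonneg by (intro mult_right_mono) auto
      finally show ?thesis by (simp add: \<rho>_def mult.assoc)
    next
      case False
      then have "(1 + \<rho> * parabolic_time t) powr N * energy r y z t \<le> K * ((1 + \<rho> * parabolic_time T) powr N * energy r y z T)"
        unfolding K_def \<rho>_def using T1 T2 T
        by (intro weighted_energy_late[OF m N]) (auto simp: T_def)
      also have "\<dots> \<le> K * (W * energy r y z 0)"
        using K early[OF T order_refl] by (intro mult_left_mono) auto
      finally show ?thesis by (simp add: \<rho>_def mult.assoc)
    qed
  qed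
  then show ?thesis using K W by (intro exI[of _ "K * W"]) auto
qed

text \<open>The equation has real coefficients, so the real analysis applies to both parts of a complex solution.\<close>

lemma Re_Im_fourier_mode:
  fixes U V W :: "real \<Rightarrow> complex"
  assumes r: "r > 0"
    and U: "\<And>t. t \<ge> 0 \<Longrightarrow> (U has_vector_derivative V t) (at t within {0..})"
    and V: "\<And>t. t \<ge> 0 \<Longrightarrow> (V has_vector_derivative W t) (at t within {0..})"
    and eq: "\<And>t. t \<ge> 0 \<Longrightarrow> W t + complex_of_real (r\<^sup>2) * U t + complex_of_real (b t + g t * r\<^sup>2) * V t = 0"
  shows "fourier_mode r (\<lambda>t. Re (U t)) (\<lambda>t. Re (V t))" "fourier_mode r (\<lambda>t. Im (U t)) (\<lambda>t. Im (V t))"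
proof -
  have W: "W t = - (complex_of_real (r\<^sup>2) * U t) - complex_of_real (total_damping r t) * V t" if "t \<ge> 0" for t
    using eq[OF that] unfolding total_damping_def by algebra
  have Re: "Re (W t) = - (r\<^sup>2 * Re (U t)) - total_damping r t * Re (V t)"
    and Im: "Im (W t) = - (r\<^sup>2 * Im (U t)) - total_damping r t * Im (V t)" if "t \<ge> 0" for t
    unfolding W[OF that] by (simp_all flip: of_real_power)
  show "fourier_mode r (\<lambda>t. Re (U t)) (\<lambda>t. Re (V t))"
    unfolding fourier_mode_def has_real_derivative_iff_has_vector_derivative
    using r bounded_linear.has_vector_derivative[OF bounded_linear_Re U]
      bounded_linear.has_vector_derivative[OF bounded_linear_Re V] by (auto simp flip: Re)
  show "fourier_mode r (\<lambda>t. Im (U t)) (\<lambda>t. Im (V t))"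
    unfolding fourier_mode_def has_real_derivative_iff_has_vector_derivative
    using r bounded_linear.has_vector_derivative[OF bounded_linear_Im U]
      bounded_linear.has_vector_derivative[OF bounded_linear_Im V] by (auto simp flip: Im)
qed

text \<open>The exponent \<open>N = s\<close> is the one needed for the data \<open>U 0\<close>, whose energy carries an extra factor \<open>r\<close>; for \<open>V 0\<close> the
  smaller exponent \<open>s - 1\<close> is enough, and the excess is discarded.\<close>

lemma frequency_estimate:
  assumes s: "s \<ge> 1"
  shows "\<exists>C>0. \<forall>r U V W. r > 0 \<longrightarrow>
    (\<forall>t\<ge>0. (U has_vector_derivative V t) (at t within {0..}) \<and>
      (V has_vector_derivative W t) (at t within {0..}) \<and>
      W t + complex_of_real (r\<^sup>2) * U t + complex_of_real (b t + g t * r\<^sup>2) * V t = 0) \<longrightarrow>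
    (\<forall>t\<ge>0. r powr (s - 1) * sqrt ((cmod (V t))\<^sup>2 + r\<^sup>2 * (cmod (U t))\<^sup>2) \<le>
      C * (parabolic_time t powr (- s / 2) * ((1 + r\<^sup>2) powr (s / 2) * cmod (U 0))
         + parabolic_time t powr (- (s - 1) / 2) * ((1 + r\<^sup>2) powr ((s - 1) / 2) * cmod (V 0))))"
proof -
  obtain C where C: "C > 0" "\<And>r y z t. fourier_mode r y z \<Longrightarrow> t \<ge> 0 \<Longrightarrow>
    (1 + r\<^sup>2 / (1 + r\<^sup>2) * parabolic_time t) powr s * energy r y z t \<le> C * energy r y z 0"
    using weighted_energy_bound[of s] s by auto
  have "r powr (s - 1) * sqrt ((cmod (V t))\<^sup>2 + r\<^sup>2 * (cmod (U t))\<^sup>2) \<le>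
      sqrt C * (parabolic_time t powr (- s / 2) * ((1 + r\<^sup>2) powr (s / 2) * cmod (U 0))
         + parabolic_time t powr (- (s - 1) / 2) * ((1 + r\<^sup>2) powr ((s - 1) / 2) * cmod (V 0)))"
    if r: "r > 0" and t: "t \<ge> 0" and ode: "\<And>t. t \<ge> 0 \<Longrightarrow> (U has_vector_derivative V t) (at t within {0..})"
      "\<And>t. t \<ge> 0 \<Longrightarrow> (V has_vector_derivative W t) (at t within {0..})"
      "\<And>t. t \<ge> 0 \<Longrightarrow> W t + complex_of_real (r\<^sup>2) * U t + complex_of_real (b t + g t * r\<^sup>2) * V t = 0"
    for r t and U V W :: "real \<Rightarrow> complex"
  proof -
    define q where "q = 1 + r\<^sup>2 / (1 + r\<^sup>2) * parabolic_time t"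
    define E where "E \<tau> = (cmod (V \<tau>))\<^sup>2 + r\<^sup>2 * (cmod (U \<tau>))\<^sup>2" for \<tau>
    have Lt: "parabolic_time t > 0" using parabolic_time_ge_1[OF t] by simp
    have q: "q \<ge> 1" using Lt by (simp add: q_def)
    have split: "E \<tau> = energy r (\<lambda>t. Re (U t)) (\<lambda>t. Re (V t)) \<tau> + energy r (\<lambda>t. Im (U t)) (\<lambda>t. Im (V t)) \<tau>" for \<tau>
      by (simp add: E_def energy_def cmod_power2 algebra_simps)
    have "q powr s * E t \<le> C * E 0"
      unfolding q_def split
      using C(2)[OF Re_Im_fourier_mode(1)[OF r ode] t] C(2)[OF Re_Im_fourier_mode(2)[OF r ode] t]
      by (simp add: distrib_left)
    then have "sqrt (q powr s * E t) \<le> sqrt (C * E 0)" by (rule real_sqrt_le_mono)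
    moreover have "sqrt (q powr s * E t) = q powr (s / 2) * sqrt (E t)"
      using q by (simp add: real_sqrt_mult powr_half_sqrt[symmetric] powr_powr)
    moreover have "sqrt (C * E 0) \<le> sqrt C * (cmod (V 0) + r * cmod (U 0))"
    proof -
      have "sqrt (E 0) \<le> sqrt ((cmod (V 0))\<^sup>2) + sqrt (r\<^sup>2 * (cmod (U 0))\<^sup>2)"
        unfolding E_def by (rule sqrt_add_le_add_sqrt) auto
      then have "sqrt (E 0) \<le> cmod (V 0) + r * cmod (U 0)" using r by (simp add: real_sqrt_mult)
      then show ?thesis using C(1) by (simp add: real_sqrt_mult)
    qed
    ultimately have E: "q powr (s / 2) * sqrt (E t) \<le> sqrt C * (cmod (V 0) + r * cmod (U 0))" by linarith
    have w1: "r powr s \<le> q powr (s / 2) * (parabolic_time t powr (- s / 2) * (1 + r\<^sup>2) powr (s / 2))"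
      unfolding q_def using r Lt s by (intro frequency_weight) auto
    have w2: "r powr (s - 1) \<le> q powr (s / 2) * (parabolic_time t powr (- (s - 1) / 2) * (1 + r\<^sup>2) powr ((s - 1) / 2))"
    proof -
      have "r powr (s - 1) \<le> q powr ((s - 1) / 2) * (parabolic_time t powr (- (s - 1) / 2) * (1 + r\<^sup>2) powr ((s - 1) / 2))"
        unfolding q_def using r Lt s by (intro frequency_weight) auto
      also have "\<dots> \<le> q powr (s / 2) * (parabolic_time t powr (- (s - 1) / 2) * (1 + r\<^sup>2) powr ((s - 1) / 2))"
        using q by (intro mult_right_mono powr_mono) auto
      finally show ?thesis .
    qed
    have "q powr (s / 2) * (r powr (s - 1) * sqrt (E t))
        \<le> r powr (s - 1) * (sqrt C * (cmod (V 0) + r * cmod (U 0)))"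
      using mult_left_mono[OF E, of "r powr (s - 1)"] by (simp add: mult_ac)
    also have "\<dots> = sqrt C * (r powr s * cmod (U 0) + r powr (s - 1) * cmod (V 0))"
      using r powr_add[of r "s - 1" 1] by (simp add: algebra_simps)
    also have "\<dots> \<le> sqrt C * (q powr (s / 2) * (parabolic_time t powr (- s / 2) * (1 + r\<^sup>2) powr (s / 2)) * cmod (U 0)
        + q powr (s / 2) * (parabolic_time t powr (- (s - 1) / 2) * (1 + r\<^sup>2) powr ((s - 1) / 2)) * cmod (V 0))"
      using C(1) w1 w2 by (intro mult_left_mono add_mono mult_right_mono) auto
    also have "\<dots> = q powr (s / 2) * (sqrt C * (parabolic_time t powr (- s / 2) * ((1 + r\<^sup>2) powr (s / 2) * cmod (U 0))
        + parabolic_time t powr (- (s - 1) / 2) * ((1 + r\<^sup>2) powr ((s - 1) / 2) * cmod (V 0))))"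
      by (simp add: algebra_simps)
    finally show ?thesis
      unfolding E_def[symmetric] using q by (simp add: mult_le_cancel_left_pos)
  qed
  then show ?thesis using C(1) by (intro exI[of _ "sqrt C"] conjI allI impI) (simp, blast)
qed

end

section \<open>Mean-square norms\<close>

text \<open>The squared norm as an extended number, meaningful also for functions not yet known to be square integrable.\<close>

definition sq_norm :: "('a::euclidean_space \<Rightarrow> complex) \<Rightarrow> ennreal" where
  "sq_norm f = (\<integral>\<^sup>+ x. ennreal ((cmod (f x))\<^sup>2) \<partial>lborel)"

lemma L2_iff: "f \<in> L2 \<longleftrightarrow> f \<in> borel_measurable borel \<and> sq_norm f < \<infinity>"
  by (auto simp: L2_def sq_norm_def integrable_iff_bounded)

lemma L2_measurable: "f \<in> L2 \<Longrightarrow> f \<in> borel_measurable borel"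
  by (simp add: L2_iff)

lemma L2_tendsto_iff: "L2_tendsto \<phi> f \<longleftrightarrow> (\<lambda>k. sq_norm (\<lambda>x. \<phi> k x - f x)) \<longlonglongrightarrow> 0"
  by (simp add: L2_tendsto_def sq_norm_def)

lemma sq_norm_eq_L2_norm:
  assumes "f \<in> L2"
  shows "sq_norm f = ennreal ((L2_norm f)\<^sup>2)"
  unfolding sq_norm_def L2_norm_def
  using assms by (subst nn_integral_eq_integral) (auto simp: L2_def)

lemma L2_norm_eq_sq_norm: "f \<in> borel_measurable borel \<Longrightarrow> L2_norm f = sqrt (enn2real (sq_norm f))"
  unfolding sq_norm_def L2_norm_def by (subst integral_eq_nn_integral) auto

lemma sq_norm_cmult: "f \<in> borel_measurable borel \<Longrightarrow> sq_norm (\<lambda>x. c * f x) = ennreal ((cmod c)\<^sup>2) * sq_norm f"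
  unfolding sq_norm_def by (subst nn_integral_cmult[symmetric])
    (auto simp: norm_mult power_mult_distrib ennreal_mult intro!: nn_integral_cong)

lemma sq_norm_uminus: "sq_norm (\<lambda>x. - f x) = sq_norm f"
  by (simp add: sq_norm_def)

lemma sq_norm_mono: "(AE x in lborel. cmod (f x) \<le> cmod (g x)) \<Longrightarrow> sq_norm f \<le> sq_norm g"
  unfolding sq_norm_def by (rule nn_integral_mono_AE) (auto intro!: ennreal_leI power_mono)

lemma sq_norm_cong_AE: "AE x in lborel. f x = g x \<Longrightarrow> sq_norm f = sq_norm g"
  unfolding sq_norm_def by (rule nn_integral_cong_AE) auto

lemma ennreal_norm_add_power2_le:
  fixes x y :: "'b::real_normed_vector"
  shows "ennreal ((norm (x + y))\<^sup>2) \<le> 2 * ennreal ((norm x)\<^sup>2) + 2 * ennreal ((norm y)\<^sup>2)"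
proof -
  have "(norm (x + y))\<^sup>2 \<le> (norm x + norm y)\<^sup>2" by (intro power_mono norm_triangle_ineq) auto
  also have "\<dots> \<le> 2 * (norm x)\<^sup>2 + 2 * (norm y)\<^sup>2"
    using sum_squares_bound[of "norm x" "norm y"] by (simp add: power2_sum)
  finally have "ennreal ((norm (x + y))\<^sup>2) \<le> ennreal (2 * (norm x)\<^sup>2 + 2 * (norm y)\<^sup>2)"
    by (rule ennreal_leI)
  also have "\<dots> = 2 * ennreal ((norm x)\<^sup>2) + 2 * ennreal ((norm y)\<^sup>2)"
    by (simp add: ennreal_mult)
  finally show ?thesis .
qed

lemma sq_norm_add_le_2:
  assumes [measurable]: "f \<in> borel_measurable borel" "g \<in> borel_measurable borel"
  shows "sq_norm (\<lambda>x. f x + g x) \<le> 2 * sq_norm f + 2 * sq_norm g"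
proof -
  have "sq_norm (\<lambda>x. f x + g x)
      \<le> (\<integral>\<^sup>+ x. 2 * ennreal ((cmod (f x))\<^sup>2) + 2 * ennreal ((cmod (g x))\<^sup>2) \<partial>lborel)"
    unfolding sq_norm_def by (intro nn_integral_mono ennreal_norm_add_power2_le)
  also have "\<dots> = 2 * sq_norm f + 2 * sq_norm g"
    unfolding sq_norm_def by (simp add: nn_integral_add nn_integral_cmult)
  finally show ?thesis .
qed

lemma sq_norm_diff_le_2:
  assumes "f \<in> borel_measurable borel" "g \<in> borel_measurable borel"
  shows "sq_norm (\<lambda>x. f x - g x) \<le> 2 * sq_norm f + 2 * sq_norm g"
  using sq_norm_add_le_2[of f "\<lambda>x. - g x"] assms by (simp add: sq_norm_uminus)

lemma L2_add: "f \<in> L2 \<Longrightarrow> g \<in> L2 \<Longrightarrow> (\<lambda>x. f x + g x) \<in> L2"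
  using sq_norm_add_le_2[of f g]
  by (auto simp: L2_iff ennreal_mult_less_top intro: le_less_trans[where y = "2 * sq_norm f + 2 * sq_norm g"])

lemma L2_diff: "f \<in> L2 \<Longrightarrow> g \<in> L2 \<Longrightarrow> (\<lambda>x. f x - g x) \<in> L2"
  using sq_norm_diff_le_2[of f g]
  by (auto simp: L2_iff ennreal_mult_less_top intro: le_less_trans[where y = "2 * sq_norm f + 2 * sq_norm g"])

lemma L2_cmult: "f \<in> L2 \<Longrightarrow> (\<lambda>x. c * f x) \<in> L2"
  by (auto simp: L2_iff sq_norm_cmult ennreal_mult_less_top)

lemma L2_bound:
  "f \<in> borel_measurable borel \<Longrightarrow> g \<in> L2 \<Longrightarrow> (AE x in lborel. cmod (f x) \<le> cmod (g x)) \<Longrightarrow> f \<in> L2"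
  using sq_norm_mono[of f g] by (auto simp: L2_iff intro: le_less_trans)

lemma L2_tendsto_diff:
  assumes "\<And>k. \<phi> k \<in> borel_measurable borel" "\<And>k. \<psi> k \<in> borel_measurable borel"
    and "f \<in> borel_measurable borel" "g \<in> borel_measurable borel"
    and "L2_tendsto \<phi> f" "L2_tendsto \<psi> g"
  shows "L2_tendsto (\<lambda>k x. \<phi> k x - \<psi> k x) (\<lambda>x. f x - g x)"
  unfolding L2_tendsto_iff
proof (rule tendsto_sandwich[OF _ _ tendsto_const])
  show "\<forall>\<^sub>F k in sequentially. sq_norm (\<lambda>x. \<phi> k x - \<psi> k x - (f x - g x))
      \<le> 2 * sq_norm (\<lambda>x. \<phi> k x - f x) + 2 * sq_norm (\<lambda>x. \<psi> k x - g x)"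
    using sq_norm_diff_le_2[of "\<lambda>x. \<phi> _ x - f x" "\<lambda>x. \<psi> _ x - g x"] assms
    by (intro always_eventually) (simp add: algebra_simps)
  show "(\<lambda>k. 2 * sq_norm (\<lambda>x. \<phi> k x - f x) + 2 * sq_norm (\<lambda>x. \<psi> k x - g x)) \<longlonglongrightarrow> 0"
    using assms(5,6) unfolding L2_tendsto_iff
    by (auto intro!: tendsto_eq_intros ennreal_tendsto_cmult)
qed simp

lemma L2_norm_nonneg: "L2_norm f \<ge> 0"
  by (simp add: L2_norm_def)

text \<open>Expanding the square, the mixed term is bounded by the Cauchy--Schwarz inequality for nonnegative integrals.\<close>

lemma L2_norm_minkowski:
  assumes f: "f \<in> L2" and g: "g \<in> L2"
  shows "L2_norm (\<lambda>x. f x + g x) \<le> L2_norm f + L2_norm g"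
proof -
  have [measurable]: "f \<in> borel_measurable borel" "g \<in> borel_measurable borel"
    using f g by (auto intro: L2_measurable)
  define a b where "a = L2_norm f" and "b = L2_norm g"
  have ab: "a \<ge> 0" "b \<ge> 0" by (auto simp: a_def b_def L2_norm_nonneg)
  define I where "I = (\<integral>\<^sup>+ x. ennreal (cmod (f x)) * ennreal (cmod (g x)) \<partial>lborel)"
  have "I\<^sup>2 \<le> sq_norm f * sq_norm g"
    unfolding I_def sq_norm_def ennreal_power[OF norm_ge_zero, symmetric]
    by (rule Cauchy_Schwarz_nn_integral) measurable
  also have "\<dots> = ennreal ((a * b)\<^sup>2)"
    unfolding sq_norm_eq_L2_norm[OF f] sq_norm_eq_L2_norm[OF g] a_def b_def
    by (simp only: power_mult_distrib ennreal_mult zero_le_power2)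
  finally have I2: "I\<^sup>2 \<le> ennreal ((a * b)\<^sup>2)" .
  then have "I\<^sup>2 < \<infinity>" by (rule le_less_trans) simp
  then have "I < \<infinity>" by (simp add: power_less_top_ennreal)
  then obtain i where i: "I = ennreal i" "i \<ge> 0"
    using ennreal_enn2real[of I] enn2real_nonneg[of I] by (metis infinity_ennreal_def)
  have "i\<^sup>2 \<le> (a * b)\<^sup>2" using I2 i by (simp add: ennreal_power)
  then have "i \<le> a * b" by (rule power2_le_imp_le) (use ab in simp)
  then have I: "I \<le> ennreal (a * b)" unfolding i by (rule ennreal_leI)
  have "sq_norm (\<lambda>x. f x + g x) \<le> (\<integral>\<^sup>+ x. ennreal ((cmod (f x))\<^sup>2) + ennreal ((cmod (g x))\<^sup>2)
      + 2 * (ennreal (cmod (f x)) * ennreal (cmod (g x))) \<partial>lborel)"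
    unfolding sq_norm_def
  proof (rule nn_integral_mono)
    fix x
    have "(cmod (f x + g x))\<^sup>2 \<le> (cmod (f x) + cmod (g x))\<^sup>2" by (intro power_mono norm_triangle_ineq) auto
    also have "\<dots> = (cmod (f x))\<^sup>2 + (cmod (g x))\<^sup>2 + 2 * (cmod (f x) * cmod (g x))"
      by (simp add: power2_sum)
    finally have "ennreal ((cmod (f x + g x))\<^sup>2)
        \<le> ennreal ((cmod (f x))\<^sup>2 + (cmod (g x))\<^sup>2 + 2 * (cmod (f x) * cmod (g x)))" by (rule ennreal_leI)
    also have "\<dots> = ennreal ((cmod (f x))\<^sup>2) + ennreal ((cmod (g x))\<^sup>2)
        + 2 * (ennreal (cmod (f x)) * ennreal (cmod (g x)))"
      by (simp add: ennreal_mult)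
    finally show "ennreal ((cmod (f x + g x))\<^sup>2) \<le> ennreal ((cmod (f x))\<^sup>2) + ennreal ((cmod (g x))\<^sup>2)
        + 2 * (ennreal (cmod (f x)) * ennreal (cmod (g x)))" .
  qed
  also have "\<dots> = sq_norm f + sq_norm g + 2 * I"
    unfolding sq_norm_def I_def by (simp add: nn_integral_add nn_integral_cmult)
  also have "\<dots> \<le> ennreal (a\<^sup>2) + ennreal (b\<^sup>2) + 2 * ennreal (a * b)"
    unfolding sq_norm_eq_L2_norm[OF f] sq_norm_eq_L2_norm[OF g] a_def[symmetric] b_def[symmetric]
    by (intro add_mono mult_left_mono I order_refl zero_le_numeral)
  also have "\<dots> = ennreal ((a + b)\<^sup>2)"
  proof -
    have "(a + b)\<^sup>2 = a\<^sup>2 + b\<^sup>2 + 2 * (a * b)" by (simp add: power2_sum)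
    then show ?thesis
      using ab by (simp only: ennreal_plus ennreal_mult ennreal_numeral zero_le_power2
          mult_nonneg_nonneg add_nonneg_nonneg zero_le_numeral)
  qed
  finally have "(L2_norm (\<lambda>x. f x + g x))\<^sup>2 \<le> (a + b)\<^sup>2"
    unfolding sq_norm_eq_L2_norm[OF L2_add[OF f g]] by simp
  then have "L2_norm (\<lambda>x. f x + g x) \<le> a + b" by (rule power2_le_imp_le) (use ab in simp)
  then show ?thesis by (simp add: a_def b_def)
qed

lemma L2_norm_tendsto:
  assumes \<phi>: "\<And>k. \<phi> k \<in> L2" and f: "f \<in> L2" and lim: "L2_tendsto \<phi> f"
  shows "(\<lambda>k. L2_norm (\<phi> k)) \<longlonglongrightarrow> L2_norm f"
proof -
  have "(\<lambda>k. ennreal ((L2_norm (\<lambda>x. \<phi> k x - f x))\<^sup>2)) \<longlonglongrightarrow> 0"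
    using lim unfolding L2_tendsto_iff by (simp add: sq_norm_eq_L2_norm[OF L2_diff[OF \<phi> f]])
  then have "(\<lambda>k. (L2_norm (\<lambda>x. \<phi> k x - f x))\<^sup>2) \<longlonglongrightarrow> 0"
    by (subst (asm) ennreal_0[symmetric], subst (asm) tendsto_ennreal_iff) auto
  then have "(\<lambda>k. sqrt ((L2_norm (\<lambda>x. \<phi> k x - f x))\<^sup>2)) \<longlonglongrightarrow> sqrt 0" by (rule tendsto_real_sqrt)
  then have d: "(\<lambda>k. L2_norm (\<lambda>x. \<phi> k x - f x)) \<longlonglongrightarrow> 0" by (simp add: L2_norm_nonneg)
  have "\<bar>L2_norm (\<phi> k) - L2_norm f\<bar> \<le> L2_norm (\<lambda>x. \<phi> k x - f x)" for k
  proof -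
    have "L2_norm (\<phi> k) \<le> L2_norm (\<lambda>x. \<phi> k x - f x) + L2_norm f"
      using L2_norm_minkowski[OF L2_diff[OF \<phi>[of k] f] f] by simp
    moreover have "L2_norm f \<le> L2_norm (\<lambda>x. \<phi> k x - f x) + L2_norm (\<phi> k)"
      using L2_norm_minkowski[OF L2_diff[OF f \<phi>[of k]] \<phi>[of k]]
      by (simp add: L2_norm_def norm_minus_commute)
    ultimately show ?thesis by linarith
  qed
  then show ?thesis
    by (intro Lim_null_comparison[OF _ d, THEN LIM_zero_cancel]) auto
qed

section \<open>Gaussian kernels\<close>

lemma
  fixes f :: "'a::euclidean_space \<Rightarrow> real \<Rightarrow> complex"
  assumes f: "\<And>b. b \<in> Basis \<Longrightarrow> integrable lborel (f b)"
  shows integrable_lborel_prod_Basis: "integrable lborel (\<lambda>x::'a. \<Prod>b\<in>Basis. f b (x \<bullet> b))"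
    and integral_lborel_prod_Basis:
      "(LINT x|lborel. (\<Prod>b\<in>Basis. f b ((x::'a) \<bullet> b))) = (\<Prod>b\<in>Basis. LINT t|lborel. f b t)"
proof -
  interpret product_sigma_finite "\<lambda>_::'a. lborel :: real measure" ..
  have f_meas: "f b \<in> borel_measurable borel" if "b \<in> Basis" for b
    using borel_measurable_integrable[OF f[OF that]] by simp
  then have [measurable]: "(\<lambda>x::'a. \<Prod>b\<in>Basis. f b (x \<bullet> b)) \<in> borel_measurable borel"
    by (intro borel_measurable_prod measurable_compose[OF _ f_meas]) auto
  have T: "(\<lambda>y. \<Sum>b\<in>Basis. y b *\<^sub>R b) \<in> (\<Pi>\<^sub>M b\<in>(Basis::'a set). lborel) \<rightarrow>\<^sub>M borel"
    by measurable
  have eq: "(\<Prod>b\<in>Basis. f b ((\<Sum>c\<in>Basis. y c *\<^sub>R c) \<bullet> b)) = (\<Prod>b\<in>Basis. f b (y b))" for y :: "'a \<Rightarrow> real"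
    by (intro prod.cong refl) (simp add: inner_sum_left_Basis)
  show "integrable lborel (\<lambda>x::'a. \<Prod>b\<in>Basis. f b (x \<bullet> b))"
    unfolding lborel_eq[where 'a='a] using product_integrable_prod[of Basis f] f
    by (subst integrable_distr_eq[OF T]) (simp_all add: eq)
  show "(LINT x|lborel. (\<Prod>b\<in>Basis. f b ((x::'a) \<bullet> b))) = (\<Prod>b\<in>Basis. LINT t|lborel. f b t)"
    unfolding lborel_eq[where 'a='a] using product_integral_prod[of Basis f] f
    by (subst integral_distr[OF T]) (simp_all add: eq)
qed

lemma cis_measurable[measurable]: "cis \<in> borel_measurable borel"
  by (intro borel_measurable_continuous_onI continuous_intros)

definition gauss :: "real \<Rightarrow> 'a::euclidean_space \<Rightarrow> real" where
  "gauss \<sigma> \<xi> = exp (- (\<sigma>\<^sup>2 * (norm \<xi>)\<^sup>2) / 2)"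

text \<open>The density of a centred normal vector with independent components of standard deviation \<open>\<sigma>\<close>: the
  heat kernel at time \<open>\<sigma>\<^sup>2/2\<close>.\<close>

definition heat :: "real \<Rightarrow> 'a::euclidean_space \<Rightarrow> real" where
  "heat \<sigma> x = (\<Prod>i\<in>Basis. normal_density 0 \<sigma> (x \<bullet> i))"

lemma gauss_prod: "gauss \<sigma> (\<xi>::'a::euclidean_space) = (\<Prod>i\<in>Basis. exp (- (\<sigma>\<^sup>2 * (\<xi> \<bullet> i)\<^sup>2) / 2))"
  unfolding gauss_def euclidean_inner[of \<xi> \<xi>] power2_norm_eq_inner
  by (simp add: exp_sum[symmetric] sum_distrib_left sum_divide_distrib sum_negf power2_eq_square)

lemma cis_inner_prod: "cis ((x::'a::euclidean_space) \<bullet> \<xi>) = (\<Prod>i\<in>Basis. cis ((x \<bullet> i) * (\<xi> \<bullet> i)))"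
proof -
  have "cis (\<Sum>i\<in>I. F i) = (\<Prod>i\<in>I. cis (F i))" if "finite I" for I and F :: "'a \<Rightarrow> real"
    using that by induction (auto simp: cis_mult[symmetric] simp flip: cis_mult)
  then show ?thesis by (subst euclidean_inner) auto
qed

text \<open>After rescaling, this is the characteristic function of the standard normal distribution.\<close>

lemma
  assumes "\<sigma> > 0"
  shows integrable_cis_exp: "integrable lborel (\<lambda>s. cis (x * s) * complex_of_real (exp (- (\<sigma>\<^sup>2 * s\<^sup>2) / 2)))"
    and integral_cis_exp: "(LINT s|lborel. cis (x * s) * complex_of_real (exp (- (\<sigma>\<^sup>2 * s\<^sup>2) / 2)))
      = complex_of_real (2 * pi * normal_density 0 \<sigma> x)"
proof -
  define G where "G s = cis (x / \<sigma> * s) * complex_of_real (std_normal_density s)" for s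
  have G_int: "integrable lborel G"
    unfolding G_def
    by (rule Bochner_Integration.integrable_bound[where f=std_normal_density]) (auto simp: norm_mult)
  have G: "(LINT s|lborel. G s) = complex_of_real (exp (- (x / \<sigma>)\<^sup>2 / 2))"
  proof -
    have "char std_normal_distribution (x / \<sigma>) = (LINT s|lborel. G s)"
      unfolding char_def G_def
      by (subst integral_density) (auto simp: cis_conv_exp scaleR_conv_of_real mult_ac)
    then show ?thesis by (simp add: char_std_normal_distribution)
  qed
  have eq: "cis (x * s) * complex_of_real (exp (- (\<sigma>\<^sup>2 * s\<^sup>2) / 2))
      = complex_of_real (sqrt (2 * pi)) * G (0 + \<sigma> * s)" for s
    using assms by (simp add: G_def std_normal_density_def power_mult_distrib)
  show "integrable lborel (\<lambda>s. cis (x * s) * complex_of_real (exp (- (\<sigma>\<^sup>2 * s\<^sup>2) / 2)))"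
    unfolding eq using assms G_int
    by (intro integrable_mult_right lborel_integrable_real_affine) auto
  have "(LINT s|lborel. G (0 + \<sigma> * s)) = complex_of_real (exp (- (x / \<sigma>)\<^sup>2 / 2) / \<sigma>)"
    using lborel_integral_real_affine[of \<sigma> G 0] assms
    by (simp add: G scaleR_conv_of_real field_simps)
  moreover have real: "sqrt (2 * pi) * (exp (- (x / \<sigma>)\<^sup>2 / 2) / \<sigma>) = 2 * pi * normal_density 0 \<sigma> x"
  proof -
    have "2 * pi * (1 / sqrt (2 * pi * \<sigma>\<^sup>2)) = 2 * pi / sqrt (2 * pi) / \<sigma>"
      using assms by (simp add: real_sqrt_mult)
    also have "2 * pi / sqrt (2 * pi) = sqrt (2 * pi)" by (rule real_div_sqrt) simp
    finally have c: "2 * pi * (1 / sqrt (2 * pi * \<sigma>\<^sup>2)) = sqrt (2 * pi) / \<sigma>" .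
    have "2 * pi * normal_density 0 \<sigma> x
        = (2 * pi * (1 / sqrt (2 * pi * \<sigma>\<^sup>2))) * exp (- (x - 0)\<^sup>2 / (2 * \<sigma>\<^sup>2))"
      unfolding normal_density_def by (simp only: mult.assoc)
    also have "\<dots> = sqrt (2 * pi) * (exp (- (x / \<sigma>)\<^sup>2 / 2) / \<sigma>)"
      unfolding c by (simp add: power_divide mult.commute)
    finally show ?thesis ..
  qed
  ultimately show "(LINT s|lborel. cis (x * s) * complex_of_real (exp (- (\<sigma>\<^sup>2 * s\<^sup>2) / 2)))
      = complex_of_real (2 * pi * normal_density 0 \<sigma> x)"
    unfolding eq using real
    by (simp only: integral_mult_right_zero of_real_mult[symmetric])
qed

lemma
  fixes x :: "'a::euclidean_space"
  assumes "\<sigma> > 0"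
  shows integrable_cis_gauss: "integrable lborel (\<lambda>\<xi>::'a. cis (x \<bullet> \<xi>) * complex_of_real (gauss \<sigma> \<xi>))"
    and integral_cis_gauss: "(LINT \<xi>|lborel. cis (x \<bullet> \<xi>) * complex_of_real (gauss \<sigma> \<xi>))
      = complex_of_real ((2 * pi) ^ DIM('a) * heat \<sigma> x)"
proof -
  have eq: "cis (x \<bullet> \<xi>) * complex_of_real (gauss \<sigma> \<xi>)
      = (\<Prod>i\<in>Basis. (\<lambda>s. cis ((x \<bullet> i) * s) * complex_of_real (exp (- (\<sigma>\<^sup>2 * s\<^sup>2) / 2))) (\<xi> \<bullet> i))" for \<xi> :: 'a
    by (simp add: gauss_prod cis_inner_prod prod.distrib)
  show "integrable lborel (\<lambda>\<xi>::'a. cis (x \<bullet> \<xi>) * complex_of_real (gauss \<sigma> \<xi>))"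
    unfolding eq by (rule integrable_lborel_prod_Basis) (rule integrable_cis_exp[OF assms])
  show "(LINT \<xi>|lborel. cis (x \<bullet> \<xi>) * complex_of_real (gauss \<sigma> \<xi>))
      = complex_of_real ((2 * pi) ^ DIM('a) * heat \<sigma> x)"
    unfolding eq
    by (subst integral_lborel_prod_Basis, rule integrable_cis_exp[OF assms], subst integral_cis_exp[OF assms])
      (simp add: heat_def prod.distrib)
qed

lemma heat_nonneg[simp]: "heat \<sigma> x \<ge> 0"
  by (simp add: heat_def prod_nonneg)

lemma heat_measurable[measurable]: "heat \<sigma> \<in> borel_measurable borel"
  unfolding heat_def[abs_def] by measurable

lemma gauss_measurable[measurable]: "gauss \<sigma> \<in> borel_measurable borel"
  unfolding gauss_def[abs_def] by measurable

lemma heat_minus_commute: "heat \<sigma> (x - y) = heat \<sigma> (y - x)"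
  by (simp add: heat_def inner_diff_left normal_density_def power2_commute)

lemma nn_integral_heat:
  assumes "\<sigma> > 0"
  shows "(\<integral>\<^sup>+ y. ennreal (heat \<sigma> (x - y)) \<partial>lborel) = 1"
proof -
  have "heat \<sigma> (x - y) = (\<Prod>i\<in>Basis. normal_density (x \<bullet> i) \<sigma> (y \<bullet> i))" for y
    by (simp add: heat_def inner_diff_left normal_density_def power2_commute)
  then have "(\<integral>\<^sup>+ y. ennreal (heat \<sigma> (x - y)) \<partial>lborel)
      = (\<integral>\<^sup>+ y. (\<Prod>i\<in>Basis. ennreal (normal_density (x \<bullet> i) \<sigma> (y \<bullet> i))) \<partial>lborel)"
    by (simp add: prod_ennreal)
  also have "\<dots> = 1"
    using assms by (subst nn_integral_lborel_prod) (auto simp: nn_integral_eq_integral)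
  finally show ?thesis .
qed

lemma heat_bounded:
  obtains c where "\<And>x::'a::euclidean_space. heat \<sigma> x \<le> c"
proof
  fix x :: 'a
  show "heat \<sigma> x \<le> (\<Prod>i\<in>(Basis::'a set). 1 / sqrt (2 * pi * \<sigma>\<^sup>2))"
    unfolding heat_def normal_density_def
    by (intro prod_mono) (auto intro!: divide_right_mono)
qed

text \<open>Half of the exponent is estimated by its value at distance \<open>d\<close>; the other half is again a Gaussian, of deviation
  \<open>sqrt 2 * \<sigma>\<close> and unit mass. This shows that the mass outside a ball vanishes as \<open>\<sigma>\<close> tends to \<open>0\<close>.\<close>

lemma heat_tail:
  fixes x y :: "'a::euclidean_space"
  assumes "\<sigma> > 0" "d > 0" "d \<le> norm (x - y)"
  shows "heat \<sigma> (x - y) \<le> sqrt 2 ^ DIM('a) * exp (- d\<^sup>2 / (4 * \<sigma>\<^sup>2)) * heat (sqrt 2 * \<sigma>) (x - y)"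
proof -
  define z where "z = x - y"
  have nd: "normal_density 0 \<sigma> t = sqrt 2 * exp (- t\<^sup>2 / (4 * \<sigma>\<^sup>2)) * normal_density 0 (sqrt 2 * \<sigma>) t" for t
  proof -
    have "exp (- t\<^sup>2 / (2 * \<sigma>\<^sup>2)) = exp (- t\<^sup>2 / (4 * \<sigma>\<^sup>2)) * exp (- t\<^sup>2 / (4 * \<sigma>\<^sup>2))"
      by (simp add: exp_add[symmetric] field_simps)
    moreover have "sqrt (2 * pi * (sqrt 2 * \<sigma>)\<^sup>2) = sqrt 2 * sqrt (2 * pi * \<sigma>\<^sup>2)"
      by (simp add: power_mult_distrib real_sqrt_mult)
    moreover have "2 * (sqrt 2 * \<sigma>)\<^sup>2 = 4 * \<sigma>\<^sup>2" by (simp add: power_mult_distrib)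
    ultimately show ?thesis unfolding normal_density_def by simp
  qed
  have "heat \<sigma> z = sqrt 2 ^ DIM('a) * (\<Prod>i\<in>Basis. exp (- (z \<bullet> i)\<^sup>2 / (4 * \<sigma>\<^sup>2))) * heat (sqrt 2 * \<sigma>) z"
    unfolding heat_def by (subst nd) (simp add: prod.distrib)
  also have "(\<Prod>i\<in>Basis. exp (- (z \<bullet> i)\<^sup>2 / (4 * \<sigma>\<^sup>2))) = exp (- (norm z)\<^sup>2 / (4 * \<sigma>\<^sup>2))"
    unfolding power2_norm_eq_inner euclidean_inner[of z z]
    by (simp add: exp_sum[symmetric] sum_divide_distrib sum_negf power2_eq_square)
  also have "exp (- (norm z)\<^sup>2 / (4 * \<sigma>\<^sup>2)) \<le> exp (- d\<^sup>2 / (4 * \<sigma>\<^sup>2))"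
    using assms by (auto simp: z_def intro!: divide_right_mono power_mono)
  finally show ?thesis
    by (simp add: z_def mult_left_mono mult_right_mono)
qed

section \<open>Vanishing mean-square oscillation at small scales\<close>

lemma tendsto_0_ennrealI:
  fixes X :: "nat \<Rightarrow> ennreal"
  assumes "\<And>e::real. e > 0 \<Longrightarrow> \<forall>\<^sub>F k in sequentially. X k \<le> ennreal e"
  shows "X \<longlonglongrightarrow> 0"
proof (rule order_tendstoI)
  fix a :: ennreal assume "0 < a"
  then obtain c where c: "0 < c" "c < a" using dense by blast
  from c(2) have "c < top" by (rule less_le_trans) simp
  with c have "0 < enn2real c" "ennreal (enn2real c) = c" by (auto simp: enn2real_positive_iff)
  with assms[of "enn2real c"] have "\<forall>\<^sub>F k in sequentially. X k \<le> c" by simp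
  then show "\<forall>\<^sub>F k in sequentially. X k < a" by eventually_elim (use c in auto)
qed simp

lemma nn_integral_heat_left:
  fixes F :: "'a::euclidean_space \<Rightarrow> ennreal"
  assumes [measurable]: "F \<in> borel_measurable borel" and "\<sigma> > 0"
  shows "(\<integral>\<^sup>+ x. \<integral>\<^sup>+ y. F x * ennreal (heat \<sigma> (x - y)) \<partial>lborel \<partial>lborel) = (\<integral>\<^sup>+ x. F x \<partial>lborel)"
  by (simp add: nn_integral_cmult nn_integral_heat assms)

lemma nn_integral_heat_right:
  fixes F :: "'a::euclidean_space \<Rightarrow> ennreal"
  assumes [measurable]: "F \<in> borel_measurable borel" and "\<sigma> > 0"
  shows "(\<integral>\<^sup>+ x. \<integral>\<^sup>+ y. F y * ennreal (heat \<sigma> (x - y)) \<partial>lborel \<partial>lborel) = (\<integral>\<^sup>+ x. F x \<partial>lborel)"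
proof -
  have "(\<integral>\<^sup>+ x. \<integral>\<^sup>+ y. F y * ennreal (heat \<sigma> (x - y)) \<partial>lborel \<partial>lborel)
      = (\<integral>\<^sup>+ y. \<integral>\<^sup>+ x. F y * ennreal (heat \<sigma> (x - y)) \<partial>lborel \<partial>lborel)"
    by (rule lborel_pair.Fubini') measurable
  also have "\<dots> = (\<integral>\<^sup>+ y. \<integral>\<^sup>+ x. F y * ennreal (heat \<sigma> (y - x)) \<partial>lborel \<partial>lborel)"
    by (simp only: heat_minus_commute)
  also have "\<dots> = (\<integral>\<^sup>+ x. F x \<partial>lborel)" by (rule nn_integral_heat_left[OF assms])
  finally show ?thesis .
qed

text \<open>The mean square oscillation of \<open>f\<close> at distances of order \<open>\<sigma>\<close>. It bounds the error of Gaussian regularization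
  (\<open>sq_norm_heat_conv_diff\<close>) and, unlike that error, is the square of a seminorm expressed by nonnegative integrals only, so
  that it makes sense for every measurable function.\<close>

definition osc :: "real \<Rightarrow> ('a::euclidean_space \<Rightarrow> complex) \<Rightarrow> ennreal" where
  "osc \<sigma> f = (\<integral>\<^sup>+ x. \<integral>\<^sup>+ y. ennreal ((cmod (f x - f y))\<^sup>2) * ennreal (heat \<sigma> (x - y)) \<partial>lborel \<partial>lborel)"

lemma osc_add_le:
  fixes f :: "'a::euclidean_space \<Rightarrow> complex"
  assumes [measurable]: "f \<in> borel_measurable borel" "g \<in> borel_measurable borel"
  shows "osc \<sigma> (\<lambda>x. f x + g x) \<le> 2 * osc \<sigma> f + 2 * osc \<sigma> g"
proof -
  have "osc \<sigma> (\<lambda>x. f x + g x) \<le> (\<integral>\<^sup>+ x. \<integral>\<^sup>+ y.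
      2 * (ennreal ((cmod (f x - f y))\<^sup>2) * ennreal (heat \<sigma> (x - y)))
      + 2 * (ennreal ((cmod (g x - g y))\<^sup>2) * ennreal (heat \<sigma> (x - y))) \<partial>lborel \<partial>lborel)"
    unfolding osc_def
  proof (intro nn_integral_mono)
    fix x y :: 'a
    have "ennreal ((cmod (f x + g x - (f y + g y)))\<^sup>2)
        \<le> 2 * ennreal ((cmod (f x - f y))\<^sup>2) + 2 * ennreal ((cmod (g x - g y))\<^sup>2)"
      using ennreal_norm_add_power2_le[of "f x - f y" "g x - g y"] by (simp add: algebra_simps)
    from mult_right_mono[OF this, of "ennreal (heat \<sigma> (x - y))"]
    show "ennreal ((cmod (f x + g x - (f y + g y)))\<^sup>2) * ennreal (heat \<sigma> (x - y))
        \<le> 2 * (ennreal ((cmod (f x - f y))\<^sup>2) * ennreal (heat \<sigma> (x - y)))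
          + 2 * (ennreal ((cmod (g x - g y))\<^sup>2) * ennreal (heat \<sigma> (x - y)))"
      by (simp add: distrib_right mult.assoc)
  qed
  also have "\<dots> = 2 * osc \<sigma> f + 2 * osc \<sigma> g"
    unfolding osc_def by (simp add: nn_integral_add nn_integral_cmult)
  finally show ?thesis .
qed

lemma osc_cmult:
  fixes f :: "'a::euclidean_space \<Rightarrow> complex"
  assumes [measurable]: "f \<in> borel_measurable borel"
  shows "osc \<sigma> (\<lambda>x. c * f x) = ennreal ((cmod c)\<^sup>2) * osc \<sigma> f"
proof -
  have "osc \<sigma> (\<lambda>x. c * f x) = (\<integral>\<^sup>+ x. \<integral>\<^sup>+ y.
      ennreal ((cmod c)\<^sup>2) * (ennreal ((cmod (f x - f y))\<^sup>2) * ennreal (heat \<sigma> (x - y))) \<partial>lborel \<partial>lborel)"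
    unfolding osc_def
    by (intro nn_integral_cong)
      (simp add: norm_mult power_mult_distrib ennreal_mult mult.assoc flip: right_diff_distrib)
  also have "\<dots> = ennreal ((cmod c)\<^sup>2) * osc \<sigma> f"
    unfolding osc_def by (simp add: nn_integral_cmult)
  finally show ?thesis .
qed

lemma osc_le_sq_norm:
  fixes f :: "'a::euclidean_space \<Rightarrow> complex"
  assumes [measurable]: "f \<in> borel_measurable borel" and s: "\<sigma> > 0"
  shows "osc \<sigma> f \<le> 4 * sq_norm f"
proof -
  have "osc \<sigma> f \<le> (\<integral>\<^sup>+ x. \<integral>\<^sup>+ y.
      2 * (ennreal ((cmod (f x))\<^sup>2) * ennreal (heat \<sigma> (x - y)))
      + 2 * (ennreal ((cmod (f y))\<^sup>2) * ennreal (heat \<sigma> (x - y))) \<partial>lborel \<partial>lborel)"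
    unfolding osc_def
  proof (intro nn_integral_mono)
    fix x y :: 'a
    have "ennreal ((cmod (f x - f y))\<^sup>2) \<le> 2 * ennreal ((cmod (f x))\<^sup>2) + 2 * ennreal ((cmod (f y))\<^sup>2)"
      using ennreal_norm_add_power2_le[of "f x" "- f y"] by simp
    from mult_right_mono[OF this, of "ennreal (heat \<sigma> (x - y))"]
    show "ennreal ((cmod (f x - f y))\<^sup>2) * ennreal (heat \<sigma> (x - y))
        \<le> 2 * (ennreal ((cmod (f x))\<^sup>2) * ennreal (heat \<sigma> (x - y)))
          + 2 * (ennreal ((cmod (f y))\<^sup>2) * ennreal (heat \<sigma> (x - y)))"
      by (simp add: distrib_right mult.assoc)
  qed
  also have "\<dots> = 2 * sq_norm f + 2 * sq_norm f"
    unfolding sq_norm_def using s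
    by (simp add: nn_integral_add nn_integral_cmult nn_integral_heat nn_integral_heat_right)
  also have "\<dots> = 4 * sq_norm f" by (simp flip: distrib_right)
  finally show ?thesis .
qed

text \<open>The functions with vanishing oscillation form a subspace that is closed in mean square. It contains the
  indicators of open sets of finite measure and therefore, by outer regularity and simple approximation, every
  square integrable function.\<close>

definition vanishing_osc :: "('a::euclidean_space \<Rightarrow> complex) \<Rightarrow> bool" where
  "vanishing_osc f \<longleftrightarrow> f \<in> borel_measurable borel \<and> (\<lambda>k. osc (1 / real (Suc k)) f) \<longlonglongrightarrow> 0"

lemma vanishing_osc_0: "vanishing_osc (\<lambda>x. 0)"
  by (simp add: vanishing_osc_def osc_def)

lemma vanishing_osc_add:
  assumes "vanishing_osc f" "vanishing_osc g"
  shows "vanishing_osc (\<lambda>x. f x + g x)"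
proof -
  have [measurable]: "f \<in> borel_measurable borel" "g \<in> borel_measurable borel"
    using assms by (auto simp: vanishing_osc_def)
  have "(\<lambda>k. osc (1 / real (Suc k)) (\<lambda>x. f x + g x)) \<longlonglongrightarrow> 0"
  proof (rule tendsto_sandwich[OF _ _ tendsto_const])
    show "\<forall>\<^sub>F k in sequentially. osc (1 / real (Suc k)) (\<lambda>x. f x + g x)
        \<le> 2 * osc (1 / real (Suc k)) f + 2 * osc (1 / real (Suc k)) g"
      by (intro always_eventually allI osc_add_le) auto
    show "(\<lambda>k. 2 * osc (1 / real (Suc k)) f + 2 * osc (1 / real (Suc k)) g) \<longlonglongrightarrow> 0"
      using assms unfolding vanishing_osc_def
      by (auto intro!: tendsto_eq_intros ennreal_tendsto_cmult)
  qed simp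
  then show ?thesis by (simp add: vanishing_osc_def)
qed

lemma vanishing_osc_cmult: "vanishing_osc f \<Longrightarrow> vanishing_osc (\<lambda>x. c * f x)"
  unfolding vanishing_osc_def
  by (auto simp: osc_cmult intro!: tendsto_eq_intros ennreal_tendsto_cmult)

lemma vanishing_osc_sum:
  "finite I \<Longrightarrow> (\<And>i. i \<in> I \<Longrightarrow> vanishing_osc (f i)) \<Longrightarrow> vanishing_osc (\<lambda>x. \<Sum>i\<in>I. f i x)"
  by (induction I rule: finite_induct) (auto intro: vanishing_osc_0 vanishing_osc_add)

lemma vanishing_osc_closed:
  fixes f :: "'a::euclidean_space \<Rightarrow> complex"
  assumes f[measurable]: "f \<in> borel_measurable borel"
    and approx: "\<And>e::real. e > 0 \<Longrightarrow> \<exists>g. vanishing_osc g \<and> sq_norm (\<lambda>x. f x - g x) \<le> ennreal e"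
  shows "vanishing_osc f"
  unfolding vanishing_osc_def
proof (intro conjI f tendsto_0_ennrealI)
  fix e :: real assume e: "e > 0"
  obtain g where g: "vanishing_osc g" "sq_norm (\<lambda>x. f x - g x) \<le> ennreal (e / 16)"
    using approx[of "e / 16"] e by auto
  have [measurable]: "g \<in> borel_measurable borel" and lim: "(\<lambda>k. osc (1 / real (Suc k)) g) \<longlonglongrightarrow> 0"
    using g by (auto simp: vanishing_osc_def)
  have "\<forall>\<^sub>F k in sequentially. osc (1 / real (Suc k)) g < ennreal (e / 4)"
    using e by (intro order_tendstoD(2)[OF lim]) simp
  then show "\<forall>\<^sub>F k in sequentially. osc (1 / real (Suc k)) f \<le> ennreal e"
  proof eventually_elim
    case (elim k)
    have "osc (1 / real (Suc k)) f
        \<le> 2 * osc (1 / real (Suc k)) g + 2 * osc (1 / real (Suc k)) (\<lambda>x. f x - g x)"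
      using osc_add_le[of g "\<lambda>x. f x - g x"] by simp
    also have "\<dots> \<le> 2 * ennreal (e / 4) + 2 * (4 * sq_norm (\<lambda>x. f x - g x))"
      using elim by (intro add_mono mult_left_mono osc_le_sq_norm) auto
    also have "\<dots> \<le> 2 * ennreal (e / 4) + 2 * (4 * ennreal (e / 16))"
      by (intro add_mono mult_left_mono g) auto
    also have "\<dots> = ennreal e"
      using e by (simp add: ennreal_mult[symmetric] ennreal_plus[symmetric] numeral_mult_ennreal del: ennreal_plus)
    finally show ?case .
  qed
qed

text \<open>Twice the probability that a Gaussian step leads from a point of \<open>U\<close> out of \<open>U\<close>, integrated over \<open>U\<close>. Every point
  of \<open>U\<close> has a ball around it inside \<open>U\<close>, so this probability tends to \<open>0\<close> pointwise, and it is at most \<open>1\<close>.\<close>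

lemma vanishing_osc_indicator_open:
  fixes U :: "'a::euclidean_space set"
  assumes U: "open U" and fin: "emeasure lborel U < \<infinity>"
  shows "vanishing_osc (indicator U)"
proof -
  have [measurable]: "U \<in> sets borel" using U by simp
  define q :: "real \<Rightarrow> 'a \<Rightarrow> ennreal" where
    "q \<sigma> x = (\<integral>\<^sup>+ y. indicator (- U) y * ennreal (heat \<sigma> (x - y)) \<partial>lborel)" for \<sigma> x
  have osc_eq: "osc \<sigma> (indicator U) = 2 * (\<integral>\<^sup>+ x. indicator U x * q \<sigma> x \<partial>lborel)" for \<sigma>
  proof -
    have swap: "(\<integral>\<^sup>+ x. \<integral>\<^sup>+ y. indicator U y * (indicator (- U) x * ennreal (heat \<sigma> (x - y))) \<partial>lborel \<partial>lborel)
        = (\<integral>\<^sup>+ x. indicator U x * q \<sigma> x \<partial>lborel)"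
    proof -
      have "(\<integral>\<^sup>+ x. \<integral>\<^sup>+ y. indicator U y * (indicator (- U) x * ennreal (heat \<sigma> (x - y))) \<partial>lborel \<partial>lborel)
          = (\<integral>\<^sup>+ y. \<integral>\<^sup>+ x. indicator U y * (indicator (- U) x * ennreal (heat \<sigma> (x - y))) \<partial>lborel \<partial>lborel)"
        by (rule lborel_pair.Fubini') measurable
      also have "\<dots> = (\<integral>\<^sup>+ y. \<integral>\<^sup>+ x. indicator U y * (indicator (- U) x * ennreal (heat \<sigma> (y - x))) \<partial>lborel \<partial>lborel)"
        by (subst heat_minus_commute) (rule refl)
      also have "\<dots> = (\<integral>\<^sup>+ y. indicator U y * q \<sigma> y \<partial>lborel)"
        unfolding q_def by (intro nn_integral_cong nn_integral_cmult) measurable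
      finally show ?thesis .
    qed
    have "osc \<sigma> (indicator U) = (\<integral>\<^sup>+ x. \<integral>\<^sup>+ y. indicator U x * (indicator (- U) y * ennreal (heat \<sigma> (x - y)))
        + indicator U y * (indicator (- U) x * ennreal (heat \<sigma> (x - y))) \<partial>lborel \<partial>lborel)"
      unfolding osc_def by (intro nn_integral_cong) (auto split: split_indicator)
    also have "\<dots> = (\<integral>\<^sup>+ x. indicator U x * q \<sigma> x \<partial>lborel) + (\<integral>\<^sup>+ x. indicator U x * q \<sigma> x \<partial>lborel)"
      by (subst swap[symmetric]) (simp add: nn_integral_add nn_integral_cmult q_def)
    finally show ?thesis by (simp add: mult_2)
  qed
  have q_meas[measurable]: "q \<sigma> \<in> borel_measurable borel" for \<sigma>
    unfolding q_def[abs_def] by measurable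
  have q_le: "q \<sigma> x \<le> 1" if "\<sigma> > 0" for \<sigma> x
  proof -
    have "q \<sigma> x \<le> (\<integral>\<^sup>+ y. ennreal (heat \<sigma> (x - y)) \<partial>lborel)"
      unfolding q_def by (intro nn_integral_mono) (auto split: split_indicator)
    then show ?thesis by (simp add: nn_integral_heat that)
  qed
  have q_lim: "(\<lambda>k. q (1 / real (Suc k)) x) \<longlonglongrightarrow> 0" if "x \<in> U" for x
  proof -
    obtain d where d: "d > 0" "ball x d \<subseteq> U" using openE[OF U \<open>x \<in> U\<close>] by blast
    define w where "w k = sqrt 2 ^ DIM('a) * exp (- d\<^sup>2 / (4 * (1 / real (Suc k))\<^sup>2))" for k
    have q_w: "q (1 / real (Suc k)) x \<le> ennreal (w k)" for k
    proof -
      have "q (1 / real (Suc k)) x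
          \<le> (\<integral>\<^sup>+ y. ennreal (w k) * ennreal (heat (sqrt 2 * (1 / real (Suc k))) (x - y)) \<partial>lborel)"
        unfolding q_def
      proof (intro nn_integral_mono)
        fix y :: 'a
        show "indicator (- U) y * ennreal (heat (1 / real (Suc k)) (x - y))
            \<le> ennreal (w k) * ennreal (heat (sqrt 2 * (1 / real (Suc k))) (x - y))"
        proof (cases "y \<in> U")
          case False
          then have "d \<le> norm (x - y)" using d by (force simp: dist_norm)
          then have "heat (1 / real (Suc k)) (x - y) \<le> w k * heat (sqrt 2 * (1 / real (Suc k))) (x - y)"
            unfolding w_def using d by (intro heat_tail) auto
          then show ?thesis using False by (simp add: w_def ennreal_mult[symmetric] ennreal_leI)
        qed simp
      qed
      also have "\<dots> = ennreal (w k)"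
        by (simp add: nn_integral_cmult nn_integral_heat)
      finally show ?thesis .
    qed
    have "w \<longlonglongrightarrow> sqrt 2 ^ DIM('a) * 0"
    proof (unfold w_def, rule tendsto_mult_left)
      have "filterlim (\<lambda>k. d\<^sup>2 / 4 * (real (Suc k))\<^sup>2) at_top sequentially"
        using d by (intro filterlim_tendsto_pos_mult_at_top[OF tendsto_const] filterlim_pow_at_top
          filterlim_compose[OF filterlim_real_sequentially filterlim_Suc]) auto
      then have "(\<lambda>k. exp (- (d\<^sup>2 / 4 * (real (Suc k))\<^sup>2))) \<longlonglongrightarrow> 0"
        by (intro filterlim_compose[OF exp_at_bot] filterlim_compose[OF filterlim_uminus_at_bot_at_top])
      then show "(\<lambda>k. exp (- d\<^sup>2 / (4 * (1 / real (Suc k))\<^sup>2))) \<longlonglongrightarrow> 0"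
        by (simp add: power_divide)
    qed
    then have "(\<lambda>k. ennreal (w k)) \<longlonglongrightarrow> 0"
      by (simp flip: ennreal_0)
    then show ?thesis
      by (rule tendsto_sandwich[OF _ _ tendsto_const, rotated 2])
        (simp, intro always_eventually allI q_w)
  qed
  have "(\<lambda>k. \<integral>\<^sup>+ x. indicator U x * q (1 / real (Suc k)) x \<partial>lborel) \<longlonglongrightarrow> (\<integral>\<^sup>+ x. 0 \<partial>(lborel :: 'a measure))"
  proof (rule nn_integral_dominated_convergence[where w = "indicator U"])
    show "AE x in lborel. indicator U x * q (1 / real (Suc k)) x \<le> indicator U x" for k
      using q_le[of "1 / real (Suc k)"] by (auto split: split_indicator)
    show "AE x in lborel. (\<lambda>k. indicator U x * q (1 / real (Suc k)) x) \<longlonglongrightarrow> 0"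
      using q_lim by (auto split: split_indicator)
  qed (use fin in auto)
  then have "(\<lambda>k. osc (1 / real (Suc k)) (indicator U)) \<longlonglongrightarrow> 2 * 0"
    unfolding osc_eq by (intro ennreal_tendsto_cmult) auto
  then show ?thesis by (simp add: vanishing_osc_def)
qed

lemma vanishing_osc_indicator:
  fixes A :: "'a::euclidean_space set"
  assumes A[measurable]: "A \<in> sets borel" and fin: "emeasure lborel A < \<infinity>"
  shows "vanishing_osc (indicator A)"
proof (rule vanishing_osc_closed)
  fix e :: real assume "e > 0"
  then obtain U where U: "open U" "A \<subseteq> U" "emeasure lborel (U - A) < ennreal e"
    using outer_regular_lborel[OF A] by metis
  have [measurable]: "U \<in> sets borel" using U by simp
  have "emeasure lborel U = emeasure lborel A + emeasure lborel (U - A)"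
    using U(2) by (subst plus_emeasure) (auto simp: Un_absorb1)
  also have "\<dots> < \<infinity>" using fin U(3) by (auto simp: less_top[symmetric])
  finally have "vanishing_osc (indicator U)" by (rule vanishing_osc_indicator_open[OF U(1)])
  moreover have "sq_norm (\<lambda>x. indicator A x - indicator U x) = emeasure lborel (U - A)"
  proof -
    have "sq_norm (\<lambda>x. indicator A x - indicator U x) = (\<integral>\<^sup>+ x. indicator (U - A) x \<partial>lborel)"
      unfolding sq_norm_def using U(2) by (intro nn_integral_cong) (auto split: split_indicator)
    then show ?thesis by simp
  qed
  ultimately show "\<exists>g. vanishing_osc g \<and> sq_norm (\<lambda>x. indicator A x - g x) \<le> ennreal e"
    using U(3) by (intro exI[of _ "indicator U"]) auto
qed simp

lemma vanishing_osc_simple: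
  fixes s :: "'a::euclidean_space \<Rightarrow> complex"
  assumes s: "simple_function lborel s" and L2: "s \<in> L2"
  shows "vanishing_osc s"
proof -
  have [measurable]: "s \<in> borel_measurable borel" using L2 by (rule L2_measurable)
  have fin: "finite (range s)" using simple_functionD(1)[OF s] by simp
  have "vanishing_osc (\<lambda>x. c * indicator (s -` {c}) x)" for c
  proof (cases "c = 0")
    case False
    have meas: "s -` {c} \<in> sets borel"
      using measurable_sets[of s borel borel "{c}"] by simp
    have "ennreal ((cmod c)\<^sup>2) * emeasure lborel (s -` {c})
        = (\<integral>\<^sup>+ x. ennreal ((cmod c)\<^sup>2) * indicator (s -` {c}) x \<partial>lborel)"
      using meas by (simp add: nn_integral_cmult)
    also have "\<dots> \<le> sq_norm s"
      unfolding sq_norm_def by (intro nn_integral_mono) (auto split: split_indicator)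
    also have "\<dots> < \<infinity>" using L2 by (simp add: L2_iff)
    finally have "emeasure lborel (s -` {c}) < \<infinity>"
      using False by (auto simp: ennreal_mult_less_top)
    then show ?thesis by (intro vanishing_osc_cmult vanishing_osc_indicator meas)
  qed (simp add: vanishing_osc_0)
  then have "vanishing_osc (\<lambda>x. \<Sum>c\<in>range s. c * indicator (s -` {c}) x)"
    using fin by (intro vanishing_osc_sum)
  also have "(\<lambda>x. \<Sum>c\<in>range s. c * indicator (s -` {c}) x) = s"
  proof
    fix x
    have "(\<Sum>c\<in>range s. c * indicator (s -` {c}) x) = (\<Sum>c\<in>range s. if c = s x then s x else 0)"
      by (intro sum.cong) (auto split: split_indicator)
    also have "\<dots> = s x" using fin by simp
    finally show "(\<Sum>c\<in>range s. c * indicator (s -` {c}) x) = s x" .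
  qed
  finally show ?thesis .
qed

lemma vanishing_osc_L2:
  fixes f :: "'a::euclidean_space \<Rightarrow> complex"
  assumes "f \<in> L2"
  shows "vanishing_osc f"
proof (rule vanishing_osc_closed)
  show f[measurable]: "f \<in> borel_measurable borel" using assms by (rule L2_measurable)
  fix e :: real assume e: "e > 0"
  have "f \<in> borel_measurable lborel" by simp
  then obtain s where s0: "\<forall>i. simple_function lborel (s i)" "\<forall>x\<in>space lborel. (\<lambda>i. s i x) \<longlonglongrightarrow> f x"
    "\<forall>i. \<forall>x\<in>space lborel. dist (s i x) 0 \<le> 2 * dist (f x) 0"
    using borel_measurable_implies_sequence_metric[of f lborel 0] by blast
  then have s: "\<And>i. simple_function lborel (s i)" "\<And>x. (\<lambda>i. s i x) \<longlonglongrightarrow> f x"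
    "\<And>i x. cmod (s i x) \<le> 2 * cmod (f x)"
    by (simp_all add: dist_norm)
  have [measurable]: "s i \<in> borel_measurable borel" for i
    using borel_measurable_simple_function[OF s(1)] by simp
  have "s i \<in> L2" for i
    using L2_bound[of "s i" "\<lambda>x. 2 * f x"] L2_cmult[OF assms, of 2] s(3) by (auto simp: norm_mult)
  then have v: "vanishing_osc (s i)" for i by (intro vanishing_osc_simple s)
  have "(\<lambda>i. \<integral>\<^sup>+ x. ennreal ((cmod (f x - s i x))\<^sup>2) \<partial>lborel) \<longlonglongrightarrow> (\<integral>\<^sup>+ x. 0 \<partial>(lborel :: 'a measure))"
  proof (rule nn_integral_dominated_convergence[where w = "\<lambda>x. ennreal 9 * ennreal ((cmod (f x))\<^sup>2)"])
    show "AE x in lborel. ennreal ((cmod (f x - s i x))\<^sup>2) \<le> ennreal 9 * ennreal ((cmod (f x))\<^sup>2)" for i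
    proof (intro AE_I2)
      fix x
      have "cmod (f x - s i x) \<le> 3 * cmod (f x)"
        using norm_triangle_ineq4[of "f x" "s i x"] s(3)[of i x] by linarith
      then have "(cmod (f x - s i x))\<^sup>2 \<le> (3 * cmod (f x))\<^sup>2" by (intro power_mono) auto
      then show "ennreal ((cmod (f x - s i x))\<^sup>2) \<le> ennreal 9 * ennreal ((cmod (f x))\<^sup>2)"
        by (subst ennreal_mult[symmetric]) (auto simp: power_mult_distrib intro!: ennreal_leI)
    qed
    show "(\<integral>\<^sup>+ x. ennreal 9 * ennreal ((cmod (f x))\<^sup>2) \<partial>lborel) < \<infinity>"
      using assms by (simp add: nn_integral_cmult L2_iff sq_norm_def ennreal_mult_less_top)
    show "AE x in lborel. (\<lambda>i. ennreal ((cmod (f x - s i x))\<^sup>2)) \<longlonglongrightarrow> 0"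
    proof (intro AE_I2)
      fix x
      have "(\<lambda>i. (cmod (f x - s i x))\<^sup>2) \<longlonglongrightarrow> (cmod (f x - f x))\<^sup>2"
        by (intro tendsto_intros s)
      then show "(\<lambda>i. ennreal ((cmod (f x - s i x))\<^sup>2)) \<longlonglongrightarrow> 0"
        by (simp flip: ennreal_0)
    qed
  qed auto
  then have "(\<lambda>i. sq_norm (\<lambda>x. f x - s i x)) \<longlonglongrightarrow> 0" by (simp add: sq_norm_def)
  then have "\<forall>\<^sub>F i in sequentially. sq_norm (\<lambda>x. f x - s i x) < ennreal e"
    using e by (intro order_tendstoD) auto
  then obtain i where "sq_norm (\<lambda>x. f x - s i x) < ennreal e"
    by (auto dest: eventually_happens)
  with v show "\<exists>g. vanishing_osc g \<and> sq_norm (\<lambda>x. f x - g x) \<le> ennreal e"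
    by (intro exI[of _ "s i"]) auto
qed

section \<open>Plancherel's identity for integrable functions\<close>

lemma integrable_mult_bounded:
  fixes f w :: "'a::euclidean_space \<Rightarrow> complex"
  assumes "integrable lborel f" "w \<in> borel_measurable borel" "\<And>x. cmod (w x) \<le> c"
  shows "integrable lborel (\<lambda>x. f x * w x)"
proof (rule Bochner_Integration.integrable_bound)
  show "integrable lborel (\<lambda>x. c *\<^sub>R f x)" using assms(1) by simp
  have "0 \<le> c" using order_trans[OF norm_ge_zero assms(3)] .
  then show "AE x in lborel. norm (f x * w x) \<le> norm (c *\<^sub>R f x)"
    using assms(3) by (auto simp: norm_mult mult.commute[of "cmod (f _)"] intro!: mult_right_mono)
qed (use assms borel_measurable_integrable[OF assms(1)] in auto)

lemma integrable_pair_dominated: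
  fixes F :: "'a::euclidean_space \<Rightarrow> 'a \<Rightarrow> complex" and u w :: "'a \<Rightarrow> real"
  assumes F: "case_prod F \<in> borel_measurable (lborel \<Otimes>\<^sub>M lborel)"
    and u: "integrable lborel u" and w: "integrable lborel w"
    and le: "\<And>x y. cmod (F x y) \<le> u x * w y"
  shows "integrable (lborel \<Otimes>\<^sub>M lborel) (case_prod F)"
proof (rule Bochner_Integration.integrable_bound[OF _ F])
  have [measurable]: "u \<in> borel_measurable borel" "w \<in> borel_measurable borel"
    using borel_measurable_integrable[OF u] borel_measurable_integrable[OF w] by auto
  have uw: "integrable lborel (\<lambda>x. \<bar>u x\<bar>)" "integrable lborel (\<lambda>y. \<bar>w y\<bar>)" using u w by auto
  show "integrable (lborel \<Otimes>\<^sub>M lborel) (\<lambda>(x, y). u x * w y)"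
    using u w uw by (intro lborel_pair.Fubini_integrable) (auto simp: abs_mult)
  show "AE z in lborel \<Otimes>\<^sub>M lborel. norm (case_prod F z) \<le> norm (case z of (x, y) \<Rightarrow> u x * w y)"
    using le by (intro AE_I2) (auto split: prod.split intro: order_trans[OF _ abs_ge_self])
qed

lemma fourier_measurable[measurable]:
  assumes [measurable]: "f \<in> borel_measurable borel"
  shows "fourier f \<in> borel_measurable borel"
  unfolding fourier_def[abs_def] by measurable

lemma integrable_cis_mult:
  assumes "integrable lborel f"
  shows "integrable lborel (\<lambda>x. cis (x \<bullet> \<xi>) * f x)"
  using integrable_mult_bounded[OF assms, of "\<lambda>x. cis (x \<bullet> \<xi>)" 1] by (simp add: mult.commute)

lemma fourier_bounded: "cmod (fourier f \<xi>) \<le> (LINT x|lborel. cmod (f x))"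
  unfolding fourier_def by (rule order_trans[OF integral_norm_bound]) (simp add: norm_mult)

lemma fourier_diff:
  assumes "integrable lborel f" "integrable lborel g"
  shows "fourier (\<lambda>x. f x - g x) \<xi> = fourier f \<xi> - fourier g \<xi>"
  using integrable_cis_mult[OF assms(1), of "- \<xi>"] integrable_cis_mult[OF assms(2), of "- \<xi>"]
  unfolding fourier_def by (simp add: right_diff_distrib)

lemma cnj_measurable[measurable]: "cnj \<in> borel_measurable borel"
  by (intro borel_measurable_continuous_onI continuous_intros)

lemma cnj_fourier: "cnj (fourier f \<xi>) = (LINT x|lborel. cis (x \<bullet> \<xi>) * cnj (f x))"
  unfolding fourier_def by (subst Bochner_Integration.integral_cnj[symmetric]) (simp add: cis_cnj)

definition heat_conv :: "real \<Rightarrow> ('a::euclidean_space \<Rightarrow> complex) \<Rightarrow> 'a \<Rightarrow> complex" where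
  "heat_conv \<sigma> f x = (LINT y|lborel. f y * complex_of_real (heat \<sigma> (x - y)))"

lemma integrable_heat:
  assumes "\<sigma> > 0"
  shows "integrable lborel (\<lambda>y. heat \<sigma> (x - y))" "(LINT y|lborel. heat \<sigma> (x - y)) = 1"
  using nn_integral_heat[OF assms, of x]
  by (auto simp: integrable_iff_bounded integral_eq_nn_integral)

lemma integrable_mult_heat:
  assumes "integrable lborel f"
  shows "integrable lborel (\<lambda>y. f y * complex_of_real (heat \<sigma> (x - y)))"
proof -
  obtain c where "\<And>x::'a. heat \<sigma> x \<le> c" by (rule heat_bounded[of \<sigma>]) blast
  then show ?thesis by (intro integrable_mult_bounded[OF assms, where c=c]) auto
qed

lemma heat_conv_measurable[measurable]:
  assumes [measurable]: "f \<in> borel_measurable borel"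
  shows "heat_conv \<sigma> f \<in> borel_measurable borel"
  unfolding heat_conv_def[abs_def] by measurable

lemma heat_conv_bounded:
  fixes f :: "'a::euclidean_space \<Rightarrow> complex"
  assumes f: "integrable lborel f"
  obtains M where "\<And>x. cmod (heat_conv \<sigma> f x) \<le> M"
proof -
  obtain c where c: "\<And>x::'a. heat \<sigma> x \<le> c" by (rule heat_bounded[of \<sigma>]) blast
  have "cmod (heat_conv \<sigma> f x) \<le> (LINT y|lborel. cmod (f y) * c)" for x
  proof -
  have "cmod (heat_conv \<sigma> f x) \<le> (LINT y|lborel. cmod (f y * complex_of_real (heat \<sigma> (x - y))))"
    unfolding heat_conv_def by (rule integral_norm_bound)
  also have "\<dots> \<le> (LINT y|lborel. cmod (f y) * c)"
  proof (rule integral_mono)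
    show "integrable lborel (\<lambda>y. cmod (f y * complex_of_real (heat \<sigma> (x - y))))"
      by (rule integrable_norm[OF integrable_mult_heat[OF f]])
  qed (use f c in \<open>auto simp: norm_mult intro!: mult_left_mono\<close>)
  finally show ?thesis .
  qed
  then show thesis by (rule that)
qed

text \<open>The difference at \<open>x\<close> is the mean of \<open>f y - f x\<close> with respect to a probability density, and the square of a mean is
  at most the mean of the squares.\<close>

lemma sq_norm_heat_conv_diff:
  assumes f: "integrable lborel f" and s: "\<sigma> > 0"
  shows "sq_norm (\<lambda>x. heat_conv \<sigma> f x - f x) \<le> osc \<sigma> f"
  unfolding sq_norm_def osc_def
proof (intro nn_integral_mono)
  fix x
  have [measurable]: "f \<in> borel_measurable borel" using borel_measurable_integrable[OF f] by simp
  define d where "d y = (f y - f x) * complex_of_real (heat \<sigma> (x - y))" for y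
  have hx: "integrable lborel (\<lambda>y. f x * complex_of_real (heat \<sigma> (x - y)))"
    using integrable_heat(1)[OF s, of x] by simp
  have d: "integrable lborel d" "(LINT y|lborel. d y) = heat_conv \<sigma> f x - f x"
    using integrable_mult_heat[OF f, of \<sigma> x] hx integrable_heat(2)[OF s, of x]
    unfolding d_def heat_conv_def left_diff_distrib by auto
  have "ennreal (cmod (heat_conv \<sigma> f x - f x)) \<le> (\<integral>\<^sup>+ y. ennreal (cmod (d y)) \<partial>lborel)"
    using integral_norm_bound_ennreal[OF d(1)] unfolding d(2) .
  also have "\<dots> = (\<integral>\<^sup>+ y. ennreal (cmod (f x - f y) * sqrt (heat \<sigma> (x - y))) * ennreal (sqrt (heat \<sigma> (x - y))) \<partial>lborel)"
    unfolding d_def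
    by (intro nn_integral_cong) (simp add: norm_mult norm_minus_commute mult.assoc flip: ennreal_mult)
  finally have "(ennreal (cmod (heat_conv \<sigma> f x - f x)))\<^sup>2 \<le> \<dots>\<^sup>2" by (rule power_mono) simp
  also have "\<dots> \<le> (\<integral>\<^sup>+ y. (ennreal (cmod (f x - f y) * sqrt (heat \<sigma> (x - y))))\<^sup>2 \<partial>lborel)
      * (\<integral>\<^sup>+ y. (ennreal (sqrt (heat \<sigma> (x - y))))\<^sup>2 \<partial>lborel)"
    by (rule Cauchy_Schwarz_nn_integral) measurable
  also have "\<dots> = (\<integral>\<^sup>+ y. ennreal ((cmod (f x - f y))\<^sup>2) * ennreal (heat \<sigma> (x - y)) \<partial>lborel)"
    by (simp add: ennreal_power power_mult_distrib ennreal_mult nn_integral_heat[OF s])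
  finally show "ennreal ((cmod (heat_conv \<sigma> f x - f x))\<^sup>2)
      \<le> (\<integral>\<^sup>+ y. ennreal ((cmod (f x - f y))\<^sup>2) * ennreal (heat \<sigma> (x - y)) \<partial>lborel)"
    by (simp add: ennreal_power)
qed

lemma heat_conv_tendsto:
  assumes f: "integrable lborel f" "f \<in> L2"
  shows "L2_tendsto (\<lambda>k. heat_conv (1 / real (Suc k)) f) f"
  unfolding L2_tendsto_iff
proof (rule tendsto_sandwich[OF _ _ tendsto_const])
  show "(\<lambda>k. osc (1 / real (Suc k)) f) \<longlonglongrightarrow> 0"
    using vanishing_osc_L2[OF f(2)] by (simp add: vanishing_osc_def)
  show "\<forall>\<^sub>F k in sequentially. sq_norm (\<lambda>x. heat_conv (1 / real (Suc k)) f x - f x) \<le> osc (1 / real (Suc k)) f"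
    by (intro always_eventually allI sq_norm_heat_conv_diff f) auto
qed simp

lemma gauss_nonneg[simp]: "gauss \<sigma> \<xi> \<ge> 0"
  by (simp add: gauss_def)

lemma gauss_integrable:
  assumes "\<sigma> > 0"
  shows "integrable lborel (gauss \<sigma> :: 'a::euclidean_space \<Rightarrow> real)"
  using integrable_norm[OF integrable_cis_gauss[OF assms, of "0::'a"]] by (simp add: norm_mult)

text \<open>The inversion formula with a Gaussian cutoff. The same identity serves twice: inserted into \<open>\<integral> |fourier f|\<^sup>2\<close> it gives
  Plancherel's identity, and read backwards it inverts the transform.\<close>

lemma fourier_gauss:
  fixes f :: "'a::euclidean_space \<Rightarrow> complex"
  assumes f: "integrable lborel f" and s: "\<sigma> > 0"
  shows "(LINT \<xi>|lborel. fourier f \<xi> * (cis (y \<bullet> \<xi>) * complex_of_real (gauss \<sigma> \<xi>)))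
    = complex_of_real ((2 * pi) ^ DIM('a)) * heat_conv \<sigma> f y"
proof -
  have [measurable]: "f \<in> borel_measurable borel" using borel_measurable_integrable[OF f] by simp
  define F where "F \<xi> x = f x * (cis ((y - x) \<bullet> \<xi>) * complex_of_real (gauss \<sigma> \<xi>))" for \<xi> x
  have "(LINT \<xi>|lborel. fourier f \<xi> * (cis (y \<bullet> \<xi>) * complex_of_real (gauss \<sigma> \<xi>)))
      = (LINT \<xi>|lborel. LINT x|lborel. F \<xi> x)"
  proof -
    have "cis ((y - x) \<bullet> \<xi>) = cis (- (x \<bullet> \<xi>)) * cis (y \<bullet> \<xi>)" for x \<xi> :: 'a
      by (simp add: cis_mult inner_diff_left)
    then show ?thesis
      unfolding fourier_def F_def by (subst integral_mult_left_zero[symmetric]) (simp add: mult_ac)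
  qed
  also have "\<dots> = (LINT x|lborel. LINT \<xi>|lborel. F \<xi> x)"
  proof (rule lborel_pair.Fubini_integral)
    show "integrable (lborel \<Otimes>\<^sub>M lborel) (case_prod (\<lambda>x \<xi>. F \<xi> x))"
      using f gauss_integrable[OF s, where 'a='a]
      by (intro integrable_pair_dominated[where u="\<lambda>x. cmod (f x)" and w="gauss \<sigma>"])
        (auto simp: F_def norm_mult)
  qed
  also have "\<dots> = (LINT x|lborel. f x * complex_of_real ((2 * pi) ^ DIM('a) * heat \<sigma> (y - x)))"
    unfolding F_def by (simp only: integral_mult_right_zero integral_cis_gauss[OF s])
  also have "\<dots> = complex_of_real ((2 * pi) ^ DIM('a)) * heat_conv \<sigma> f y"
    unfolding heat_conv_def by (subst integral_mult_right_zero[symmetric]) (simp add: mult_ac)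
  finally show ?thesis .
qed

lemma fourier_energy_gauss:
  fixes f :: "'a::euclidean_space \<Rightarrow> complex"
  assumes f: "integrable lborel f" and s: "\<sigma> > 0"
  shows "complex_of_real (LINT \<xi>|lborel. (cmod (fourier f \<xi>))\<^sup>2 * gauss \<sigma> \<xi>)
    = complex_of_real ((2 * pi) ^ DIM('a)) * (LINT y|lborel. cnj (f y) * heat_conv \<sigma> f y)"
proof -
  have [measurable]: "f \<in> borel_measurable borel" using borel_measurable_integrable[OF f] by simp
  define M where "M = (LINT x|lborel. cmod (f x))"
  define F where "F \<xi> y = cnj (f y) * (fourier f \<xi> * (cis (y \<bullet> \<xi>) * complex_of_real (gauss \<sigma> \<xi>)))" for \<xi> y
  have "complex_of_real (LINT \<xi>|lborel. (cmod (fourier f \<xi>))\<^sup>2 * gauss \<sigma> \<xi>)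
      = (LINT \<xi>|lborel. (fourier f \<xi> * complex_of_real (gauss \<sigma> \<xi>)) * cnj (fourier f \<xi>))"
    by (subst integral_complex_of_real[symmetric]) (simp add: complex_norm_square mult_ac del: of_real_power)
  also have "\<dots> = (LINT \<xi>|lborel. LINT y|lborel. F \<xi> y)"
    unfolding cnj_fourier F_def
    by (subst integral_mult_right_zero[symmetric]) (simp add: mult_ac)
  also have "\<dots> = (LINT y|lborel. LINT \<xi>|lborel. F \<xi> y)"
  proof (rule lborel_pair.Fubini_integral)
    show "integrable (lborel \<Otimes>\<^sub>M lborel) (case_prod (\<lambda>y \<xi>. F \<xi> y))"
    proof (rule integrable_pair_dominated[where u="\<lambda>y. cmod (f y)" and w="\<lambda>\<xi>. M * gauss \<sigma> \<xi>"])
      fix y \<xi>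
      show "cmod (F \<xi> y) \<le> cmod (f y) * (M * gauss \<sigma> \<xi>)"
        using fourier_bounded[of f \<xi>]
        by (auto simp: F_def norm_mult M_def intro!: mult_left_mono mult_right_mono)
    qed (use f gauss_integrable[OF s] in \<open>auto simp: F_def\<close>)
  qed
  also have "\<dots> = (LINT y|lborel. cnj (f y) * (complex_of_real ((2 * pi) ^ DIM('a)) * heat_conv \<sigma> f y))"
    unfolding F_def by (simp only: integral_mult_right_zero fourier_gauss[OF f s])
  also have "\<dots> = complex_of_real ((2 * pi) ^ DIM('a)) * (LINT y|lborel. cnj (f y) * heat_conv \<sigma> f y)"
    by (subst integral_mult_right_zero[symmetric]) (simp add: mult_ac)
  finally show ?thesis .
qed

text \<open>With the Gaussian factor, \<open>\<integral> |fourier f|\<^sup>2\<close> equals \<open>(2\<pi>)\<^sup>n\<close> times the inner product of \<open>f\<close> with its regularization. As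
  \<open>\<sigma>\<close> decreases to \<open>0\<close>, the integral increases to its value without the factor, and the inner product
  tends to the squared norm of \<open>f\<close>.\<close>

theorem plancherel:
  fixes f :: "'a::euclidean_space \<Rightarrow> complex"
  assumes f: "integrable lborel f" "f \<in> L2"
  shows "sq_norm (fourier f) = ennreal ((2 * pi) ^ DIM('a)) * sq_norm f"
proof -
  have fm[measurable]: "f \<in> borel_measurable borel" using borel_measurable_integrable[OF f(1)] by simp
  define \<sigma> where "\<sigma> k = 1 / real (Suc k)" for k
  have s: "\<sigma> k > 0" for k by (simp add: \<sigma>_def)
  define a where "a k = (LINT \<xi>|lborel. (cmod (fourier f \<xi>))\<^sup>2 * gauss (\<sigma> k) \<xi>)" for k
  define d where "d k = (LINT y|lborel. cnj (f y) * (heat_conv (\<sigma> k) f y - f y))" for k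
  have f2: "integrable lborel (\<lambda>y. (cmod (f y))\<^sup>2)" using f(2) by (simp add: L2_def)
  have cf: "integrable lborel (\<lambda>y. cnj (f y))" using f(1) by simp
  have int_conv: "integrable lborel (\<lambda>y. cnj (f y) * heat_conv (\<sigma> k) f y)" for k
  proof -
    obtain M where "\<And>x. cmod (heat_conv (\<sigma> k) f x) \<le> M" using heat_conv_bounded[OF f(1)] by blast
    then show ?thesis by (intro integrable_mult_bounded[OF cf]) auto
  qed
  have int_sq: "integrable lborel (\<lambda>y. cnj (f y) * f y)"
    using f2 by (subst mult.commute, subst complex_norm_square[symmetric]) (simp flip: of_real_power)
  have int_d: "integrable lborel (\<lambda>y. cnj (f y) * (heat_conv (\<sigma> k) f y - f y))" for k
    using int_conv int_sq by (simp add: right_diff_distrib)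
  have sq: "(LINT y|lborel. cnj (f y) * f y) = complex_of_real ((L2_norm f)\<^sup>2)"
  proof -
    have "(LINT y|lborel. cnj (f y) * f y) = (LINT y|lborel. complex_of_real ((cmod (f y))\<^sup>2))"
      by (intro Bochner_Integration.integral_cong) (simp_all add: complex_norm_square mult.commute del: of_real_power)
    then show ?thesis by (simp add: L2_norm_def del: of_real_power)
  qed
  have a_eq: "complex_of_real (a k) = complex_of_real ((2 * pi) ^ DIM('a)) * (complex_of_real ((L2_norm f)\<^sup>2) + d k)" for k
    unfolding a_def fourier_energy_gauss[OF f(1) s] d_def sq[symmetric]
    using int_conv int_sq by (simp add: right_diff_distrib)
  have "(\<lambda>k. ennreal ((cmod (d k))\<^sup>2)) \<longlonglongrightarrow> 0"
  proof (rule tendsto_sandwich[OF _ _ tendsto_const])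
    have "ennreal ((cmod (d k))\<^sup>2) \<le> sq_norm f * sq_norm (\<lambda>x. heat_conv (\<sigma> k) f x - f x)" for k
    proof -
      have "ennreal (cmod (d k)) \<le> (\<integral>\<^sup>+ y. ennreal (cmod (cnj (f y) * (heat_conv (\<sigma> k) f y - f y))) \<partial>lborel)"
        unfolding d_def by (rule integral_norm_bound_ennreal[OF int_d])
      also have "\<dots> = (\<integral>\<^sup>+ y. ennreal (cmod (f y)) * ennreal (cmod (heat_conv (\<sigma> k) f y - f y)) \<partial>lborel)"
        by (simp add: norm_mult ennreal_mult)
      finally have "(ennreal (cmod (d k)))\<^sup>2 \<le> \<dots>\<^sup>2" by (rule power_mono) simp
      also have "\<dots> \<le> (\<integral>\<^sup>+ y. (ennreal (cmod (f y)))\<^sup>2 \<partial>lborel)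
          * (\<integral>\<^sup>+ y. (ennreal (cmod (heat_conv (\<sigma> k) f y - f y)))\<^sup>2 \<partial>lborel)"
        by (rule Cauchy_Schwarz_nn_integral) measurable
      finally show ?thesis by (simp add: sq_norm_def ennreal_power)
    qed
    then show "\<forall>\<^sub>F k in sequentially. ennreal ((cmod (d k))\<^sup>2) \<le> sq_norm f * sq_norm (\<lambda>x. heat_conv (\<sigma> k) f x - f x)"
      by simp
    have "(\<lambda>k. sq_norm f * sq_norm (\<lambda>x. heat_conv (\<sigma> k) f x - f x)) \<longlonglongrightarrow> sq_norm f * 0"
      using heat_conv_tendsto[OF f] f(2) unfolding L2_tendsto_iff \<sigma>_def[symmetric]
      by (intro ennreal_tendsto_cmult) (auto simp: L2_iff)
    then show "(\<lambda>k. sq_norm f * sq_norm (\<lambda>x. heat_conv (\<sigma> k) f x - f x)) \<longlonglongrightarrow> 0" by simp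
  qed simp
  then have "(\<lambda>k. (cmod (d k))\<^sup>2) \<longlonglongrightarrow> 0"
    by (subst (asm) ennreal_0[symmetric], subst (asm) tendsto_ennreal_iff) auto
  then have "(\<lambda>k. sqrt ((cmod (d k))\<^sup>2)) \<longlonglongrightarrow> sqrt 0" by (rule tendsto_real_sqrt)
  then have d: "d \<longlonglongrightarrow> 0" by (simp add: tendsto_norm_zero_iff)
  have "(\<lambda>k. complex_of_real (a k)) \<longlonglongrightarrow> complex_of_real ((2 * pi) ^ DIM('a)) * (complex_of_real ((L2_norm f)\<^sup>2) + 0)"
    unfolding a_eq by (intro tendsto_intros d)
  then have "a \<longlonglongrightarrow> (2 * pi) ^ DIM('a) * (L2_norm f)\<^sup>2"
    by (simp only: add_0_right of_real_mult[symmetric] tendsto_of_real_iff)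
  then have "(\<lambda>k. ennreal (a k)) \<longlonglongrightarrow> ennreal ((2 * pi) ^ DIM('a) * (L2_norm f)\<^sup>2)"
    by (rule tendsto_ennrealI)
  also have "ennreal ((2 * pi) ^ DIM('a) * (L2_norm f)\<^sup>2) = ennreal ((2 * pi) ^ DIM('a)) * sq_norm f"
    by (simp add: sq_norm_eq_L2_norm[OF f(2)] ennreal_mult)
  finally have lim1: "(\<lambda>k. ennreal (a k)) \<longlonglongrightarrow> ennreal ((2 * pi) ^ DIM('a)) * sq_norm f" .
  have a_nn: "ennreal (a k) = (\<integral>\<^sup>+ \<xi>. ennreal ((cmod (fourier f \<xi>))\<^sup>2 * gauss (\<sigma> k) \<xi>) \<partial>lborel)" for k
  proof -
    define M where "M = (LINT x|lborel. cmod (f x))"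
    have "integrable lborel (\<lambda>\<xi>. (cmod (fourier f \<xi>))\<^sup>2 * gauss (\<sigma> k) \<xi>)"
    proof (rule Bochner_Integration.integrable_bound)
      show "integrable lborel (\<lambda>\<xi>. M\<^sup>2 * gauss (\<sigma> k) (\<xi>::'a))"
        using gauss_integrable[OF s, where 'a='a] by simp
      show "AE \<xi> in lborel. norm ((cmod (fourier f \<xi>))\<^sup>2 * gauss (\<sigma> k) \<xi>) \<le> norm (M\<^sup>2 * gauss (\<sigma> k) \<xi>)"
        using fourier_bounded[of f] by (auto simp: M_def abs_mult intro!: mult_right_mono power_mono)
    qed measurable
    then show ?thesis unfolding a_def by (subst nn_integral_eq_integral) auto
  qed
  have "(\<lambda>k. ennreal (a k)) \<longlonglongrightarrow> sq_norm (fourier f)"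
    unfolding a_nn sq_norm_def
  proof (rule nn_integral_LIMSEQ)
    show "incseq (\<lambda>k \<xi>. ennreal ((cmod (fourier f \<xi>))\<^sup>2 * gauss (\<sigma> k) \<xi>))"
    proof (intro monoI le_funI ennreal_leI mult_left_mono)
      fix i j :: nat and \<xi> :: 'a assume "i \<le> j"
      then have "\<sigma> j \<le> \<sigma> i" by (auto simp: \<sigma>_def intro!: divide_left_mono)
      then have "(\<sigma> j)\<^sup>2 \<le> (\<sigma> i)\<^sup>2" using s[of j] by (intro power_mono) auto
      then show "gauss (\<sigma> i) \<xi> \<le> gauss (\<sigma> j) \<xi>" by (simp add: gauss_def mult_right_mono)
    qed simp
    fix \<xi> :: 'a
    have "\<sigma> \<longlonglongrightarrow> 0"
      unfolding \<sigma>_def using LIMSEQ_inverse_real_of_nat by (simp add: inverse_eq_divide)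
    then have "(\<lambda>k. (cmod (fourier f \<xi>))\<^sup>2 * gauss (\<sigma> k) \<xi>) \<longlonglongrightarrow> (cmod (fourier f \<xi>))\<^sup>2 * gauss 0 \<xi>"
      unfolding gauss_def by (intro tendsto_intros) auto
    then show "(\<lambda>k. ennreal ((cmod (fourier f \<xi>))\<^sup>2 * gauss (\<sigma> k) \<xi>)) \<longlonglongrightarrow> ennreal ((cmod (fourier f \<xi>))\<^sup>2)"
      by (intro tendsto_ennrealI) (simp add: gauss_def)
  qed measurable
  then show ?thesis using lim1 by (rule LIMSEQ_unique)
qed

section \<open>The Fourier--Plancherel transform\<close>

lemma fourier_in_L2: "integrable lborel f \<Longrightarrow> f \<in> L2 \<Longrightarrow> fourier f \<in> L2"
  using plancherel[of f] by (auto simp: L2_iff ennreal_mult_less_top)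

theorem fourier_L2_plancherel:
  fixes f F :: "'a::euclidean_space \<Rightarrow> complex"
  assumes "fourier_L2 f F"
  shows "L2_norm F = sqrt ((2 * pi) ^ DIM('a)) * L2_norm f"
proof -
  obtain \<phi> where \<phi>: "\<And>k. \<phi> k \<in> L2" "\<And>k. integrable lborel (\<phi> k)"
    "L2_tendsto \<phi> f" "L2_tendsto (\<lambda>k. fourier (\<phi> k)) F" and fF: "f \<in> L2" "F \<in> L2"
    using assms unfolding fourier_L2_def by blast
  have "L2_norm (fourier (\<phi> k)) = sqrt ((2 * pi) ^ DIM('a)) * L2_norm (\<phi> k)" for k
    using L2_measurable[OF \<phi>(1)[of k]]
    by (simp only: L2_norm_eq_sq_norm fourier_measurable plancherel[OF \<phi>(2,1)] enn2real_mult real_sqrt_mult) simp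
  moreover have "(\<lambda>k. sqrt ((2 * pi) ^ DIM('a)) * L2_norm (\<phi> k)) \<longlonglongrightarrow> sqrt ((2 * pi) ^ DIM('a)) * L2_norm f"
    by (intro tendsto_intros L2_norm_tendsto \<phi> fF)
  moreover have "(\<lambda>k. L2_norm (fourier (\<phi> k))) \<longlonglongrightarrow> L2_norm F"
    by (intro L2_norm_tendsto fourier_in_L2 \<phi> fF)
  ultimately show ?thesis by (auto intro: LIMSEQ_unique)
qed

lemma fourier_L2_diff:
  assumes "fourier_L2 f F" "fourier_L2 g G"
  shows "fourier_L2 (\<lambda>x. f x - g x) (\<lambda>\<xi>. F \<xi> - G \<xi>)"
proof -
  obtain \<phi> where \<phi>: "\<And>k. \<phi> k \<in> L2" "\<And>k. integrable lborel (\<phi> k)"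
    "L2_tendsto \<phi> f" "L2_tendsto (\<lambda>k. fourier (\<phi> k)) F" and fF: "f \<in> L2" "F \<in> L2"
    using assms(1) unfolding fourier_L2_def by blast
  obtain \<psi> where \<psi>: "\<And>k. \<psi> k \<in> L2" "\<And>k. integrable lborel (\<psi> k)"
    "L2_tendsto \<psi> g" "L2_tendsto (\<lambda>k. fourier (\<psi> k)) G" and gG: "g \<in> L2" "G \<in> L2"
    using assms(2) unfolding fourier_L2_def by blast
  have m[measurable]: "\<phi> k \<in> borel_measurable borel" "\<psi> k \<in> borel_measurable borel"
    "f \<in> borel_measurable borel" "F \<in> borel_measurable borel"
    "g \<in> borel_measurable borel" "G \<in> borel_measurable borel" for k
    using \<phi>(1) \<psi>(1) fF gG by (auto intro: L2_measurable)
  have "fourier (\<lambda>x. \<phi> k x - \<psi> k x) = (\<lambda>\<xi>. fourier (\<phi> k) \<xi> - fourier (\<psi> k) \<xi>)" for k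
    using \<phi>(2) \<psi>(2) by (intro ext fourier_diff)
  moreover have "L2_tendsto (\<lambda>k \<xi>. fourier (\<phi> k) \<xi> - fourier (\<psi> k) \<xi>) (\<lambda>\<xi>. F \<xi> - G \<xi>)"
    using \<phi>(4) \<psi>(4) by (intro L2_tendsto_diff) auto
  moreover have "L2_tendsto (\<lambda>k x. \<phi> k x - \<psi> k x) (\<lambda>x. f x - g x)"
    using \<phi>(3) \<psi>(3) by (intro L2_tendsto_diff) auto
  ultimately show ?thesis
    unfolding fourier_L2_def using \<phi>(1,2) \<psi>(1,2) fF gG
    by (intro conjI L2_diff exI[of _ "\<lambda>k x. \<phi> k x - \<psi> k x"]) (auto intro: L2_diff)
qed

lemma sq_norm_eq_0_iff:
  assumes [measurable]: "f \<in> borel_measurable borel"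
  shows "sq_norm f = 0 \<longleftrightarrow> (AE x in lborel. f x = 0)"
  unfolding sq_norm_def by (subst nn_integral_0_iff_AE) auto

lemma fourier_L2_unique:
  fixes f F G :: "'a::euclidean_space \<Rightarrow> complex"
  assumes "fourier_L2 f F" "fourier_L2 f G"
  shows "AE \<xi> in lborel. F \<xi> = G \<xi>"
proof -
  have L2: "(\<lambda>\<xi>. F \<xi> - G \<xi>) \<in> L2" using assms by (auto simp: fourier_L2_def intro: L2_diff)
  have "L2_norm (\<lambda>\<xi>. F \<xi> - G \<xi>) = sqrt ((2 * pi) ^ DIM('a)) * L2_norm (\<lambda>x::'a. 0)"
    using fourier_L2_plancherel[OF fourier_L2_diff[OF assms]] by simp
  then have "sq_norm (\<lambda>\<xi>. F \<xi> - G \<xi>) = 0"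
    unfolding sq_norm_eq_L2_norm[OF L2] by (simp add: L2_norm_def)
  then show ?thesis using L2_measurable[OF L2] by (simp add: sq_norm_eq_0_iff)
qed

lemma fourier_L2_cong_AE:
  assumes "fourier_L2 f F" "G \<in> L2" "AE \<xi> in lborel. F \<xi> = G \<xi>"
  shows "fourier_L2 f G"
proof -
  have "L2_tendsto \<phi> F \<longleftrightarrow> L2_tendsto \<phi> G" for \<phi>
  proof -
    have "sq_norm (\<lambda>x. \<phi> k x - F x) = sq_norm (\<lambda>x. \<phi> k x - G x)" for k
      by (rule sq_norm_cong_AE) (use assms(3) in auto)
    then show ?thesis by (simp add: L2_tendsto_iff)
  qed
  with assms(1,2) show ?thesis by (simp add: fourier_L2_def)
qed

text \<open>The transform relation is defined as the closure of a graph; a diagonal choice of approximants shows that it is closed.\<close>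

lemma fourier_L2_closed:
  assumes fF: "\<And>k. fourier_L2 (f k) (F k)" and g: "g \<in> L2" "G \<in> L2"
    and lim: "L2_tendsto f g" "L2_tendsto F G"
  shows "fourier_L2 g G"
proof -
  have "\<exists>\<phi>. \<phi> \<in> L2 \<and> integrable lborel \<phi> \<and> sq_norm (\<lambda>x. \<phi> x - f k x) \<le> ennreal (1 / real (Suc k))
      \<and> sq_norm (\<lambda>\<xi>. fourier \<phi> \<xi> - F k \<xi>) \<le> ennreal (1 / real (Suc k))" for k
  proof -
    obtain \<phi> where \<phi>: "\<And>j. \<phi> j \<in> L2" "\<And>j. integrable lborel (\<phi> j)"
      "L2_tendsto \<phi> (f k)" "L2_tendsto (\<lambda>j. fourier (\<phi> j)) (F k)"
      using fF[of k] unfolding fourier_L2_def by blast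
    have e: "0 < ennreal (1 / real (Suc k))" by simp
    have "\<forall>\<^sub>F j in sequentially. sq_norm (\<lambda>x. \<phi> j x - f k x) < ennreal (1 / real (Suc k))
        \<and> sq_norm (\<lambda>\<xi>. fourier (\<phi> j) \<xi> - F k \<xi>) < ennreal (1 / real (Suc k))"
      using \<phi>(3,4) e unfolding L2_tendsto_iff by (intro eventually_conj order_tendstoD(2)) auto
    then obtain j where "sq_norm (\<lambda>x. \<phi> j x - f k x) < ennreal (1 / real (Suc k))
        \<and> sq_norm (\<lambda>\<xi>. fourier (\<phi> j) \<xi> - F k \<xi>) < ennreal (1 / real (Suc k))"
      by (auto dest: eventually_happens)
    with \<phi>(1,2) show ?thesis by (intro exI[of _ "\<phi> j"]) auto
  qed
  then obtain \<phi> where \<phi>: "\<And>k. \<phi> k \<in> L2" "\<And>k. integrable lborel (\<phi> k)"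
    "\<And>k. sq_norm (\<lambda>x. \<phi> k x - f k x) \<le> ennreal (1 / real (Suc k))"
    "\<And>k. sq_norm (\<lambda>\<xi>. fourier (\<phi> k) \<xi> - F k \<xi>) \<le> ennreal (1 / real (Suc k))"
    by metis
  have m[measurable]: "\<phi> k \<in> borel_measurable borel" "f k \<in> borel_measurable borel" "F k \<in> borel_measurable borel"
    "g \<in> borel_measurable borel" "G \<in> borel_measurable borel" for k
    using \<phi>(1) fF g by (auto simp: fourier_L2_def intro: L2_measurable)
  have small: "(\<lambda>k. ennreal (1 / real (Suc k))) \<longlonglongrightarrow> 0"
    using tendsto_ennrealI[OF LIMSEQ_inverse_real_of_nat] by (simp add: inverse_eq_divide)
  have near: "L2_tendsto \<psi> h" if \<psi>: "\<And>k. \<psi> k \<in> borel_measurable borel" "\<And>k. a k \<in> borel_measurable borel"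
    "h \<in> borel_measurable borel" and a: "L2_tendsto a h"
    "\<And>k. sq_norm (\<lambda>x. \<psi> k x - a k x) \<le> ennreal (1 / real (Suc k))" for \<psi> a h
    unfolding L2_tendsto_iff
  proof (rule tendsto_sandwich[OF _ _ tendsto_const])
    show "\<forall>\<^sub>F k in sequentially. sq_norm (\<lambda>x. \<psi> k x - h x)
        \<le> 2 * ennreal (1 / real (Suc k)) + 2 * sq_norm (\<lambda>x. a k x - h x)"
    proof (intro always_eventually allI)
      fix k
      have "sq_norm (\<lambda>x. \<psi> k x - h x) \<le> 2 * sq_norm (\<lambda>x. \<psi> k x - a k x) + 2 * sq_norm (\<lambda>x. a k x - h x)"
        using sq_norm_add_le_2[of "\<lambda>x. \<psi> k x - a k x" "\<lambda>x. a k x - h x"] \<psi> by simp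
      also have "\<dots> \<le> 2 * ennreal (1 / real (Suc k)) + 2 * sq_norm (\<lambda>x. a k x - h x)"
        by (intro add_mono mult_left_mono a(2)) auto
      finally show "sq_norm (\<lambda>x. \<psi> k x - h x)
        \<le> 2 * ennreal (1 / real (Suc k)) + 2 * sq_norm (\<lambda>x. a k x - h x)" .
    qed
    have "(\<lambda>k. 2 * ennreal (1 / real (Suc k)) + 2 * sq_norm (\<lambda>x. a k x - h x)) \<longlonglongrightarrow> 2 * 0 + 2 * 0"
      using small a(1) unfolding L2_tendsto_iff by (intro tendsto_add ennreal_tendsto_cmult) auto
    then show "(\<lambda>k. 2 * ennreal (1 / real (Suc k)) + 2 * sq_norm (\<lambda>x. a k x - h x)) \<longlonglongrightarrow> 0" by simp
  qed simp
  have "L2_tendsto \<phi> g" by (rule near[OF _ _ _ lim(1) \<phi>(3)]) auto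
  moreover have "L2_tendsto (\<lambda>k. fourier (\<phi> k)) G" by (rule near[OF _ _ _ lim(2) \<phi>(4)]) auto
  ultimately show ?thesis unfolding fourier_L2_def using g \<phi>(1,2) by blast
qed

text \<open>The candidate is the inverse integral transform \<open>w\<close> of \<open>G\<close>, square integrable by Plancherel's identity but perhaps
  not integrable. Its products with Gaussians are integrable, and by \<open>fourier_gauss\<close> their transforms are the
  Gaussian regularizations of \<open>G\<close>; both sequences converge in mean square, to \<open>w\<close> and \<open>G\<close>.\<close>

lemma fourier_L2_inversion:
  fixes G :: "'a::euclidean_space \<Rightarrow> complex"
  assumes G: "integrable lborel G" "G \<in> L2"
  shows "\<exists>w. fourier_L2 w G"
proof -
  have [measurable]: "G \<in> borel_measurable borel" using G(2) by (rule L2_measurable)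
  define c where "c = (2 * pi) ^ DIM('a)"
  have c: "c > 0" by (simp add: c_def)
  \<comment> \<open>The inverse transform is the conjugate of the transform of the conjugate, which avoids reflections.\<close>
  define H where "H x = cnj (G x)" for x
  have H: "integrable lborel H" unfolding H_def[abs_def] using G(1) by simp
  then have "H \<in> L2"
    using G(2) borel_measurable_integrable[OF H] by (intro L2_bound[of H G]) (auto simp: H_def)
  note H = H this
  have [measurable]: "H \<in> borel_measurable borel" using H(2) by (rule L2_measurable)
  define w where "w x = complex_of_real (1 / c) * cnj (fourier H x)" for x
  have w_meas[measurable]: "w \<in> borel_measurable borel" unfolding w_def[abs_def] by measurable
  have "sq_norm w = ennreal ((1 / c)\<^sup>2) * sq_norm (fourier H)"
    unfolding w_def using c by (subst sq_norm_cmult) (auto simp: sq_norm_def norm_divide)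
  also have "\<dots> = ennreal ((1 / c)\<^sup>2) * (ennreal c * sq_norm H)"
    unfolding c_def by (simp only: plancherel[OF H])
  also have "\<dots> < \<infinity>" using H(2) by (auto simp: L2_iff ennreal_mult_less_top)
  finally have w: "w \<in> L2" by (simp add: L2_iff)
  define \<phi> where "\<phi> k x = w x * complex_of_real (gauss (1 / real (Suc k)) x)" for k x
  have [measurable]: "\<phi> k \<in> borel_measurable borel" for k unfolding \<phi>_def by measurable
  have gauss_le_1: "gauss s (x::'a) \<le> 1" for s x by (simp add: gauss_def)
  have \<phi>_le: "cmod (\<phi> k x) \<le> cmod (w x)" for k x
    unfolding \<phi>_def by (simp add: norm_mult mult_left_le gauss_le_1)
  have \<phi>_L2: "\<phi> k \<in> L2" for k
    using w \<phi>_le by (intro L2_bound[of "\<phi> k" w]) auto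
  have \<phi>_int: "integrable lborel (\<phi> k)" for k
  proof -
    have w_le: "cmod (w x) \<le> 1 / c * (LINT x|lborel. cmod (H x))" for x
      using fourier_bounded[of H x] c by (simp add: w_def norm_divide divide_right_mono)
    have "integrable lborel (\<lambda>x::'a. complex_of_real (gauss (1 / real (Suc k)) x))"
      using gauss_integrable[of "1 / real (Suc k)", where 'a='a] by simp
    from integrable_mult_bounded[OF this w_meas w_le] show ?thesis
      by (simp add: \<phi>_def[abs_def] mult.commute)
  qed
  have fourier_\<phi>: "fourier (\<phi> k) = heat_conv (1 / real (Suc k)) G" for k
  proof
    fix \<xi> :: 'a
    define \<sigma> where "\<sigma> = 1 / real (Suc k)"
    have "cnj (fourier (\<phi> k) \<xi>)
        = (LINT x|lborel. complex_of_real (1 / c) * (fourier H x * (cis (\<xi> \<bullet> x) * complex_of_real (gauss \<sigma> x))))"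
      unfolding cnj_fourier by (simp add: \<phi>_def w_def \<sigma>_def inner_commute mult_ac)
    also have "\<dots> = complex_of_real (1 / c) * (complex_of_real c * heat_conv \<sigma> H \<xi>)"
      unfolding integral_mult_right_zero c_def by (subst fourier_gauss[OF H(1)]) (auto simp: \<sigma>_def)
    also have "\<dots> = heat_conv \<sigma> H \<xi>" using c by simp
    also have "\<dots> = cnj (heat_conv \<sigma> G \<xi>)"
      unfolding heat_conv_def H_def by (subst Bochner_Integration.integral_cnj[symmetric]) simp
    finally show "fourier (\<phi> k) \<xi> = heat_conv (1 / real (Suc k)) G \<xi>"
      by (simp add: \<sigma>_def)
  qed
  have "L2_tendsto \<phi> w"
  proof -
    have "(\<lambda>k. \<integral>\<^sup>+ x. ennreal ((cmod (\<phi> k x - w x))\<^sup>2) \<partial>lborel) \<longlonglongrightarrow> (\<integral>\<^sup>+ x. 0 \<partial>(lborel :: 'a measure))"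
    proof (rule nn_integral_dominated_convergence[where w = "\<lambda>x. ennreal ((cmod (w x))\<^sup>2)"])
      have "cmod (\<phi> k x - w x) \<le> cmod (w x)" for k x
      proof -
        have "\<phi> k x - w x = - (w x * complex_of_real (1 - gauss (1 / real (Suc k)) x))"
          by (simp add: \<phi>_def algebra_simps)
        then show ?thesis
          by (simp only: norm_minus_cancel norm_mult norm_of_real) (simp add: mult_left_le gauss_le_1)
      qed
      then show "AE x in lborel. ennreal ((cmod (\<phi> k x - w x))\<^sup>2) \<le> ennreal ((cmod (w x))\<^sup>2)" for k
        by (intro AE_I2 ennreal_leI power_mono) auto
      show "(\<integral>\<^sup>+ x. ennreal ((cmod (w x))\<^sup>2) \<partial>lborel) < \<infinity>"
        using w by (simp add: L2_iff sq_norm_def)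
      show "AE x in lborel. (\<lambda>k. ennreal ((cmod (\<phi> k x - w x))\<^sup>2)) \<longlonglongrightarrow> 0"
      proof (intro AE_I2)
        fix x
        have "(\<lambda>k. 1 / real (Suc k)) \<longlonglongrightarrow> 0"
          using LIMSEQ_inverse_real_of_nat by (simp add: inverse_eq_divide)
        then have "(\<lambda>k. (cmod (\<phi> k x - w x))\<^sup>2) \<longlonglongrightarrow> (cmod (w x * complex_of_real (gauss 0 x) - w x))\<^sup>2"
          unfolding \<phi>_def gauss_def by (intro tendsto_intros) auto
        then show "(\<lambda>k. ennreal ((cmod (\<phi> k x - w x))\<^sup>2)) \<longlonglongrightarrow> 0"
          by (subst ennreal_0[symmetric]) (intro tendsto_ennrealI, simp add: gauss_def)
      qed
    qed measurable
    then show ?thesis by (simp add: L2_tendsto_def)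
  qed
  moreover have "L2_tendsto (\<lambda>k. fourier (\<phi> k)) G"
    unfolding fourier_\<phi> by (rule heat_conv_tendsto[OF G])
  ultimately show ?thesis
    unfolding fourier_L2_def using w G(2) \<phi>_L2 \<phi>_int by blast
qed

text \<open>The geometric bound makes \<open>\<Sum> 2\<^sup>j |f (j + 1) - f j|\<^sup>2\<close> integrable, hence finite almost everywhere, which forces pointwise
  convergence there. Fatou's lemma turns the pointwise limit into a limit in mean square.\<close>

lemma L2_complete_fast:
  fixes f :: "nat \<Rightarrow> 'a::euclidean_space \<Rightarrow> complex"
  assumes f: "\<And>j. f j \<in> L2" and fast: "\<And>j. sq_norm (\<lambda>x. f (Suc j) x - f j x) \<le> ennreal (1 / 4 ^ j)"
  shows "\<exists>g\<in>L2. L2_tendsto f g"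
proof -
  have fm[measurable]: "f j \<in> borel_measurable borel" for j using f by (rule L2_measurable)
  define d where "d j x = f (Suc j) x - f j x" for j x
  have [measurable]: "d j \<in> borel_measurable borel" for j unfolding d_def by measurable
  have "(\<integral>\<^sup>+ x. (\<Sum>j. ennreal (2 ^ j) * ennreal ((cmod (d j x))\<^sup>2)) \<partial>lborel)
      = (\<Sum>j. ennreal (2 ^ j) * sq_norm (d j))"
    unfolding sq_norm_def by (subst nn_integral_suminf) (auto simp: nn_integral_cmult)
  also have "\<dots> \<le> (\<Sum>j. ennreal ((1 / 2) ^ j))"
  proof (intro suminf_le summableI allI)
    fix j
    have "ennreal (2 ^ j) * sq_norm (d j) \<le> ennreal (2 ^ j) * ennreal (1 / 4 ^ j)"
      using fast[of j] unfolding d_def by (intro mult_left_mono) auto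
    also have "\<dots> = ennreal (2 ^ j * (1 / 4 ^ j))" by (rule ennreal_mult[symmetric]) auto
    also have "2 ^ j * (1 / 4 ^ j) = (1 / 2 :: real) ^ j"
      by (simp add: power_divide power_mult_distrib[symmetric] field_simps flip: power_mult_distrib)
    finally show "ennreal (2 ^ j) * sq_norm (d j) \<le> ennreal ((1 / 2) ^ j)" .
  qed
  also have "\<dots> = ennreal (\<Sum>j. (1 / 2) ^ j)" by (intro suminf_ennreal2) (auto intro: summable_geometric)
  also have "\<dots> < \<infinity>" by simp
  finally have "AE x in lborel. (\<Sum>j. ennreal (2 ^ j) * ennreal ((cmod (d j x))\<^sup>2)) \<noteq> \<infinity>"
    by (intro nn_integral_PInf_AE) auto
  then have conv: "AE x in lborel. convergent (\<lambda>j. f j x)"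
  proof (rule AE_mp, intro AE_I2 impI)
    fix x assume fin: "(\<Sum>j. ennreal (2 ^ j) * ennreal ((cmod (d j x))\<^sup>2)) \<noteq> \<infinity>"
    define S where "S = enn2real (\<Sum>j. ennreal (2 ^ j) * ennreal ((cmod (d j x))\<^sup>2))"
    have S: "S \<ge> 0" by (simp add: S_def)
    have bound: "cmod (d j x) \<le> sqrt S * (1 / sqrt 2) ^ j" for j
    proof -
      have "ennreal (2 ^ j * (cmod (d j x))\<^sup>2) = ennreal (2 ^ j) * ennreal ((cmod (d j x))\<^sup>2)"
        by (rule ennreal_mult) auto
      also have "\<dots> \<le> (\<Sum>j. ennreal (2 ^ j) * ennreal ((cmod (d j x))\<^sup>2))"
        using sum_le_suminf[OF summableI, of "{j}"] by simp
      also have "\<dots> = ennreal S" unfolding S_def using fin by (subst ennreal_enn2real) (simp_all add: less_top)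
      finally have "2 ^ j * (cmod (d j x))\<^sup>2 \<le> S" using S by (simp only: ennreal_le_iff)
      then have "(cmod (d j x))\<^sup>2 \<le> S * (1 / 2) ^ j" by (simp add: power_divide field_simps)
      also have "\<dots> = (sqrt S * (1 / sqrt 2) ^ j)\<^sup>2"
      proof -
        have "((1 / sqrt 2) ^ j)\<^sup>2 = ((1 / sqrt 2)\<^sup>2) ^ j" by (simp only: power_mult[symmetric] mult.commute)
        then show ?thesis using S by (simp add: power_mult_distrib power_divide)
      qed
      finally show ?thesis by (rule power2_le_imp_le) (use S in auto)
    qed
    have "summable (\<lambda>j. sqrt S * (1 / sqrt 2) ^ j)"
      by (intro summable_mult summable_geometric) simp
    then have "summable (\<lambda>j. d j x)"
      by (rule summable_comparison_test'[where N=0]) (use bound in auto)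
    then have "convergent (\<lambda>n. f 0 x + (\<Sum>j<n. d j x))"
      by (intro convergent_add convergent_const) (simp add: summable_iff_convergent)
    also have "(\<lambda>n. f 0 x + (\<Sum>j<n. d j x)) = (\<lambda>n. f n x)"
      unfolding d_def by (subst sum_lessThan_telescope) simp
    finally show "convergent (\<lambda>j. f j x)" .
  qed
  define g where "g x = lim (\<lambda>j. f j x)" for x
  have g_meas[measurable]: "g \<in> borel_measurable borel"
    unfolding g_def[abs_def] by measurable
  have g_lim: "AE x in lborel. (\<lambda>j. f j x) \<longlonglongrightarrow> g x"
    using conv by eventually_elim (simp add: g_def convergent_LIMSEQ_iff)
  have step: "L2_norm (\<lambda>x. f (Suc j) x - f j x) \<le> (1 / 2) ^ j" for j
  proof -
    have "ennreal ((L2_norm (\<lambda>x. f (Suc j) x - f j x))\<^sup>2) \<le> ennreal (((1 / 2) ^ j)\<^sup>2)"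
      using fast[of j] unfolding sq_norm_eq_L2_norm[OF L2_diff[OF f f]]
      by (simp add: power_divide power_mult[symmetric] mult.commute[of j]) (simp add: power_mult)
    then have "(L2_norm (\<lambda>x. f (Suc j) x - f j x))\<^sup>2 \<le> ((1 / 2) ^ j)\<^sup>2" by (subst (asm) ennreal_le_iff) auto
    then show ?thesis by (rule power2_le_imp_le) simp
  qed
  \<comment> \<open>The bound is written as a telescoping difference so that the induction on \<open>m\<close> closes.\<close>
  have tail: "L2_norm (\<lambda>x. f (j + m) x - f j x) \<le> 2 * (1 / 2) ^ j - 2 * (1 / 2) ^ (j + m)" for j m
  proof (induction m)
    case 0
    show ?case by (simp add: L2_norm_def)
  next
    case (Suc m)
    have "L2_norm (\<lambda>x. f (j + Suc m) x - f j x)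
        \<le> L2_norm (\<lambda>x. f (Suc (j + m)) x - f (j + m) x) + L2_norm (\<lambda>x. f (j + m) x - f j x)"
      using L2_norm_minkowski[OF L2_diff[OF f f] L2_diff[OF f f], of "Suc (j + m)" "j + m" "j + m" j] by simp
    with step[of "j + m"] Suc show ?case by simp
  qed
  have close: "sq_norm (\<lambda>x. f j x - g x) \<le> ennreal ((2 * (1 / 2) ^ j)\<^sup>2)" for j
  proof -
    have "sq_norm (\<lambda>x. f j x - g x) = (\<integral>\<^sup>+ x. liminf (\<lambda>m. ennreal ((cmod (f (j + m) x - f j x))\<^sup>2)) \<partial>lborel)"
      unfolding sq_norm_def
    proof (rule nn_integral_cong_AE)
      show "AE x in lborel. ennreal ((cmod (f j x - g x))\<^sup>2) = liminf (\<lambda>m. ennreal ((cmod (f (j + m) x - f j x))\<^sup>2))"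
        using g_lim
      proof eventually_elim
        case (elim x)
        have "(\<lambda>m. f (m + j) x) \<longlonglongrightarrow> g x" using elim by (rule LIMSEQ_ignore_initial_segment)
        then have "(\<lambda>m. ennreal ((cmod (f (j + m) x - f j x))\<^sup>2)) \<longlonglongrightarrow> ennreal ((cmod (g x - f j x))\<^sup>2)"
          by (intro tendsto_ennrealI tendsto_intros) (simp add: add.commute)
        from lim_imp_Liminf[OF _ this] show ?case by (simp add: norm_minus_commute)
      qed
    qed
    also have "\<dots> \<le> liminf (\<lambda>m. \<integral>\<^sup>+ x. ennreal ((cmod (f (j + m) x - f j x))\<^sup>2) \<partial>lborel)"
      by (rule nn_integral_liminf) measurable
    also have "\<dots> \<le> liminf (\<lambda>m. ennreal ((2 * (1 / 2) ^ j)\<^sup>2))"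
    proof (intro Liminf_mono always_eventually allI)
      fix m
      have "(\<integral>\<^sup>+ x. ennreal ((cmod (f (j + m) x - f j x))\<^sup>2) \<partial>lborel)
          = ennreal ((L2_norm (\<lambda>x. f (j + m) x - f j x))\<^sup>2)"
        using sq_norm_eq_L2_norm[OF L2_diff[OF f f]] by (simp add: sq_norm_def)
      also have "\<dots> \<le> ennreal ((2 * (1 / 2) ^ j)\<^sup>2)"
        using tail[of j m] by (intro ennreal_leI power_mono order_trans[OF tail]) (auto simp: L2_norm_nonneg)
      finally show "(\<integral>\<^sup>+ x. ennreal ((cmod (f (j + m) x - f j x))\<^sup>2) \<partial>lborel) \<le> ennreal ((2 * (1 / 2) ^ j)\<^sup>2)" .
    qed
    finally show ?thesis by (simp add: Liminf_const)
  qed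
  have "(\<lambda>x. f 0 x - g x) \<in> L2"
    using close[of 0] by (simp add: L2_iff le_less_trans)
  from L2_diff[OF f[of 0] this] have "g \<in> L2" by simp
  moreover have "L2_tendsto f g"
    unfolding L2_tendsto_iff
  proof (rule tendsto_sandwich[OF _ _ tendsto_const])
    show "\<forall>\<^sub>F j in sequentially. sq_norm (\<lambda>x. f j x - g x) \<le> ennreal ((2 * (1 / 2) ^ j)\<^sup>2)"
      by (intro always_eventually allI close)
    have "(\<lambda>j. (2 * (1 / 2 :: real) ^ j)\<^sup>2) \<longlonglongrightarrow> (2 * 0)\<^sup>2"
      by (intro tendsto_intros LIMSEQ_power_zero) simp
    then show "(\<lambda>j. ennreal ((2 * (1 / 2) ^ j)\<^sup>2)) \<longlonglongrightarrow> 0"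
      using tendsto_ennrealI by fastforce
  qed simp
  ultimately show ?thesis by blast
qed

lemma L2_truncation:
  fixes G :: "'a::euclidean_space \<Rightarrow> complex"
  assumes G: "G \<in> L2"
  defines "T \<equiv> \<lambda>k x. G x * indicator (cball 0 (real k)) x"
  shows "T k \<in> L2" "integrable lborel (T k)" "L2_tendsto T G"
proof -
  have [measurable]: "G \<in> borel_measurable borel" using G by (rule L2_measurable)
  have [measurable]: "cball (0::'a) (real k) \<in> sets borel" for k by (intro borel_closed closed_cball)
  have T_meas[measurable]: "T k \<in> borel_measurable borel" for k unfolding T_def by measurable
  show "T k \<in> L2"
    by (rule L2_bound[OF T_meas G]) (auto simp: T_def split: split_indicator)
  have "integrable lborel (\<lambda>x. (cmod (G x))\<^sup>2 + indicator (cball 0 (real k)) x)"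
    using G emeasure_lborel_cball_finite[of 0 "real k"]
    by (intro Bochner_Integration.integrable_add integrable_real_indicator) (auto simp: L2_def)
  then show "integrable lborel (T k)"
  proof (rule Bochner_Integration.integrable_bound)
    have "cmod (G x) \<le> (cmod (G x))\<^sup>2 + 1" for x
      using sum_squares_bound[of "cmod (G x)" 1] by (simp add: power2_eq_square) (smt (verit) norm_ge_zero)
    then show "AE x in lborel. norm (T k x) \<le> norm ((cmod (G x))\<^sup>2 + indicator (cball 0 (real k)) x)"
      by (auto simp: T_def split: split_indicator)
  qed measurable
  have "(\<lambda>k. \<integral>\<^sup>+ x. ennreal ((cmod (T k x - G x))\<^sup>2) \<partial>lborel) \<longlonglongrightarrow> (\<integral>\<^sup>+ x. 0 \<partial>(lborel :: 'a measure))"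
  proof (rule nn_integral_dominated_convergence[where w = "\<lambda>x. ennreal ((cmod (G x))\<^sup>2)"])
    show "(\<integral>\<^sup>+ x. ennreal ((cmod (G x))\<^sup>2) \<partial>lborel) < \<infinity>" using G by (simp add: L2_iff sq_norm_def)
    show "AE x in lborel. ennreal ((cmod (T k x - G x))\<^sup>2) \<le> ennreal ((cmod (G x))\<^sup>2)" for k
      by (auto simp: T_def split: split_indicator)
    show "AE x in lborel. (\<lambda>k. ennreal ((cmod (T k x - G x))\<^sup>2)) \<longlonglongrightarrow> 0"
    proof (intro AE_I2 tendsto_eventually)
      fix x :: 'a
      obtain K :: nat where K: "norm x \<le> real K" using real_arch_simple by blast
      show "\<forall>\<^sub>F k in sequentially. ennreal ((cmod (T k x - G x))\<^sup>2) = 0"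
        using eventually_ge_at_top[of K]
        by eventually_elim (use K in \<open>auto simp: T_def split: split_indicator\<close>)
    qed
  qed measurable
  then show "L2_tendsto T G" by (simp add: L2_tendsto_def)
qed

text \<open>Truncations of \<open>G\<close> to balls are covered by \<open>fourier_L2_inversion\<close>. Along a subsequence that converges fast enough, their
  preimages converge as well, since the transform preserves distances up to a factor.\<close>

theorem fourier_L2_surj:
  fixes G :: "'a::euclidean_space \<Rightarrow> complex"
  assumes G: "G \<in> L2"
  shows "\<exists>w. fourier_L2 w G"
proof -
  define T where "T k x = G x * indicator (cball 0 (real k)) x" for k x
  have T: "T k \<in> L2" "integrable lborel (T k)" "L2_tendsto T G" for k
    using L2_truncation[OF G] unfolding T_def[abs_def] by auto
  have [measurable]: "G \<in> borel_measurable borel" "T k \<in> borel_measurable borel" for k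
    using G T(1) by (auto intro: L2_measurable)
  \<comment> \<open>The first bound gives the fast convergence needed for completeness, the second one gives the limit.\<close>
  have "\<exists>m. sq_norm (\<lambda>x. T m x - G x) \<le> ennreal (1 / 4 ^ Suc j) \<and> sq_norm (\<lambda>x. T m x - G x) \<le> ennreal (1 / real (Suc j))" for j
  proof -
    have "\<forall>\<^sub>F m in sequentially. sq_norm (\<lambda>x. T m x - G x) < ennreal (1 / 4 ^ Suc j)
        \<and> sq_norm (\<lambda>x. T m x - G x) < ennreal (1 / real (Suc j))"
      using T(3) unfolding L2_tendsto_iff by (intro eventually_conj order_tendstoD(2)) auto
    then show ?thesis by (auto dest!: eventually_happens intro: less_imp_le)
  qed
  then obtain m where m: "\<And>j. sq_norm (\<lambda>x. T (m j) x - G x) \<le> ennreal (1 / 4 ^ Suc j)"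
    "\<And>j. sq_norm (\<lambda>x. T (m j) x - G x) \<le> ennreal (1 / real (Suc j))" by metis
  have step: "sq_norm (\<lambda>x. T (m (Suc j)) x - T (m j) x) \<le> ennreal (1 / 4 ^ j)" for j
  proof -
    have "sq_norm (\<lambda>x. T (m (Suc j)) x - T (m j) x)
        \<le> 2 * sq_norm (\<lambda>x. T (m (Suc j)) x - G x) + 2 * sq_norm (\<lambda>x. T (m j) x - G x)"
      using sq_norm_diff_le_2[of "\<lambda>x. T (m (Suc j)) x - G x" "\<lambda>x. T (m j) x - G x"] by simp
    also have "\<dots> \<le> 2 * ennreal (1 / 4 ^ Suc (Suc j)) + 2 * ennreal (1 / 4 ^ Suc j)"
      by (intro add_mono mult_left_mono m) auto
    also have "\<dots> = ennreal (2 * (1 / 4 ^ Suc (Suc j)) + 2 * (1 / 4 ^ Suc j))"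
      by (simp only: ennreal_plus ennreal_mult ennreal_numeral zero_le_divide_1_iff zero_le_power
          zero_le_numeral mult_nonneg_nonneg)
    also have "\<dots> \<le> ennreal (1 / 4 ^ j)" by (intro ennreal_leI) (simp add: field_simps)
    finally show ?thesis .
  qed
  have "\<exists>w. fourier_L2 w (T (m j))" for j by (rule fourier_L2_inversion[OF T(2,1)])
  then obtain w where w: "\<And>j. fourier_L2 (w j) (T (m j))" by metis
  have w_L2: "w j \<in> L2" for j using w by (auto simp: fourier_L2_def)
  have w_step: "sq_norm (\<lambda>x. w (Suc j) x - w j x) \<le> ennreal (1 / 4 ^ j)" for j
  proof -
    define c where "c = (2 * pi) ^ DIM('a)"
    have c: "c \<ge> 1" unfolding c_def using pi_gt3 by (intro one_le_power) auto
    have "1 * L2_norm (\<lambda>x. w (Suc j) x - w j x) \<le> sqrt c * L2_norm (\<lambda>x. w (Suc j) x - w j x)"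
      using c by (intro mult_right_mono L2_norm_nonneg) auto
    also have "\<dots> = L2_norm (\<lambda>x. T (m (Suc j)) x - T (m j) x)"
      unfolding c_def by (rule fourier_L2_plancherel[OF fourier_L2_diff[OF w w], symmetric])
    finally have "sq_norm (\<lambda>x. w (Suc j) x - w j x) \<le> sq_norm (\<lambda>x. T (m (Suc j)) x - T (m j) x)"
      unfolding sq_norm_eq_L2_norm[OF L2_diff[OF w_L2 w_L2]] sq_norm_eq_L2_norm[OF L2_diff[OF T(1) T(1)]]
      by (intro ennreal_leI power_mono) (auto simp: L2_norm_nonneg)
    with step[of j] show ?thesis by (rule order_trans[rotated])
  qed
  obtain v where v: "v \<in> L2" "L2_tendsto w v" using L2_complete_fast[OF w_L2 w_step] by blast
  have "L2_tendsto (\<lambda>j. T (m j)) G"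
    unfolding L2_tendsto_iff
  proof (rule tendsto_sandwich[OF _ _ tendsto_const])
    show "\<forall>\<^sub>F j in sequentially. sq_norm (\<lambda>x. T (m j) x - G x) \<le> ennreal (1 / real (Suc j))"
      by (intro always_eventually allI m)
    show "(\<lambda>k. ennreal (1 / real (Suc k))) \<longlonglongrightarrow> 0"
      using tendsto_ennrealI[OF LIMSEQ_inverse_real_of_nat] by (simp add: inverse_eq_divide)
  qed simp
  from fourier_L2_closed[OF w v(1) G v(2) this] show ?thesis by blast
qed

text \<open>Multipliers are defined by a choice of the transform and of the image function. Uniqueness makes every choice of the
  transform agree with the given \<open>F\<close> almost everywhere, Plancherel's identity makes the norm independent of the
  image chosen, and surjectivity reduces existence of an image to square integrability.\<close>

lemma multiplier_iff:
  fixes f F :: "'a::euclidean_space \<Rightarrow> complex" and m :: "'a \<Rightarrow> real"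
  assumes f: "fourier_L2 f F" and m[measurable]: "m \<in> borel_measurable borel"
  shows "f \<in> multiplier_domain m \<longleftrightarrow> (\<lambda>\<xi>. complex_of_real (m \<xi>) * F \<xi>) \<in> L2"
    and "f \<in> multiplier_domain m \<Longrightarrow>
      L2_norm (\<lambda>\<xi>. complex_of_real (m \<xi>) * F \<xi>) = sqrt ((2 * pi) ^ DIM('a)) * L2_norm (multiplier m f)"
proof -
  have F[measurable]: "F \<in> borel_measurable borel" using f by (auto simp: fourier_L2_def intro: L2_measurable)
  have image: "fourier_L2 w (\<lambda>\<xi>. complex_of_real (m \<xi>) * F \<xi>)" if w: "is_multiplier_image m f w" for w
  proof -
    obtain F' where F': "fourier_L2 f F'" "fourier_L2 w (\<lambda>\<xi>. complex_of_real (m \<xi>) * F' \<xi>)"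
      using w unfolding is_multiplier_image_def by blast
    have ae: "AE \<xi> in lborel. F' \<xi> = F \<xi>" by (rule fourier_L2_unique[OF F'(1) f])
    have "(\<lambda>\<xi>. complex_of_real (m \<xi>) * F' \<xi>) \<in> L2" using F'(2) by (simp add: fourier_L2_def)
    then have "(\<lambda>\<xi>. complex_of_real (m \<xi>) * F \<xi>) \<in> L2"
      by (rule L2_bound[rotated]) (use ae in auto)
    then show ?thesis by (rule fourier_L2_cong_AE[OF F'(2)]) (use ae in auto)
  qed
  show "f \<in> multiplier_domain m \<longleftrightarrow> (\<lambda>\<xi>. complex_of_real (m \<xi>) * F \<xi>) \<in> L2"
  proof
    assume "f \<in> multiplier_domain m"
    then show "(\<lambda>\<xi>. complex_of_real (m \<xi>) * F \<xi>) \<in> L2"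
      using image by (auto simp: multiplier_domain_def fourier_L2_def)
  next
    assume "(\<lambda>\<xi>. complex_of_real (m \<xi>) * F \<xi>) \<in> L2"
    then obtain w where "fourier_L2 w (\<lambda>\<xi>. complex_of_real (m \<xi>) * F \<xi>)"
      using fourier_L2_surj by blast
    with f show "f \<in> multiplier_domain m"
      unfolding multiplier_domain_def is_multiplier_image_def by blast
  qed
  assume "f \<in> multiplier_domain m"
  then have "is_multiplier_image m f (multiplier m f)"
    using someI_ex[of "is_multiplier_image m f"] unfolding multiplier_domain_def multiplier_def by auto
  then show "L2_norm (\<lambda>\<xi>. complex_of_real (m \<xi>) * F \<xi>) = sqrt ((2 * pi) ^ DIM('a)) * L2_norm (multiplier m f)"
    by (intro fourier_L2_plancherel image)
qed

section \<open>Decay of Sobolev solutions\<close>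

lemma L2_norm_mono:
  assumes "f \<in> L2" "g \<in> L2" "AE x in lborel. cmod (f x) \<le> cmod (g x)"
  shows "L2_norm f \<le> L2_norm g"
  unfolding L2_norm_def using assms
  by (intro real_sqrt_le_mono integral_mono_AE) (auto simp: L2_def)

lemma L2_norm_cmult_cmod:
  assumes "c \<ge> 0"
  shows "L2_norm (\<lambda>x. complex_of_real (c * cmod (f x))) = c * L2_norm f"
  using assms by (simp add: L2_norm_def norm_mult power_mult_distrib real_sqrt_mult)

text \<open>A pointwise bound between symbols times transforms carries over to norms of multipliers; the powers of \<open>2\<pi>\<close> cancel.\<close>

lemma multiplier_estimate:
  fixes y Y u\<^sub>0 u\<^sub>1 F\<^sub>0 F\<^sub>1 :: "'a::euclidean_space \<Rightarrow> complex" and m m\<^sub>0 m\<^sub>1 :: "'a \<Rightarrow> real"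
  assumes y: "fourier_L2 y Y" and u0: "fourier_L2 u\<^sub>0 F\<^sub>0" and u1: "fourier_L2 u\<^sub>1 F\<^sub>1"
    and m: "m \<in> borel_measurable borel" "m\<^sub>0 \<in> borel_measurable borel" "m\<^sub>1 \<in> borel_measurable borel"
    and dom: "u\<^sub>0 \<in> multiplier_domain m\<^sub>0" "u\<^sub>1 \<in> multiplier_domain m\<^sub>1"
    and c: "c\<^sub>0 \<ge> 0" "c\<^sub>1 \<ge> 0"
    and le: "AE \<xi> in lborel. \<bar>m \<xi>\<bar> * cmod (Y \<xi>)
      \<le> c\<^sub>0 * (\<bar>m\<^sub>0 \<xi>\<bar> * cmod (F\<^sub>0 \<xi>)) + c\<^sub>1 * (\<bar>m\<^sub>1 \<xi>\<bar> * cmod (F\<^sub>1 \<xi>))"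
  shows "y \<in> multiplier_domain m" (is ?dom)
    and "L2_norm (multiplier m y)
      \<le> c\<^sub>0 * L2_norm (multiplier m\<^sub>0 u\<^sub>0) + c\<^sub>1 * L2_norm (multiplier m\<^sub>1 u\<^sub>1)" (is ?est)
proof -
  define G G\<^sub>0 G\<^sub>1 where "G = (\<lambda>\<xi>. complex_of_real (m \<xi>) * Y \<xi>)"
    and "G\<^sub>0 = (\<lambda>\<xi>. complex_of_real (m\<^sub>0 \<xi>) * F\<^sub>0 \<xi>)" and "G\<^sub>1 = (\<lambda>\<xi>. complex_of_real (m\<^sub>1 \<xi>) * F\<^sub>1 \<xi>)"
  define K where "K = sqrt ((2 * pi) ^ DIM('a))"
  have K: "K > 0" by (simp add: K_def)
  have L2: "G\<^sub>0 \<in> L2" "G\<^sub>1 \<in> L2"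
    using dom multiplier_iff(1)[OF u0 m(2)] multiplier_iff(1)[OF u1 m(3)] by (auto simp: G\<^sub>0_def G\<^sub>1_def)
  note [measurable] = m L2_measurable[OF L2(1)] L2_measurable[OF L2(2)]
  have [measurable]: "Y \<in> borel_measurable borel" using y by (auto simp: fourier_L2_def intro: L2_measurable)
  define P where "P c f = (\<lambda>\<xi>::'a. complex_of_real (c * cmod (f \<xi> :: complex)))" for c f
  have P: "P c f \<in> L2" if "f \<in> L2" for c f
    unfolding P_def using L2_measurable[OF that]
    by (intro L2_bound[OF _ L2_cmult[OF that, of "complex_of_real c"]]) (auto simp: norm_mult)
  have PP: "(\<lambda>\<xi>. P c\<^sub>0 G\<^sub>0 \<xi> + P c\<^sub>1 G\<^sub>1 \<xi>) \<in> L2" by (intro L2_add P L2)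
  have G_le: "AE \<xi> in lborel. cmod (G \<xi>) \<le> cmod (P c\<^sub>0 G\<^sub>0 \<xi> + P c\<^sub>1 G\<^sub>1 \<xi>)"
    using le
  proof eventually_elim
    case (elim \<xi>)
    have "P c\<^sub>0 G\<^sub>0 \<xi> + P c\<^sub>1 G\<^sub>1 \<xi> = complex_of_real (c\<^sub>0 * cmod (G\<^sub>0 \<xi>) + c\<^sub>1 * cmod (G\<^sub>1 \<xi>))"
      by (simp add: P_def)
    then have "cmod (P c\<^sub>0 G\<^sub>0 \<xi> + P c\<^sub>1 G\<^sub>1 \<xi>) = c\<^sub>0 * cmod (G\<^sub>0 \<xi>) + c\<^sub>1 * cmod (G\<^sub>1 \<xi>)"
      using c by (simp only: norm_of_real) simp
    then show ?case using elim by (simp add: G_def G\<^sub>0_def G\<^sub>1_def norm_mult)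
  qed
  have G: "G \<in> L2" by (rule L2_bound[OF _ PP G_le]) (simp add: G_def)
  then show dom': ?dom using multiplier_iff(1)[OF y m(1)] by (simp add: G_def)
  have "K * L2_norm (multiplier m y) = L2_norm G"
    unfolding G_def K_def by (rule multiplier_iff(2)[OF y m(1) dom', symmetric])
  also have "\<dots> \<le> L2_norm (\<lambda>\<xi>. P c\<^sub>0 G\<^sub>0 \<xi> + P c\<^sub>1 G\<^sub>1 \<xi>)" by (rule L2_norm_mono[OF G PP G_le])
  also have "\<dots> \<le> L2_norm (P c\<^sub>0 G\<^sub>0) + L2_norm (P c\<^sub>1 G\<^sub>1)" by (intro L2_norm_minkowski P L2)
  also have "\<dots> = c\<^sub>0 * L2_norm G\<^sub>0 + c\<^sub>1 * L2_norm G\<^sub>1"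
    unfolding P_def using c by (simp only: L2_norm_cmult_cmod)
  also have "\<dots> = c\<^sub>0 * (K * L2_norm (multiplier m\<^sub>0 u\<^sub>0)) + c\<^sub>1 * (K * L2_norm (multiplier m\<^sub>1 u\<^sub>1))"
    unfolding G\<^sub>0_def G\<^sub>1_def K_def
    by (simp only: multiplier_iff(2)[OF u0 m(2) dom(1)] multiplier_iff(2)[OF u1 m(3) dom(2)])
  also have "\<dots> = K * (c\<^sub>0 * L2_norm (multiplier m\<^sub>0 u\<^sub>0) + c\<^sub>1 * L2_norm (multiplier m\<^sub>1 u\<^sub>1))"
    by (simp add: algebra_simps)
  finally show ?est using K by (simp only: mult_le_cancel_left_pos)
qed

lemma abs_symbol_measurable: "abs_symbol s \<in> borel_measurable borel"
  unfolding abs_symbol_def[abs_def] by measurable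

lemma bessel_symbol_measurable: "bessel_symbol s \<in> borel_measurable borel"
  unfolding bessel_symbol_def[abs_def] by measurable

text \<open>Both \<open>|\<xi>|\<^sup>s |U|\<close> and \<open>|\<xi>|^(s-1) |V|\<close> are at most \<open>|\<xi>|^(s-1)\<close> times the square root of the energy of the mode, so a
  single frequency estimate controls solution and time derivative simultaneously.\<close>

lemma (in effective_damping) sobolev_solution_estimate:
  assumes s: "s \<ge> 1"
  shows "\<exists>C>0. \<forall>(u\<^sub>0 :: 'a::euclidean_space \<Rightarrow> complex) u\<^sub>1 u v.
    sobolev_solution b g u\<^sub>0 u\<^sub>1 u v \<longrightarrow> u\<^sub>0 \<in> sobolev_H s \<longrightarrow> u\<^sub>1 \<in> sobolev_H (s - 1) \<longrightarrow>
    (\<forall>t\<ge>0. u t \<in> multiplier_domain (abs_symbol s) \<and> v t \<in> multiplier_domain (abs_symbol (s - 1)) \<and>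
      max (L2_norm (multiplier (abs_symbol s) (u t))) (L2_norm (multiplier (abs_symbol (s - 1)) (v t)))
        \<le> C * (parabolic_time t powr (- s / 2) * sobolev_norm s u\<^sub>0 + parabolic_time t powr (- (s - 1) / 2) * sobolev_norm (s - 1) u\<^sub>1))"
proof -
  obtain C where C: "C > 0" and freq: "\<forall>r U V W. r > 0 \<longrightarrow>
    (\<forall>t\<ge>0. (U has_vector_derivative V t) (at t within {0..}) \<and>
      (V has_vector_derivative W t) (at t within {0..}) \<and>
      W t + complex_of_real (r\<^sup>2) * U t + complex_of_real (b t + g t * r\<^sup>2) * V t = 0) \<longrightarrow>
    (\<forall>t\<ge>0. r powr (s - 1) * sqrt ((cmod (V t))\<^sup>2 + r\<^sup>2 * (cmod (U t))\<^sup>2) \<le>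
      C * (parabolic_time t powr (- s / 2) * ((1 + r\<^sup>2) powr (s / 2) * cmod (U 0))
         + parabolic_time t powr (- (s - 1) / 2) * ((1 + r\<^sup>2) powr ((s - 1) / 2) * cmod (V 0))))"
    using frequency_estimate[OF s] by blast
  have "u t \<in> multiplier_domain (abs_symbol s) \<and> v t \<in> multiplier_domain (abs_symbol (s - 1)) \<and>
      max (L2_norm (multiplier (abs_symbol s) (u t))) (L2_norm (multiplier (abs_symbol (s - 1)) (v t)))
        \<le> C * (parabolic_time t powr (- s / 2) * sobolev_norm s u\<^sub>0 + parabolic_time t powr (- (s - 1) / 2) * sobolev_norm (s - 1) u\<^sub>1)"
    if sol: "sobolev_solution b g u\<^sub>0 u\<^sub>1 u v" and u0: "u\<^sub>0 \<in> sobolev_H s" and u1: "u\<^sub>1 \<in> sobolev_H (s - 1)"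
      and t: "t \<ge> 0" for u\<^sub>0 u\<^sub>1 :: "'a \<Rightarrow> complex" and u v t
  proof -
    obtain U V W where UV: "\<forall>t\<ge>0. fourier_L2 (u t) (U t) \<and> fourier_L2 (v t) (V t)"
      and init: "fourier_L2 u\<^sub>0 (U 0)" "fourier_L2 u\<^sub>1 (V 0)"
      and ode: "AE \<xi> in lborel. \<forall>t\<ge>0.
           ((\<lambda>s. U s \<xi>) has_vector_derivative V t \<xi>) (at t within {0..}) \<and>
           ((\<lambda>s. V s \<xi>) has_vector_derivative W t \<xi>) (at t within {0..}) \<and>
           W t \<xi> + complex_of_real ((norm \<xi>)\<^sup>2) * U t \<xi>
             + complex_of_real (b t + g t * (norm \<xi>)\<^sup>2) * V t \<xi> = 0"
      using sol unfolding sobolev_solution_def by blast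
    define c\<^sub>0 c\<^sub>1 where "c\<^sub>0 = C * parabolic_time t powr (- s / 2)" and "c\<^sub>1 = C * parabolic_time t powr (- (s - 1) / 2)"
    have c: "c\<^sub>0 \<ge> 0" "c\<^sub>1 \<ge> 0" using C by (auto simp: c\<^sub>0_def c\<^sub>1_def)
    have dom: "u\<^sub>0 \<in> multiplier_domain (bessel_symbol s)" "u\<^sub>1 \<in> multiplier_domain (bessel_symbol (s - 1))"
      using u0 u1 by (auto simp: sobolev_H_def)
    have main: "AE \<xi> in lborel. norm \<xi> powr (s - 1) * sqrt ((cmod (V t \<xi>))\<^sup>2 + (norm \<xi>)\<^sup>2 * (cmod (U t \<xi>))\<^sup>2)
        \<le> c\<^sub>0 * (\<bar>bessel_symbol s \<xi>\<bar> * cmod (U 0 \<xi>)) + c\<^sub>1 * (\<bar>bessel_symbol (s - 1) \<xi>\<bar> * cmod (V 0 \<xi>))"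
      using ode AE_lborel_singleton[of "0::'a"]
    proof eventually_elim
      case (elim \<xi>)
      then have "norm \<xi> > 0" by simp
      from freq[rule_format, OF this, of "\<lambda>s. U s \<xi>" "\<lambda>s. V s \<xi>" "\<lambda>s. W s \<xi>" t] elim(1) t
      have "norm \<xi> powr (s - 1) * sqrt ((cmod (V t \<xi>))\<^sup>2 + (norm \<xi>)\<^sup>2 * (cmod (U t \<xi>))\<^sup>2)
        \<le> C * (parabolic_time t powr (- s / 2) * ((1 + (norm \<xi>)\<^sup>2) powr (s / 2) * cmod (U 0 \<xi>))
           + parabolic_time t powr (- (s - 1) / 2) * ((1 + (norm \<xi>)\<^sup>2) powr ((s - 1) / 2) * cmod (V 0 \<xi>)))"
        by blast
      then show ?case by (simp add: bessel_symbol_def c\<^sub>0_def c\<^sub>1_def distrib_left mult.assoc)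
    qed
    have U_le: "AE \<xi> in lborel. \<bar>abs_symbol s \<xi>\<bar> * cmod (U t \<xi>)
        \<le> c\<^sub>0 * (\<bar>bessel_symbol s \<xi>\<bar> * cmod (U 0 \<xi>)) + c\<^sub>1 * (\<bar>bessel_symbol (s - 1) \<xi>\<bar> * cmod (V 0 \<xi>))"
      using main AE_lborel_singleton[of "0::'a"]
    proof eventually_elim
      case (elim \<xi>)
      have "norm \<xi> powr s = norm \<xi> powr (s - 1) * norm \<xi>"
        using elim(2) powr_add[of "norm \<xi>" "s - 1" 1] by simp
      moreover have "norm \<xi> * cmod (U t \<xi>) \<le> sqrt ((cmod (V t \<xi>))\<^sup>2 + (norm \<xi>)\<^sup>2 * (cmod (U t \<xi>))\<^sup>2)"
        by (rule real_le_rsqrt) (simp add: power_mult_distrib)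
      ultimately have "\<bar>abs_symbol s \<xi>\<bar> * cmod (U t \<xi>)
          \<le> norm \<xi> powr (s - 1) * sqrt ((cmod (V t \<xi>))\<^sup>2 + (norm \<xi>)\<^sup>2 * (cmod (U t \<xi>))\<^sup>2)"
        by (simp add: abs_symbol_def mult.assoc mult_left_mono)
      with elim(1) show ?case by (rule order_trans[rotated])
    qed
    have V_le: "AE \<xi> in lborel. \<bar>abs_symbol (s - 1) \<xi>\<bar> * cmod (V t \<xi>)
        \<le> c\<^sub>0 * (\<bar>bessel_symbol s \<xi>\<bar> * cmod (U 0 \<xi>)) + c\<^sub>1 * (\<bar>bessel_symbol (s - 1) \<xi>\<bar> * cmod (V 0 \<xi>))"
      using main
    proof eventually_elim
      case (elim \<xi>)
      have "cmod (V t \<xi>) \<le> sqrt ((cmod (V t \<xi>))\<^sup>2 + (norm \<xi>)\<^sup>2 * (cmod (U t \<xi>))\<^sup>2)"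
        by (rule real_le_rsqrt) simp
      then have "\<bar>abs_symbol (s - 1) \<xi>\<bar> * cmod (V t \<xi>)
          \<le> norm \<xi> powr (s - 1) * sqrt ((cmod (V t \<xi>))\<^sup>2 + (norm \<xi>)\<^sup>2 * (cmod (U t \<xi>))\<^sup>2)"
        by (simp add: abs_symbol_def mult_left_mono)
      with elim show ?case by (rule order_trans[rotated])
    qed
    have UVt: "fourier_L2 (u t) (U t)" "fourier_L2 (v t) (V t)" using UV t by auto
    note est_U = multiplier_estimate[OF UVt(1) init abs_symbol_measurable bessel_symbol_measurable
        bessel_symbol_measurable dom c U_le]
    note est_V = multiplier_estimate[OF UVt(2) init abs_symbol_measurable bessel_symbol_measurable
        bessel_symbol_measurable dom c V_le]
    show ?thesis
      using est_U est_V by (simp add: c\<^sub>0_def c\<^sub>1_def sobolev_norm_def distrib_left mult.assoc)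
  qed
  then show ?thesis using C by blast
qed

theorem theorem4p2:
  fixes b b' b'' g g' :: "real \<Rightarrow> real" and a \<epsilon>\<^sub>0 :: real
  assumes b_pos: "\<And>t. t \<ge> 0 \<Longrightarrow> b t > 0"
    and B1: "\<And>t. t \<ge> 0 \<Longrightarrow> (b has_real_derivative b' t) (at t within {0..})"
            "\<And>t. t \<ge> 0 \<Longrightarrow> (b' has_real_derivative b'' t) (at t within {0..})"
            "continuous_on {0..} b''"
    and B2: "(\<forall>t\<ge>0. b' t \<ge> 0) \<or> (\<forall>t\<ge>0. b' t \<le> 0)"
            "filterlim (\<lambda>t. t * b t) at_top at_top"
    and B3: "\<exists>C>0. \<forall>t\<ge>0. \<bar>b' t\<bar> / b t \<le> C * (1 / (1 + t))"
            "\<exists>C>0. \<forall>t\<ge>0. \<bar>b'' t\<bar> / b t \<le> C * (1 / (1 + t)\<^sup>2)"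
    and EF: "a < 1" "\<And>t. t \<ge> 0 \<Longrightarrow> \<bar>b' t\<bar> \<le> a * (b t)\<^sup>2"
    and g_deriv: "\<And>t. t \<ge> 0 \<Longrightarrow> (g has_real_derivative g' t) (at t within {0..})"
    and E1: "\<And>t. t \<ge> 0 \<Longrightarrow> g t > 0" "\<And>t. t \<ge> 0 \<Longrightarrow> g' t < 0"
    and E2: "g absolutely_integrable_on {0..}"
    and E3: "\<And>t. t \<ge> 0 \<Longrightarrow> b t * g t \<le> 1 / 2"
    and E4: "\<And>t. t \<ge> 0 \<Longrightarrow> b' t / b t \<le> - (g' t / g t)"
    and E5: "(\<lambda>t. (g' t)\<^sup>2 / g t) absolutely_integrable_on {0..}"
    and eps: "\<epsilon>\<^sub>0 > 0" "\<And>t. t \<ge> 0 \<Longrightarrow> - g' t \<le> 2 - \<epsilon>\<^sub>0"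
  shows "\<exists>t\<^sub>0\<ge>0.
    (\<forall>s\<ge>1. \<exists>C>0. \<forall>(u\<^sub>0 :: real ^ 'n \<Rightarrow> complex) u\<^sub>1 u v.
       sobolev_solution b g u\<^sub>0 u\<^sub>1 u v \<longrightarrow> u\<^sub>0 \<in> sobolev_H s \<longrightarrow> u\<^sub>1 \<in> sobolev_H (s - 1) \<longrightarrow>
       (\<forall>t\<ge>t\<^sub>0.
          u t \<in> multiplier_domain (abs_symbol s) \<and>
          L2_norm (multiplier (abs_symbol s) (u t)) \<le>
            C * ((1 + integral {t\<^sub>0..t} (\<lambda>\<tau>. 1 / b \<tau>)) powr (- s / 2) * sobolev_norm s u\<^sub>0
               + (1 + integral {t\<^sub>0..t} (\<lambda>\<tau>. 1 / b \<tau>)) powr (- (s - 1) / 2) * sobolev_norm (s - 1) u\<^sub>1)))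
    \<and>
    (\<forall>s\<ge>0. \<exists>C>0. \<forall>(u\<^sub>0 :: real ^ 'n \<Rightarrow> complex) u\<^sub>1 u v.
       sobolev_solution b g u\<^sub>0 u\<^sub>1 u v \<longrightarrow> u\<^sub>0 \<in> sobolev_H (s + 1) \<longrightarrow> u\<^sub>1 \<in> sobolev_H s \<longrightarrow>
       (\<forall>t\<ge>t\<^sub>0.
          v t \<in> multiplier_domain (abs_symbol s) \<and>
          L2_norm (multiplier (abs_symbol s) (v t)) \<le>
            C * ((1 + integral {t\<^sub>0..t} (\<lambda>\<tau>. 1 / b \<tau>)) powr (- (s + 1) / 2) * sobolev_norm (s + 1) u\<^sub>0
               + (1 + integral {t\<^sub>0..t} (\<lambda>\<tau>. 1 / b \<tau>)) powr (- s / 2) * sobolev_norm s u\<^sub>1)))"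
proof -
  have b'_le: "\<bar>b' t\<bar> \<le> (b t)\<^sup>2" if "t \<ge> 0" for t
    using EF(2)[OF that] mult_right_mono[of a 1 "(b t)\<^sup>2"] EF(1) by simp
  interpret effective_damping b b' g g'
    by unfold_locales (use assms b'_le in auto)
  show ?thesis
  \<comment> \<open>The energy bound holds from the initial time on.\<close>
  proof (rule exI[of _ 0], intro conjI allI impI order_refl)
    fix s :: real assume "s \<ge> 1"
    from sobolev_solution_estimate[OF this, where 'a = "real ^ 'n"]
    show "\<exists>C>0. \<forall>(u\<^sub>0 :: real ^ 'n \<Rightarrow> complex) u\<^sub>1 u v.
       sobolev_solution b g u\<^sub>0 u\<^sub>1 u v \<longrightarrow> u\<^sub>0 \<in> sobolev_H s \<longrightarrow> u\<^sub>1 \<in> sobolev_H (s - 1) \<longrightarrow>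
       (\<forall>t\<ge>0. u t \<in> multiplier_domain (abs_symbol s) \<and>
          L2_norm (multiplier (abs_symbol s) (u t)) \<le>
            C * ((1 + integral {0..t} (\<lambda>\<tau>. 1 / b \<tau>)) powr (- s / 2) * sobolev_norm s u\<^sub>0
               + (1 + integral {0..t} (\<lambda>\<tau>. 1 / b \<tau>)) powr (- (s - 1) / 2) * sobolev_norm (s - 1) u\<^sub>1))"
      unfolding parabolic_time_def by (elim ex_forward conj_forward) auto
  next
    fix s :: real assume "s \<ge> 0"
    then have "s + 1 \<ge> 1" by simp
    from sobolev_solution_estimate[OF this, where 'a = "real ^ 'n"]
    show "\<exists>C>0. \<forall>(u\<^sub>0 :: real ^ 'n \<Rightarrow> complex) u\<^sub>1 u v.
       sobolev_solution b g u\<^sub>0 u\<^sub>1 u v \<longrightarrow> u\<^sub>0 \<in> sobolev_H (s + 1) \<longrightarrow> u\<^sub>1 \<in> sobolev_H s \<longrightarrow>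
       (\<forall>t\<ge>0. v t \<in> multiplier_domain (abs_symbol s) \<and>
          L2_norm (multiplier (abs_symbol s) (v t)) \<le>
            C * ((1 + integral {0..t} (\<lambda>\<tau>. 1 / b \<tau>)) powr (- (s + 1) / 2) * sobolev_norm (s + 1) u\<^sub>0
               + (1 + integral {0..t} (\<lambda>\<tau>. 1 / b \<tau>)) powr (- s / 2) * sobolev_norm s u\<^sub>1))"
      unfolding parabolic_time_def add_diff_cancel_right' by (elim ex_forward conj_forward) auto
  qed
qed

end
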